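(* Let $H$ be a Hopf algebra over an arbitrary field $\Bbbk$ with the dual Chevalley property. Denote the set of all the simple subcoalgebras of $H$ by $\mathcal{S}$. Then: (1) For any $C\in\mathcal{S}$, $H_{(C)}=CH_{(1)}=H_{(1)}C$; (2) For any $C,D\in\mathcal{S}$, $H_{(C)}H_{(D)}\subseteq\sum_{E\in\mathcal{S},\;E\subseteq CD}H_{(E)}$; (3) $H_{(1)}$ is a Hopf subalgebra of $H$.
   Context: The coradical $H_0$ of a coalgebra $H$ is the sum of all its simple subcoalgebras. A Hopf algebra $H$ (possibly infinite-dimensional) has the dual Chevalley property if $H_0$ is a Hopf subalgebra of $H$. For subspaces $X,Y$ of a coalgebra $H$, $X\wedge Y=\Delta^{-1}(X\otimes H+H\otimes Y)$. Simple subcoalgebras $C,D$ of $H$ are directly linked in $H$ if $C+D\subsetneq C\wedge D+D\wedge C$. They are linked in $H$ if there are $n\in\mathbb{N}$ (with $n=0$ allowed) and simple subcoalgebras $E_0,\dots,E_n$ with $C=E_0$, $D=E_n$ and $E_i,E_{i+1}$ directly linked in $H$ for $0\le i<n$; this is an equivalence relation. A subcoalgebra $H'\subseteq H$ is link-indecomposable if any two simple subcoalgebras of $H'$ are linked in $H'$; a link-indecomposable component of $H$ is a maximal link-indecomposable subcoalgebra. It is known that $H$ is the direct sum of its link-indecomposable components. $H_{(C)}$ denotes the link-indecomposable component containing the simple subcoalgebra $C$, and $H_{(1)}:=H_{(\Bbbk 1)}$ is the one containing the unit element $1$. The product of two subspaces is the linear span of the products of their elements. *)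

theory Defs
  imports Complex_Main "HOL-Library.Poly_Mapping" "HOL-Library.Set_Algebras"
begin

section \<open>Free vector spaces\<close>

text \<open>The free vector space on a type \<open>'a\<close> over a field \<open>'k\<close> is the type of finitely supported
  functions \<open>'a \<Rightarrow>\<^sub>0 'k\<close>.\<close>

definition fscale :: "'k::field \<Rightarrow> ('a \<Rightarrow>\<^sub>0 'k) \<Rightarrow> ('a \<Rightarrow>\<^sub>0 'k)" where
  "fscale c p = Poly_Mapping.map ((*) c) p"

lemma lookup_fscale [simp]: "Poly_Mapping.lookup (fscale c p) x = c * Poly_Mapping.lookup p x"
  by (simp add: fscale_def Poly_Mapping.map.rep_eq when_def)

interpretation free: vector_space "fscale :: 'k::field \<Rightarrow> ('a \<Rightarrow>\<^sub>0 'k) \<Rightarrow> ('a \<Rightarrow>\<^sub>0 'k)"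
  by unfold_locales (auto intro!: poly_mapping_eqI simp: lookup_add algebra_simps)

abbreviation gen :: "'a \<Rightarrow> ('a \<Rightarrow>\<^sub>0 'k::field)" where
  "gen x \<equiv> Poly_Mapping.single x 1"

text \<open>Linear extension of a map defined on the generators, with values in a vector space with
  scalar multiplication \<open>s\<close>.\<close>

definition lin_ext :: "('k::field \<Rightarrow> 'v \<Rightarrow> 'v) \<Rightarrow> ('a \<Rightarrow> 'v) \<Rightarrow> ('a \<Rightarrow>\<^sub>0 'k) \<Rightarrow> 'v::ab_group_add" where
  "lin_ext s f p = (\<Sum>x\<in>Poly_Mapping.keys p. s (Poly_Mapping.lookup p x) (f x))"


section \<open>Tensor products\<close>

text \<open>\<open>H \<otimes> H\<close> and \<open>H \<otimes> H \<otimes> H\<close> are the quotients of the free vector spaces on \<open>H \<times> H\<close> and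
  \<open>H \<times> H \<times> H\<close> by the subspaces spanned by the multilinearity relations.  Since these subspaces
  depend on the scalar multiplication, the quotients are not formed as types: their elements are
  given by representatives (formal sums), and equality is congruence modulo the relations.\<close>

locale tensor_space = vector_space scale
  for scale :: "'a::field \<Rightarrow> 'b::ab_group_add \<Rightarrow> 'b" (infixr \<open>*s\<close> 75)
begin

definition tensor2_rel :: "(('b \<times> 'b) \<Rightarrow>\<^sub>0 'a) set" where
  "tensor2_rel = free.span
     ({gen (x + x', y) - (gen (x, y) + gen (x', y)) | x x' y. True} \<union>
      {gen (x, y + y') - (gen (x, y) + gen (x, y')) | x y y'. True} \<union>
      {gen (c *s x, y) - fscale c (gen (x, y)) | c x y. True} \<union>
      {gen (x, c *s y) - fscale c (gen (x, y)) | c x y. True})"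

definition tensor3_rel :: "(('b \<times> 'b \<times> 'b) \<Rightarrow>\<^sub>0 'a) set" where
  "tensor3_rel = free.span
     ({gen (x + x', y, z) - (gen (x, y, z) + gen (x', y, z)) | x x' y z. True} \<union>
      {gen (x, y + y', z) - (gen (x, y, z) + gen (x, y', z)) | x y y' z. True} \<union>
      {gen (x, y, z + z') - (gen (x, y, z) + gen (x, y, z')) | x y z z'. True} \<union>
      {gen (c *s x, y, z) - fscale c (gen (x, y, z)) | c x y z. True} \<union>
      {gen (x, c *s y, z) - fscale c (gen (x, y, z)) | c x y z. True} \<union>
      {gen (x, y, c *s z) - fscale c (gen (x, y, z)) | c x y z. True})"

definition teq2 :: "(('b \<times> 'b) \<Rightarrow>\<^sub>0 'a) \<Rightarrow> (('b \<times> 'b) \<Rightarrow>\<^sub>0 'a) \<Rightarrow> bool" where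
  "teq2 p q \<longleftrightarrow> p - q \<in> tensor2_rel"

definition teq3 :: "(('b \<times> 'b \<times> 'b) \<Rightarrow>\<^sub>0 'a) \<Rightarrow> (('b \<times> 'b \<times> 'b) \<Rightarrow>\<^sub>0 'a) \<Rightarrow> bool" where
  "teq3 p q \<longleftrightarrow> p - q \<in> tensor3_rel"

text \<open>The image of \<open>X \<otimes> Y\<close> in \<open>H \<otimes> H\<close>, as the set of all its representatives.  Over a field
  \<open>X \<otimes> Y \<rightarrow> H \<otimes> H\<close> is injective for subspaces \<open>X\<close>, \<open>Y\<close>.\<close>

definition tensor_sub :: "'b set \<Rightarrow> 'b set \<Rightarrow> (('b \<times> 'b) \<Rightarrow>\<^sub>0 'a) set" where
  "tensor_sub X Y = {t. \<exists>p. Poly_Mapping.keys p \<subseteq> X \<times> Y \<and> teq2 t p}"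

end


section \<open>Coalgebras\<close>

text \<open>\<open>\<Delta> h\<close> is a representative of the comultiplication of \<open>h\<close>; the axioms, and all notions
  defined below, depend only on its class in \<open>H \<otimes> H\<close>.\<close>

locale coalgebra = tensor_space scale
  for scale :: "'k::field \<Rightarrow> 'h::ab_group_add \<Rightarrow> 'h" (infixr \<open>*s\<close> 75) +
  fixes \<Delta> :: "'h \<Rightarrow> (('h \<times> 'h) \<Rightarrow>\<^sub>0 'k)" and \<epsilon> :: "'h \<Rightarrow> 'k"
  assumes comult_add: "teq2 (\<Delta> (x + y)) (\<Delta> x + \<Delta> y)"
    and comult_scale: "teq2 (\<Delta> (c *s x)) (fscale c (\<Delta> x))"
    and counit_linear: "Vector_Spaces.linear scale (*) \<epsilon>"
    and coassoc: "teq3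
        (lin_ext fscale (\<lambda>(a, b). lin_ext fscale (\<lambda>(a', a''). gen (a', a'', b)) (\<Delta> a)) (\<Delta> x))
        (lin_ext fscale (\<lambda>(a, b). lin_ext fscale (\<lambda>(b', b''). gen (a, b', b'')) (\<Delta> b)) (\<Delta> x))"
    and counit_left: "lin_ext scale (\<lambda>(a, b). \<epsilon> a *s b) (\<Delta> x) = x"
    and counit_right: "lin_ext scale (\<lambda>(a, b). \<epsilon> b *s a) (\<Delta> x) = x"
begin

definition subcoalgebra :: "'h set \<Rightarrow> bool" where
  "subcoalgebra P \<longleftrightarrow> subspace P \<and> (\<forall>x\<in>P. \<Delta> x \<in> tensor_sub P P)"

definition simple_subcoalgebra :: "'h set \<Rightarrow> bool" where
  "simple_subcoalgebra C \<longleftrightarrow> subcoalgebra C \<and> C \<noteq> {0} \<and>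
     (\<forall>D. subcoalgebra D \<and> D \<subseteq> C \<longrightarrow> D = {0} \<or> D = C)"

definition coradical :: "'h set" where
  "coradical = span (\<Union>{C. simple_subcoalgebra C})"

text \<open>The following notions are relative to a subcoalgebra \<open>P\<close>, regarded as a coalgebra on its
  own; \<open>P = UNIV\<close> gives those for the whole coalgebra.  The simple subcoalgebras of \<open>P\<close>
  are the simple subcoalgebras contained in \<open>P\<close>.\<close>

definition wedge :: "'h set \<Rightarrow> 'h set \<Rightarrow> 'h set \<Rightarrow> 'h set" where
  "wedge P X Y = {h \<in> P. \<Delta> h \<in> tensor_sub X P + tensor_sub P Y}"

definition directly_linked :: "'h set \<Rightarrow> 'h set \<Rightarrow> 'h set \<Rightarrow> bool" where
  "directly_linked P C D \<longleftrightarrow> C + D \<subset> wedge P C D + wedge P D C"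

definition linked :: "'h set \<Rightarrow> 'h set \<Rightarrow> 'h set \<Rightarrow> bool" where
  "linked P C D \<longleftrightarrow> (\<exists>(n::nat) E.
     (\<forall>i\<le>n. simple_subcoalgebra (E i) \<and> E i \<subseteq> P) \<and> E 0 = C \<and> E n = D \<and>
     (\<forall>i<n. directly_linked P (E i) (E (Suc i))))"

definition link_indecomposable :: "'h set \<Rightarrow> bool" where
  "link_indecomposable P \<longleftrightarrow> subcoalgebra P \<and>
     (\<forall>C D. simple_subcoalgebra C \<and> C \<subseteq> P \<and> simple_subcoalgebra D \<and> D \<subseteq> P \<longrightarrow> linked P C D)"

definition link_component :: "'h set \<Rightarrow> bool" where
  "link_component P \<longleftrightarrow> link_indecomposable P \<and>
     (\<forall>Q. link_indecomposable Q \<and> P \<subseteq> Q \<longrightarrow> Q = P)"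

text \<open>The component \<open>H\<^bsub>(C)\<^esub>\<close>.  Its existence and uniqueness for simple \<open>C\<close> are not built into
  the definition.\<close>

definition component_of :: "'h set \<Rightarrow> 'h set" where
  "component_of C = (THE P. link_component P \<and> C \<subseteq> P)"

end


section \<open>Hopf algebras\<close>

locale hopf_algebra = coalgebra scale \<Delta> \<epsilon>
  for scale :: "'k::field \<Rightarrow> 'h::ring_1 \<Rightarrow> 'h" (infixr \<open>*s\<close> 75)
    and \<Delta> :: "'h \<Rightarrow> (('h \<times> 'h) \<Rightarrow>\<^sub>0 'k)" and \<epsilon> :: "'h \<Rightarrow> 'k" +
  fixes S :: "'h \<Rightarrow> 'h"
  assumes mult_scale_left: "(c *s x) * y = c *s (x * y)"
    and mult_scale_right: "x * (c *s y) = c *s (x * y)"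
    and comult_mult: "teq2 (\<Delta> (x * y))
        (lin_ext fscale (\<lambda>(a, b). lin_ext fscale (\<lambda>(c, d). gen (a * c, b * d)) (\<Delta> y)) (\<Delta> x))"
    and comult_one: "teq2 (\<Delta> 1) (gen (1, 1))"
    and counit_mult: "\<epsilon> (x * y) = \<epsilon> x * \<epsilon> y"
    and counit_one: "\<epsilon> 1 = 1"
    and antipode_linear: "Vector_Spaces.linear scale scale S"
    and antipode_left: "lin_ext scale (\<lambda>(a, b). S a * b) (\<Delta> x) = \<epsilon> x *s 1"
    and antipode_right: "lin_ext scale (\<lambda>(a, b). a * S b) (\<Delta> x) = \<epsilon> x *s 1"
begin

definition hopf_subalgebra :: "'h set \<Rightarrow> bool" where
  "hopf_subalgebra A \<longleftrightarrow> subcoalgebra A \<and> 1 \<in> A \<and> (\<forall>x\<in>A. \<forall>y\<in>A. x * y \<in> A) \<and> (\<forall>x\<in>A. S x \<in> A)"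

definition dual_chevalley :: bool where
  "dual_chevalley \<longleftrightarrow> hopf_subalgebra coradical"

definition subspace_prod :: "'h set \<Rightarrow> 'h set \<Rightarrow> 'h set" where
  "subspace_prod X Y = span {x * y | x y. x \<in> X \<and> y \<in> Y}"

text \<open>\<open>H\<^bsub>(1)\<^esub>\<close>, the component of the simple subcoalgebra \<open>k1\<close>.\<close>

definition unit_component :: "'h set" where
  "unit_component = component_of (span {1})"

end

end

theory Submission
  imports Defs
begin

text \<open>
  The dual algebra \<open>H\<^sup>*\<close> acts on \<open>H\<close> from both sides, and everything about coalgebras is phrased
  through these two actions.  For a union \<open>T\<close> of link classes, \<open>H\<close> is the direct sum of the
  components in \<open>T\<close> and of those outside \<open>T\<close>, so there is a central idempotent functional \<open>u\<close> that
  vanishes on the former and agrees with \<open>\<epsilon>\<close> on the latter.  The heart of the matter is that, for a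
  subcoalgebra \<open>F\<close> of the coradical, \<open>u(F C) = 0\<close> forces \<open>u(F D) = 0\<close> whenever \<open>C\<close> and \<open>D\<close> are
  directly linked.  Centrality gives \<open>x\<^sub>1 u(f x\<^sub>2) = S(f\<^sub>1) u(f\<^sub>2 x\<^sub>1) f\<^sub>3 x\<^sub>2\<close>, which lies in the
  coradical for \<open>x \<in> C \<and> D\<close>; the functionals that map \<open>C \<and> D\<close> into the coradical form a two-sided
  ideal, and the dual of \<open>D\<close> is a simple algebra, so if \<open>u(F D) \<noteq> 0\<close> then \<open>C \<and> D\<close> is contained in
  the coradical.  The same holds for \<open>D \<and> C\<close>, by an analogous identity that needs \<open>F = S(F')\<close>,
  which is available because the integral of the coradical shows \<open>S\<^sup>2(C) = C\<close> for simple \<open>C\<close>.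
  Hence \<open>C H\<^bsub>(1)\<^esub>\<close> lies in \<open>H\<^bsub>(C)\<^esub>\<close>.  Conversely \<open>e(S(c) x\<^sub>1) x\<^sub>2\<close> lies in \<open>C H\<^bsub>(1)\<^esub>\<close> for the central
  idempotent \<open>e\<close> of \<open>H\<^bsub>(1)\<^esub>\<close>, and the same ideal argument shows that \<open>C H\<^bsub>(1)\<^esub>\<close> is closed under wedges
  with the simple subcoalgebras of \<open>H\<^bsub>(C)\<^esub>\<close>.
\<close>

section \<open>Linear maps, functionals and projections\<close>

text \<open>\<open>H\<close> may be infinite-dimensional, and invertibility of \<open>S\<close> is
  not among the assumptions; these two facts shape the proof. Over a field a subspace is the common
  kernel of its annihilator, so conditions on coproducts are tested by functionals, and a wedge
  becomes the annihilator of a convolution product. Instead of exhausting \<open>H\<close> by the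
  coradical filtration, a subcoalgebra \<open>U\<close> that misses part of \<open>P\<close> is
  enlarged by a wedge with one simple subcoalgebra of \<open>P\<close>. The antipode is used only
  through S(a_1) a_2 and a_1 S(a_2). To cancel f_2 in u(f_1 x_1) f_2 x_2 one would need the inverse
  of \<open>S\<close>, unless f itself has the form S(g); this is the origin of \<open>S(F)\<close>
  in the key step. Mirror images come from reversing product and coproduct together, which keeps
  \<open>S\<close> as the antipode. The dual Chevalley property enters where products with elements
  of \<open>F\<close> must stay in the coradical, and through the integral.\<close>

context tensor_space
begin

definition lin :: "('b \<Rightarrow> 'b) \<Rightarrow> bool" where
  "lin f \<longleftrightarrow> (\<forall>x y. f (x + y) = f x + f y) \<and> (\<forall>c x. f (scale c x) = scale c (f x))"

definition fnl :: "('b \<Rightarrow> 'a) \<Rightarrow> bool" where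
  "fnl f \<longleftrightarrow> (\<forall>x y. f (x + y) = f x + f y) \<and> (\<forall>c x. f (scale c x) = c * f x)"

definition bilin :: "('b \<Rightarrow> 'b \<Rightarrow> 'b) \<Rightarrow> bool" where
  "bilin B \<longleftrightarrow> (\<forall>b. lin (\<lambda>a. B a b)) \<and> (\<forall>a. lin (B a))"

definition perp :: "'b set \<Rightarrow> ('b \<Rightarrow> 'a) \<Rightarrow> bool" where
  "perp P f \<longleftrightarrow> fnl f \<and> (\<forall>p\<in>P. f p = 0)"

lemma linI: "(\<And>x y. f (x + y) = f x + f y) \<Longrightarrow> (\<And>c x. f (scale c x) = scale c (f x)) \<Longrightarrow> lin f"
  by (simp add: lin_def)

lemma fnlI: "(\<And>x y. f (x + y) = f x + f y) \<Longrightarrow> (\<And>c x. f (scale c x) = c * f x) \<Longrightarrow> fnl f"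
  by (simp add: fnl_def)

lemma bilinI: "(\<And>b. lin (\<lambda>a. B a b)) \<Longrightarrow> (\<And>a. lin (\<lambda>b. B a b)) \<Longrightarrow> bilin (\<lambda>a b. B a b)"
  by (simp add: bilin_def)

lemma bilinD: "bilin B \<Longrightarrow> lin (\<lambda>a. B a b)" "bilin B \<Longrightarrow> lin (B a)"
  by (auto simp: bilin_def)

lemma bilin_flip: "bilin B \<Longrightarrow> bilin (\<lambda>a b. B b a)"
  by (auto simp: bilin_def)

lemma lin_add: "lin f \<Longrightarrow> f (x + y) = f x + f y"
  and lin_scale: "lin f \<Longrightarrow> f (scale c x) = scale c (f x)"
  by (auto simp: lin_def)

lemma fnl_add: "fnl f \<Longrightarrow> f (x + y) = f x + f y"
  and fnl_scale: "fnl f \<Longrightarrow> f (scale c x) = c * f x"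
  by (auto simp: fnl_def)

lemma lin_0: "lin f \<Longrightarrow> f 0 = 0"
  using lin_scale[of f 0 0] by simp

lemma fnl_0: "fnl f \<Longrightarrow> f 0 = 0"
  using fnl_scale[of f 0 0] by simp

lemma lin_diff: "lin f \<Longrightarrow> f (x - y) = f x - f y"
  using lin_add[of f "x - y" y] by (simp add: algebra_simps)

lemma fnl_diff: "fnl f \<Longrightarrow> f (x - y) = f x - f y"
  using fnl_add[of f "x - y" y] by (simp add: algebra_simps)

lemma lin_sum: "lin f \<Longrightarrow> f (sum g I) = (\<Sum>i\<in>I. f (g i))"
  by (induction I rule: infinite_finite_induct) (auto simp: lin_0 lin_add)

lemma fnl_sum: "fnl f \<Longrightarrow> f (sum g I) = (\<Sum>i\<in>I. f (g i))"
  by (induction I rule: infinite_finite_induct) (auto simp: fnl_0 fnl_add)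

lemma lin_linear: "lin f \<longleftrightarrow> Vector_Spaces.linear scale scale f"
  unfolding lin_def Vector_Spaces.linear_def module_hom_def module_hom_axioms_def
  using vector_space_axioms module_axioms by auto

lemma vector_space_field: "vector_space ((*) :: 'a \<Rightarrow> 'a \<Rightarrow> 'a)"
  by unfold_locales (auto simp: algebra_simps)

lemma fnl_linear: "fnl f \<longleftrightarrow> Vector_Spaces.linear scale (*) f"
  unfolding fnl_def Vector_Spaces.linear_def module_hom_def module_hom_axioms_def
  using vector_space_axioms module_axioms vector_space_field
  by (auto simp: module_iff_vector_space)

lemma lin_id: "lin (\<lambda>x. x)"
  and lin_const_zero: "lin (\<lambda>x. 0)"
  and fnl_const_zero: "fnl (\<lambda>x. 0)"
  by (auto simp: lin_def fnl_def)

lemma lin_plus: "lin f \<Longrightarrow> lin g \<Longrightarrow> lin (\<lambda>x. f x + g x)"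
  and lin_minus: "lin f \<Longrightarrow> lin g \<Longrightarrow> lin (\<lambda>x. f x - g x)"
  and lin_cscale: "lin f \<Longrightarrow> lin (\<lambda>x. scale c (f x))"
  and lin_fscale: "fnl h \<Longrightarrow> lin (\<lambda>x. scale (h x) v)"
  by (auto simp: lin_def fnl_def algebra_simps)

lemma fnl_plus: "fnl f \<Longrightarrow> fnl g \<Longrightarrow> fnl (\<lambda>x. f x + g x)"
  and fnl_minus: "fnl f \<Longrightarrow> fnl g \<Longrightarrow> fnl (\<lambda>x. f x - g x)"
  and fnl_cmult: "fnl f \<Longrightarrow> fnl (\<lambda>x. c * f x)"
  and fnl_multc: "fnl f \<Longrightarrow> fnl (\<lambda>x. f x * c)"
  by (auto simp: fnl_def algebra_simps)

lemma lin_comp: "lin f \<Longrightarrow> lin g \<Longrightarrow> lin (\<lambda>x. f (g x))"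
  and fnl_comp: "fnl h \<Longrightarrow> lin g \<Longrightarrow> fnl (\<lambda>x. h (g x))"
  by (auto simp: lin_def fnl_def)

lemma bilin_minus: "bilin B \<Longrightarrow> bilin B' \<Longrightarrow> bilin (\<lambda>a b. B a b - B' a b)"
  by (auto simp: bilin_def intro!: lin_minus)

lemma bilin_0: "bilin B \<Longrightarrow> B 0 b = 0" "bilin B \<Longrightarrow> B a 0 = 0"
  using lin_0[OF bilinD(1)] lin_0[OF bilinD(2)] by auto

lemma subspace_sumset: "subspace X \<Longrightarrow> subspace Y \<Longrightarrow> subspace (X + Y)"
proof -
  assume "subspace X" "subspace Y"
  moreover have "X + Y = {x + y |x y. x \<in> X \<and> y \<in> Y}" by (auto simp: set_plus_def)
  ultimately show ?thesis using subspace_sums[of X Y] by simp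
qed

lemma sumset_subset: "subspace Z \<Longrightarrow> X \<subseteq> Z \<Longrightarrow> Y \<subseteq> Z \<Longrightarrow> X + Y \<subseteq> Z"
  by (auto simp: set_plus_def intro: subspace_add)

lemma subset_sumset1: "subspace Y \<Longrightarrow> X \<subseteq> X + Y"
  by (metis add.right_neutral set_plus_intro subsetI subspace_0)

lemma subset_sumset2: "subspace X \<Longrightarrow> Y \<subseteq> X + Y"
  by (metis add.left_neutral set_plus_intro subsetI subspace_0)

lemma lin_image_subspace: "lin f \<Longrightarrow> subspace P \<Longrightarrow> subspace (f ` P)"
  using module_hom.subspace_image[of scale scale f P]
  by (simp add: lin_linear Vector_Spaces.linear_def)

lemma lin_vimage_subspace: "lin f \<Longrightarrow> subspace P \<Longrightarrow> subspace {x. f x \<in> P}"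
  unfolding subspace_def by (auto simp: lin_0 lin_add lin_scale)

lemma fnl_kernel_subspace: "fnl f \<Longrightarrow> subspace {x. f x = 0}"
  unfolding subspace_def by (auto simp: fnl_0 fnl_add fnl_scale)

section \<open>Projections and separating functionals\<close>

lemma ex_projection:
  assumes "subspace P"
  shows "\<exists>p. lin p \<and> range p \<subseteq> P \<and> (\<forall>x\<in>P. p x = x)"
proof -
  interpret vector_space_pair scale scale by unfold_locales
  have "Vector_Spaces.linear scale scale (\<lambda>x. x)" using lin_id lin_linear by blast
  from linear_exists_left_inverse_on[OF this assms] show ?thesis
    by (auto simp: lin_linear inj_on_def)
qed

text \<open>Subtracting a projection onto \<open>P\<close> gives a map that kills \<open>P\<close>
  and is still injective on \<open>Q\<close>, because \<open>P\<close> and \<open>Q\<close> meet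
  trivially; a left inverse on \<open>Q\<close> repairs the values there.\<close>

lemma ex_separating_projection:
  assumes P: "subspace P" and Q: "subspace Q" and 0: "P \<inter> Q \<subseteq> {0}"
  shows "\<exists>p. lin p \<and> range p \<subseteq> Q \<and> (\<forall>x\<in>P. p x = 0) \<and> (\<forall>x\<in>Q. p x = x)"
proof -
  interpret vector_space_pair scale scale by unfold_locales
  obtain r where r: "lin r" "range r \<subseteq> P" "\<forall>x\<in>P. r x = x" using ex_projection[OF P] by blast
  define s where "s x = x - r x" for x
  have s: "lin s" unfolding s_def by (intro lin_minus lin_id) (use r in auto)
  have "inj_on s Q"
  proof (rule inj_onI)
    fix x y assume xy: "x \<in> Q" "y \<in> Q" "s x = s y"
    have "x - y = r x - r y" using xy(3) by (simp add: s_def algebra_simps)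
    then have "x - y \<in> P" using r(2) P by (auto intro!: subspace_diff)
    moreover have "x - y \<in> Q" using xy Q by (auto intro: subspace_diff)
    ultimately show "x = y" using 0 by auto
  qed
  then obtain g where g: "range g \<subseteq> Q" "lin g" "\<forall>v\<in>Q. g (s v) = v"
    using linear_exists_left_inverse_on[of s Q] s Q by (auto simp: lin_linear)
  show ?thesis
    by (rule exI[of _ "\<lambda>x. g (s x)"])
       (use g s lin_comp[OF g(2) s] r in \<open>auto simp: s_def lin_0\<close>)
qed

lemma ex_fnl_extending:
  assumes P: "subspace P" and Q: "subspace Q" and 0: "P \<inter> Q \<subseteq> {0}" and g: "fnl g"
  shows "\<exists>f. perp P f \<and> (\<forall>x\<in>Q. f x = g x)"
proof -
  obtain p where "lin p" "range p \<subseteq> Q" "\<forall>x\<in>P. p x = 0" "\<forall>x\<in>Q. p x = x"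
    using ex_separating_projection[OF P Q 0] by blast
  then show ?thesis
    by (intro exI[of _ "\<lambda>x. g (p x)"]) (auto simp: perp_def fnl_0[OF g] intro: fnl_comp g)
qed

lemma ex_fnl_nonzero:
  assumes "x \<noteq> 0" shows "\<exists>f. fnl f \<and> f x = 1"
proof -
  interpret vector_space_pair scale "(*) :: 'a \<Rightarrow> 'a \<Rightarrow> 'a"
    using vector_space_field vector_space_axioms by (simp add: vector_space_pair_def)
  have "independent {x}" using assms by (simp add: dependent_single)
  from linear_independent_extend[OF this, of "\<lambda>_. 1"] show ?thesis by (auto simp: fnl_linear)
qed

lemma ex_perp_nonzero:
  assumes P: "subspace P" and x: "x \<notin> P" shows "\<exists>f. perp P f \<and> f x = 1"
proof -
  have "x \<noteq> 0" using x P subspace_0 by blast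
  then obtain g where g: "fnl g" "g x = 1" using ex_fnl_nonzero by blast
  have "P \<inter> span {x} \<subseteq> {0}"
  proof
    fix y assume y: "y \<in> P \<inter> span {x}"
    then obtain c where c: "y = scale c x" by (auto simp: span_singleton)
    show "y \<in> {0}"
    proof (cases "c = 0")
      case False
      then have "x = scale (inverse c) y" by (simp add: c)
      then show ?thesis using y x P subspace_scale by auto
    qed (simp add: c)
  qed
  from ex_fnl_extending[OF P subspace_span this g(1)] show ?thesis
    using g(2) span_base[of x "{x}"] by auto
qed

lemma mem_by_perp: "subspace P \<Longrightarrow> (\<And>f. perp P f \<Longrightarrow> f x = 0) \<Longrightarrow> x \<in> P"
  using ex_perp_nonzero by (metis zero_neq_one)

lemma zero_by_fnl: "(\<And>f. fnl f \<Longrightarrow> f x = 0) \<Longrightarrow> x = 0"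
  using ex_fnl_nonzero by (metis zero_neq_one)

text \<open>The vectors are expanded in a basis of the whole space, so that the coordinates are
  functionals on all of it. \<open>I\<close> keeps the finitely many basis vectors that occur, each
  serving as its own index.\<close>

lemma ex_coordinates:
  assumes "finite A"
  shows "\<exists>I r. finite I \<and> (\<forall>i. fnl (r i)) \<and> (\<forall>a\<in>A. a = (\<Sum>i\<in>I. scale (r i a) i))"
proof -
  obtain B where B: "independent B" "UNIV \<subseteq> span B" by (rule basis_exists[of UNIV])
  define r where "r i a = representation B a i" for i a
  define I where "I = (\<Union>a\<in>A. {i. r i a \<noteq> 0})"
  have B': "a \<in> span B" for a using B(2) by blast
  have "finite I" unfolding I_def r_def using assms by (intro finite_UN_I finite_representation)
  moreover have "fnl (r i)" for i
    by (rule fnlI) (simp_all add: r_def representation_add[OF B(1)] representation_scale[OF B(1)] B')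
  moreover have "a = (\<Sum>i\<in>I. scale (r i a) i)" if a: "a \<in> A" for a
  proof -
    have "a = (\<Sum>i | r i a \<noteq> 0. scale (r i a) i)"
      unfolding r_def by (rule sum_nonzero_representation_eq[OF B(1) B', symmetric])
    also have "\<dots> = (\<Sum>i\<in>I. scale (r i a) i)"
    proof (rule sum.mono_neutral_left)
      show "{i. r i a \<noteq> 0} \<subseteq> I" using a unfolding I_def by blast
    qed (use \<open>finite I\<close> in simp_all)
    finally show ?thesis .
  qed
  ultimately show ?thesis by (intro exI[of _ I] exI[of _ r] conjI allI ballI)
qed

lemma dim_strict_mono:
  assumes M: "subspace M" "M \<subset> N" and N: "N \<subseteq> span A" "finite A"
  shows "dim M < dim N"
proof -
  obtain B where B: "B \<subseteq> M" "independent B" "M \<subseteq> span B" "card B = dim M"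
    by (rule basis_exists)
  obtain C where C: "B \<subseteq> C" "C \<subseteq> N" "independent C" "N \<subseteq> span C"
    using maximal_independent_subset_extend[of B N] B M(2) by (metis order.trans psubset_imp_subset)
  have "finite C" using independent_span_bound[OF N(2) C(3)] C(2) N(1) by auto
  moreover have "B \<noteq> C"
    using B(1) C(4) M span_minimal[of B M] by auto
  ultimately have "card B < card C" using C(1) by (auto intro: psubset_card_mono)
  then show ?thesis using B(4) basis_card_eq_dim[OF C(2,4,3)] by simp
qed

lemma finite_spanning_subset:
  assumes "N \<subseteq> span A" "finite A"
  obtains B where "finite B" "B \<subseteq> N" "N \<subseteq> span B"
proof -
  obtain B where B: "B \<subseteq> N" "independent B" "N \<subseteq> span B" by (rule basis_exists)
  then have "finite B" using independent_span_bound[OF assms(2) B(2)] assms(1) by auto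
  with B that show ?thesis by blast
qed

lemma span_finite_subset:
  assumes "x \<in> span S" obtains T where "finite T" "T \<subseteq> S" "x \<in> span T"
proof -
  from assms obtain t r where t: "finite t" "t \<subseteq> S" "x = (\<Sum>a\<in>t. scale (r a) a)"
    by (auto simp: span_explicit)
  have "x \<in> span t" unfolding t(3) by (intro span_sum span_scale span_base)
  with t that show ?thesis by blast
qed

end

section \<open>Sums over lists of pairs\<close>

text \<open>A Sweedler sum: the list stands for a tensor, and \<open>B\<close> tests its two
  legs.\<close>

definition sweed :: "('a \<times> 'b) list \<Rightarrow> ('a \<Rightarrow> 'b \<Rightarrow> 'v::comm_monoid_add) \<Rightarrow> 'v" where
  "sweed xs B = sum_list (map (\<lambda>(a, b). B a b) xs)"

lemma sweed_Nil [simp]: "sweed [] B = 0"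
  and sweed_Cons [simp]: "sweed (p # xs) B = B (fst p) (snd p) + sweed xs B"
  by (auto simp: sweed_def split: prod.splits)

lemma sweed_0 [simp]: "sweed xs (\<lambda>a b. 0) = 0"
  by (induction xs) auto

lemma sweed_add: "sweed xs (\<lambda>a b. B a b + B' a b) = sweed xs B + sweed xs B'"
  by (induction xs) (auto simp: ac_simps)

lemma sweed_diff:
  fixes B B' :: "'a \<Rightarrow> 'b \<Rightarrow> 'v::ab_group_add"
  shows "sweed xs (\<lambda>a b. B a b - B' a b) = sweed xs B - sweed xs B'"
  by (induction xs) (auto simp: algebra_simps)

lemma sweed_sum: "sweed xs (\<lambda>a b. \<Sum>i\<in>I. B i a b) = (\<Sum>i\<in>I. sweed xs (B i))"
  by (induction xs) (auto simp: sum.distrib)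

lemma sweed_swap:
  "sweed xs (\<lambda>a b. sweed ys (\<lambda>c d. T a b c d)) = sweed ys (\<lambda>c d. sweed xs (\<lambda>a b. T a b c d))"
  by (induction xs) (auto simp: sweed_add)

lemma sweed_flip: "sweed (map prod.swap xs) B = sweed xs (\<lambda>a b. B b a)"
  by (induction xs) auto

lemma sweed_cong: "(\<And>a b. (a, b) \<in> set xs \<Longrightarrow> B a b = B' a b) \<Longrightarrow> sweed xs B = sweed xs B'"
  by (induction xs) auto

context tensor_space
begin

lemma lin_sweed: "lin f \<Longrightarrow> f (sweed xs B) = sweed xs (\<lambda>a b. f (B a b))"
  by (induction xs) (auto simp: lin_0 lin_add)

lemma fnl_sweed: "fnl f \<Longrightarrow> f (sweed xs B) = sweed xs (\<lambda>a b. f (B a b))"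
  by (induction xs) (auto simp: fnl_0 fnl_add)

lemma sweed_mem: "subspace W \<Longrightarrow> (\<And>a b. (a, b) \<in> set xs \<Longrightarrow> B a b \<in> W) \<Longrightarrow> sweed xs B \<in> W"
  by (induction xs) (auto intro: subspace_0 subspace_add)

lemma lin_sweed_fun: "(\<And>a b. lin (\<lambda>y. T y a b)) \<Longrightarrow> lin (\<lambda>y. sweed xs (T y))"
  by (induction xs) (auto intro: lin_const_zero lin_plus)

lemma sweed_scale_left: "scale (sweed xs B) v = sweed xs (\<lambda>a b. scale (B a b) v)"
  by (induction xs) (auto simp: scale_left_distrib)

lemma sweed_scale: "sweed xs (\<lambda>a b. scale c (B a b)) = scale c (sweed xs B)"
  by (induction xs) (auto simp: scale_right_distrib)

text \<open>Writing the left legs in finitely many coordinates turns the sum into values of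
  \<open>B\<close> whose second arguments are contractions of the tensor, and these vanish.
  Functionals on one leg thus detect whether a tensor is zero.\<close>

lemma sweed_bilin_left_zero:
  assumes B: "bilin B" and p: "lin p"
    and 0: "\<And>r. fnl r \<Longrightarrow> sweed xs (\<lambda>a b. scale (r (p a)) b) = 0"
  shows "sweed xs (\<lambda>a b. B (p a) b) = 0"
proof -
  have "finite (p ` fst ` set xs)" by simp
  from ex_coordinates[OF this] obtain I r where I: "finite I" "\<forall>i. fnl (r i)"
      "\<forall>a \<in> p ` fst ` set xs. a = (\<Sum>i\<in>I. scale (r i a) i)"
    by (elim exE conjE)
  have "sweed xs (\<lambda>a b. B (p a) b) = sweed xs (\<lambda>a b. \<Sum>i\<in>I. B i (scale (r i (p a)) b))"
  proof (rule sweed_cong)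
    fix a b assume "(a, b) \<in> set xs"
    then have "p a = (\<Sum>i\<in>I. scale (r i (p a)) i)" by (intro I(3)[rule_format]) force
    then have "B (p a) b = B (\<Sum>i\<in>I. scale (r i (p a)) i) b" by (rule arg_cong[of _ _ "\<lambda>z. B z b"])
    also have "\<dots> = (\<Sum>i\<in>I. B i (scale (r i (p a)) b))"
      by (simp add: lin_sum[OF bilinD(1)[OF B]] lin_scale[OF bilinD(1)[OF B]] lin_scale[OF bilinD(2)[OF B]])
    finally show "B (p a) b = (\<Sum>i\<in>I. B i (scale (r i (p a)) b))" .
  qed
  also have "\<dots> = (\<Sum>i\<in>I. B i (sweed xs (\<lambda>a b. scale (r i (p a)) b)))"
    by (simp add: sweed_sum lin_sweed[OF bilinD(2)[OF B]])
  also have "\<dots> = 0" by (simp add: 0 I(2) bilin_0[OF B])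
  finally show ?thesis .
qed

lemma sweed_bilin_right_zero:
  assumes B: "bilin B" and p: "lin p"
    and 0: "\<And>r. fnl r \<Longrightarrow> sweed xs (\<lambda>a b. scale (r (p b)) a) = 0"
  shows "sweed xs (\<lambda>a b. B a (p b)) = 0"
proof -
  have "sweed (map prod.swap xs) (\<lambda>a b. B b (p a)) = 0"
    by (rule sweed_bilin_left_zero[OF bilin_flip[OF B] p]) (unfold sweed_flip, rule 0)
  then show ?thesis unfolding sweed_flip .
qed

end

section \<open>Coalgebras in Sweedler form\<close>

text \<open>Coproducts are lists of pairs, constrained only by their effect on multilinear maps.
  Congruence modulo the tensor relations thereby disappears, and swapping the pairs gives another
  instance, the co-opposite coalgebra.\<close>

locale sweedler_coalgebra = tensor_space scale
  for scale :: "'k::field \<Rightarrow> 'h::ab_group_add \<Rightarrow> 'h" (infixr \<open>*s\<close> 75) +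
  fixes D :: "'h \<Rightarrow> ('h \<times> 'h) list" and \<epsilon> :: "'h \<Rightarrow> 'k"
  assumes lin_sweed_arg: "bilin B \<Longrightarrow> lin (\<lambda>x. sweed (D x) B)"
    and sweed_coassoc: "(\<And>b c. lin (\<lambda>a. T a b c)) \<Longrightarrow> (\<And>a c. lin (\<lambda>b. T a b c)) \<Longrightarrow>
        (\<And>a b. lin (\<lambda>c. T a b c)) \<Longrightarrow>
        sweed (D x) (\<lambda>a b. sweed (D a) (\<lambda>c d. T c d b)) =
        sweed (D x) (\<lambda>a b. sweed (D b) (\<lambda>c d. T a c d))"
    and fnl_counit: "fnl \<epsilon>"
    and sweed_counit_left: "sweed (D x) (\<lambda>a b. \<epsilon> a *s b) = x"
    and sweed_counit_right: "sweed (D x) (\<lambda>a b. \<epsilon> b *s a) = x"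
begin

text \<open>\<open>L f x = f(x\<^sub>1) x\<^sub>2\<close> and \<open>R f x = x\<^sub>1 f(x\<^sub>2)\<close> are the two commuting actions of the dual
  algebra, whose product is \<open>conv\<close>.\<close>

definition L :: "('h \<Rightarrow> 'k) \<Rightarrow> 'h \<Rightarrow> 'h" where "L f x = sweed (D x) (\<lambda>a b. f a *s b)"

definition R :: "('h \<Rightarrow> 'k) \<Rightarrow> 'h \<Rightarrow> 'h" where "R f x = sweed (D x) (\<lambda>a b. f b *s a)"

definition conv :: "('h \<Rightarrow> 'k) \<Rightarrow> ('h \<Rightarrow> 'k) \<Rightarrow> 'h \<Rightarrow> 'k" where "conv f g x = g (L f x)"

text \<open>Over a field, stability under both actions says that the coproduct of \<open>P\<close>
  lies in the tensor square of \<open>P\<close>; see \<open>subcoalgebra_iff\<close>.\<close>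

definition sub :: "'h set \<Rightarrow> bool" where
  "sub P \<longleftrightarrow> subspace P \<and> (\<forall>x\<in>P. \<forall>f. fnl f \<longrightarrow> L f x \<in> P \<and> R f x \<in> P)"

definition simple :: "'h set \<Rightarrow> bool" where
  "simple C \<longleftrightarrow> sub C \<and> C \<noteq> {0} \<and> (\<forall>B. sub B \<and> B \<subseteq> C \<longrightarrow> B = {0} \<or> B = C)"

text \<open>As \<open>g (L f h)\<close> is f(h_1) g(h_2), this is the annihilator of the convolution
  product of the annihilators of \<open>X\<close> and \<open>Y\<close>. \<open>wedge_eq\<close>
  relates it to the wedge.\<close>

definition wg :: "'h set \<Rightarrow> 'h set \<Rightarrow> 'h set" where
  "wg X Y = {h. \<forall>f g. perp X f \<longrightarrow> perp Y g \<longrightarrow> g (L f h) = 0}"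

text \<open>Right coideals, that is, left modules over the dual algebra acting by
  \<open>R\<close>.\<close>

definition Rmod :: "'h set \<Rightarrow> bool" where
  "Rmod N \<longleftrightarrow> subspace N \<and> (\<forall>x\<in>N. \<forall>f. fnl f \<longrightarrow> R f x \<in> N)"

lemma lin_L: "fnl f \<Longrightarrow> lin (L f)"
  unfolding L_def by (rule lin_sweed_arg) (auto intro!: bilinI lin_fscale lin_cscale lin_id)

lemma lin_R: "fnl f \<Longrightarrow> lin (R f)"
  unfolding R_def by (rule lin_sweed_arg) (auto intro!: bilinI lin_fscale lin_cscale lin_id)

text \<open>Coassociativity: both sides are f(x_1) x_2 g(x_3).\<close>

lemma L_R_swap: "fnl f \<Longrightarrow> fnl g \<Longrightarrow> L f (R g x) = R g (L f x)"
proof -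
  assume f: "fnl f" and g: "fnl g"
  have "L f (R g x) = sweed (D x) (\<lambda>a b. sweed (D a) (\<lambda>c d. f c *s g b *s d))"
    unfolding R_def by (subst lin_sweed[OF lin_L[OF f]], unfold lin_scale[OF lin_L[OF f]])
      (simp add: L_def sweed_scale[symmetric] mult.commute)
  also have "\<dots> = sweed (D x) (\<lambda>a b. sweed (D b) (\<lambda>c d. f a *s g d *s c))"
    by (rule sweed_coassoc) (auto intro!: lin_cscale lin_fscale lin_id fnl_cmult fnl_multc f g)
  also have "\<dots> = R g (L f x)"
    unfolding L_def by (subst lin_sweed[OF lin_R[OF g]], unfold lin_scale[OF lin_R[OF g]])
      (simp add: R_def sweed_scale[symmetric])
  finally show ?thesis .
qed

lemma conv_sweed: "fnl g \<Longrightarrow> conv f g x = sweed (D x) (\<lambda>a b. f a * g b)"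
  by (simp add: conv_def L_def fnl_sweed fnl_scale)

lemma conv_R: "fnl f \<Longrightarrow> fnl g \<Longrightarrow> conv f g x = f (R g x)"
  by (simp add: conv_sweed R_def fnl_sweed fnl_scale mult.commute)

lemma fnl_conv: "fnl f \<Longrightarrow> fnl g \<Longrightarrow> fnl (conv f g)"
  unfolding conv_def[abs_def] by (rule fnl_comp[OF _ lin_L])

text \<open>Coassociativity again. The functional applied later becomes the right factor, so
  \<open>L\<close> is a right action, whereas \<open>R_R\<close> makes \<open>R\<close> a left
  action.\<close>

lemma L_L: "fnl f \<Longrightarrow> fnl g \<Longrightarrow> L g (L f x) = L (conv f g) x"
proof -
  assume f: "fnl f" and g: "fnl g"
  have "L g (L f x) = sweed (D x) (\<lambda>a b. sweed (D b) (\<lambda>c d. f a *s g c *s d))"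
    unfolding L_def[of f] by (subst lin_sweed[OF lin_L[OF g]], unfold lin_scale[OF lin_L[OF g]])
      (simp add: L_def sweed_scale[symmetric])
  also have "\<dots> = sweed (D x) (\<lambda>a b. sweed (D a) (\<lambda>c d. f c *s g d *s b))"
    by (rule sweed_coassoc[symmetric]) (auto intro!: lin_cscale lin_fscale lin_id fnl_cmult fnl_multc f g)
  also have "\<dots> = L (conv f g) x"
    unfolding L_def[of "conv f g"] by (simp add: conv_sweed[OF g] sweed_scale_left[symmetric])
  finally show ?thesis .
qed

lemma R_R: "fnl f \<Longrightarrow> fnl g \<Longrightarrow> R f (R g x) = R (conv f g) x"
proof -
  assume f: "fnl f" and g: "fnl g"
  have "R f (R g x) = sweed (D x) (\<lambda>a b. sweed (D a) (\<lambda>c d. f d *s g b *s c))"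
    unfolding R_def[of g] by (subst lin_sweed[OF lin_R[OF f]], unfold lin_scale[OF lin_R[OF f]])
      (simp add: R_def sweed_scale[symmetric] mult.commute)
  also have "\<dots> = sweed (D x) (\<lambda>a b. sweed (D b) (\<lambda>c d. f c *s g d *s a))"
    by (rule sweed_coassoc) (auto intro!: lin_cscale lin_fscale lin_id fnl_cmult fnl_multc f g)
  also have "\<dots> = R (conv f g) x"
    unfolding R_def[of "conv f g"] by (simp add: conv_sweed[OF g] sweed_scale_left[symmetric])
  finally show ?thesis .
qed

lemma L_counit [simp]: "L \<epsilon> x = x"
  and R_counit [simp]: "R \<epsilon> x = x"
  by (simp_all add: L_def R_def sweed_counit_left sweed_counit_right)

lemma counit_L: "fnl f \<Longrightarrow> \<epsilon> (L f x) = f x"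
  using conv_R[of f \<epsilon> x] fnl_counit by (simp add: conv_def)

lemma counit_R: "fnl f \<Longrightarrow> \<epsilon> (R f x) = f x"
  using conv_R[of \<epsilon> f x] fnl_counit by (simp add: conv_def)

lemma L_minus: "L (\<lambda>x. f x - g x) x = L f x - L g x"
  and R_minus: "R (\<lambda>x. f x - g x) x = R f x - R g x"
  by (simp_all add: L_def R_def scale_left_diff_distrib sweed_diff)

lemma L_plus: "L (\<lambda>x. f x + g x) x = L f x + L g x"
  and R_plus: "R (\<lambda>x. f x + g x) x = R f x + R g x"
  by (simp_all add: L_def R_def scale_left_distrib sweed_add)

lemma R_cmult: "R (\<lambda>x. c * f x) x = c *s R f x"
  by (simp add: R_def sweed_scale[symmetric])

lemma fnlD_sub: "sub P \<Longrightarrow> x \<in> P \<Longrightarrow> fnl f \<Longrightarrow> L f x \<in> P"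
  "sub P \<Longrightarrow> x \<in> P \<Longrightarrow> fnl f \<Longrightarrow> R f x \<in> P"
  by (auto simp: sub_def)

lemma sub_subspace: "sub P \<Longrightarrow> subspace P"
  by (simp add: sub_def)

lemma sub_Rmod: "sub P \<Longrightarrow> Rmod P"
  by (simp add: sub_def Rmod_def)

lemma perp_fnl: "perp P f \<Longrightarrow> fnl f"
  and perp_zero: "perp P f \<Longrightarrow> p \<in> P \<Longrightarrow> f p = 0"
  by (auto simp: perp_def)

lemma perp_mono: "P \<subseteq> Q \<Longrightarrow> perp Q f \<Longrightarrow> perp P f"
  by (auto simp: perp_def)

lemma perp_L: "sub P \<Longrightarrow> perp P f \<Longrightarrow> x \<in> P \<Longrightarrow> L f x = 0"
proof (rule zero_by_fnl)
  fix g assume *: "sub P" "perp P f" "x \<in> P" "fnl g"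
  have "g (L f x) = f (R g x)" using conv_R[of f g x] * by (simp add: conv_def perp_fnl)
  also have "\<dots> = 0" using * by (auto intro!: perp_zero fnlD_sub)
  finally show "g (L f x) = 0" .
qed

lemma perp_R: "sub P \<Longrightarrow> perp P f \<Longrightarrow> x \<in> P \<Longrightarrow> R f x = 0"
proof (rule zero_by_fnl)
  fix g assume *: "sub P" "perp P f" "x \<in> P" "fnl g"
  have "g (R f x) = f (L g x)" using conv_R[of g f x] * by (simp add: conv_def perp_fnl)
  also have "\<dots> = 0" using * by (auto intro!: perp_zero fnlD_sub)
  finally show "g (R f x) = 0" .
qed

lemma L_agree: "sub P \<Longrightarrow> x \<in> P \<Longrightarrow> fnl f \<Longrightarrow> fnl g \<Longrightarrow> (\<And>y. y \<in> P \<Longrightarrow> f y = g y) \<Longrightarrow> L f x = L g x"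
  using perp_L[of P "\<lambda>x. f x - g x" x] by (auto simp: perp_def L_minus intro: fnl_minus)

lemma R_agree: "sub P \<Longrightarrow> x \<in> P \<Longrightarrow> fnl f \<Longrightarrow> fnl g \<Longrightarrow> (\<And>y. y \<in> P \<Longrightarrow> f y = g y) \<Longrightarrow> R f x = R g x"
  using perp_R[of P "\<lambda>x. f x - g x" x] by (auto simp: perp_def R_minus intro: fnl_minus)

lemma perp_conv_left: "sub P \<Longrightarrow> perp P f \<Longrightarrow> fnl g \<Longrightarrow> perp P (conv f g)"
  using perp_L[of P f] by (simp add: perp_def fnl_conv) (simp add: conv_def fnl_0)

lemma perp_conv_right: "sub P \<Longrightarrow> perp P f \<Longrightarrow> fnl g \<Longrightarrow> perp P (conv g f)"
  using perp_R[of P f] by (simp add: perp_def fnl_conv) (simp add: conv_R fnl_0)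

lemma mem_Rmod_iff: "sub B \<Longrightarrow> x \<in> B \<longleftrightarrow> (\<forall>f. perp B f \<longrightarrow> R f x = 0)"
proof safe
  assume B: "sub B" and *: "\<forall>f. perp B f \<longrightarrow> R f x = 0"
  show "x \<in> B"
  proof (rule mem_by_perp[OF sub_subspace[OF B]])
    fix f assume f: "perp B f"
    then have "f x = \<epsilon> (R f x)" by (simp add: counit_R perp_fnl)
    with * f show "f x = 0" by (simp add: fnl_0 fnl_counit)
  qed
qed (rule perp_R)

lemma sub_zero: "sub {0}"
  by (auto simp: sub_def lin_0 lin_L lin_R)

lemma sub_UNIV: "sub UNIV"
  by (simp add: sub_def)

lemma sub_Int: "sub P \<Longrightarrow> sub Q \<Longrightarrow> sub (P \<inter> Q)"
  by (simp add: sub_def subspace_inter)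

lemma sub_span_Union: "(\<And>Q. Q \<in> A \<Longrightarrow> sub Q) \<Longrightarrow> sub (span (\<Union>A))"
proof -
  assume A: "\<And>Q. Q \<in> A \<Longrightarrow> sub Q"
  have "L f x \<in> span (\<Union>A) \<and> R f x \<in> span (\<Union>A)" if x: "x \<in> span (\<Union>A)" and f: "fnl f" for f x
    using x
  proof (induction x rule: span_induct_alt)
    case base then show ?case by (simp add: lin_0 lin_L lin_R f span_zero)
  next
    case (step c x y)
    then obtain Q where "Q \<in> A" "x \<in> Q" by blast
    then have "L f x \<in> Q" "R f x \<in> Q" using fnlD_sub[OF A _ f] by auto
    then have "L f x \<in> span (\<Union>A)" "R f x \<in> span (\<Union>A)"
      using \<open>Q \<in> A\<close> by (auto intro!: span_base)
    with step show ?case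
      by (simp add: lin_add[OF lin_L] lin_add[OF lin_R] lin_scale[OF lin_L] lin_scale[OF lin_R] f
          span_add span_scale)
  qed
  then show ?thesis by (simp add: sub_def)
qed

lemma sub_sumset: "sub P \<Longrightarrow> sub Q \<Longrightarrow> sub (P + Q)"
proof -
  assume P: "sub P" and Q: "sub Q"
  have "L f x \<in> P + Q \<and> R f x \<in> P + Q" if x: "x \<in> P + Q" and f: "fnl f" for f x
  proof -
    from x obtain p q where "x = p + q" "p \<in> P" "q \<in> Q" by (rule set_plus_elim)
    then show ?thesis using fnlD_sub[OF P _ f] fnlD_sub[OF Q _ f]
      by (simp add: lin_add[OF lin_L[OF f]] lin_add[OF lin_R[OF f]] set_plus_intro)
  qed
  then show ?thesis using P Q by (simp add: sub_def subspace_sumset)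
qed

lemma sub_0_mem: "sub P \<Longrightarrow> 0 \<in> P"
  by (simp add: sub_def subspace_0)

text \<open>With a projection \<open>p\<close> onto \<open>P\<close>, every functional composed with
  the identity minus \<open>p\<close> annihilates \<open>P\<close>, so projecting one leg after the
  other does not change the sum. This replaces the choice of both legs of the coproduct inside
  \<open>P\<close>.\<close>

lemma sweed_mem_sub:
  assumes P: "sub P" and x: "x \<in> P" and B: "bilin B" and W: "subspace W"
    and mem: "\<And>a b. a \<in> P \<Longrightarrow> b \<in> P \<Longrightarrow> B a b \<in> W"
  shows "sweed (D x) B \<in> W"
proof -
  obtain p where p: "lin p" "range p \<subseteq> P" "\<forall>x\<in>P. p x = x"
    using ex_projection[OF sub_subspace[OF P]] by blast
  have q: "lin (\<lambda>a. a - p a)" by (intro lin_minus lin_id p)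
  have perp: "perp P (\<lambda>a. r (a - p a))" if "fnl r" for r
    using that p by (auto simp: perp_def fnl_0 intro!: fnl_comp q)
  have "sweed (D x) (\<lambda>a b. B (a - p a) b) = 0"
    by (rule sweed_bilin_left_zero[OF B q]) (use perp_L[OF P perp x] in \<open>simp add: L_def\<close>)
  moreover have Bp: "bilin (\<lambda>a b. B (p a) b)"
    using B p(1) by (auto simp: bilin_def intro: lin_comp)
  then have "sweed (D x) (\<lambda>a b. B (p a) (b - p b)) = 0"
    by (rule sweed_bilin_right_zero[OF _ q]) (use perp_R[OF P perp x] in \<open>simp add: R_def\<close>)
  ultimately have "sweed (D x) B = sweed (D x) (\<lambda>a b. B (p a) (p b))"
    by (simp add: lin_diff[OF bilinD(1)[OF B]] lin_diff[OF bilinD(2)[OF B]] sweed_diff)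
  also have "\<dots> \<in> W" using p by (intro sweed_mem W mem) auto
  finally show ?thesis .
qed

lemma sweed_cong_sub:
  assumes "sub P" "x \<in> P" "bilin B" "bilin B'" "\<And>a b. a \<in> P \<Longrightarrow> b \<in> P \<Longrightarrow> B a b = B' a b"
  shows "sweed (D x) B = sweed (D x) B'"
  using sweed_mem_sub[of P x "\<lambda>a b. B a b - B' a b" "{0}"] assms
  by (auto simp: sweed_diff bilin_minus)

section \<open>Simple subcoalgebras\<close>

text \<open>Two-sided ideals of the dual algebra. Scalar multiples arise by convolution with
  multiples of \<open>\<epsilon>\<close>; the empty set also qualifies, whence the nonemptiness
  condition in \<open>Rmod_orbit\<close>.\<close>

definition ideal :: "('h \<Rightarrow> 'k) set \<Rightarrow> bool" where
  "ideal J \<longleftrightarrow> (\<forall>j\<in>J. fnl j) \<and> (\<forall>i\<in>J. \<forall>j\<in>J. (\<lambda>x. i x + j x) \<in> J \<and> (\<lambda>x. i x - j x) \<in> J) \<and>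
     (\<forall>j\<in>J. \<forall>f. fnl f \<longrightarrow> conv f j \<in> J \<and> conv j f \<in> J)"

definition minR :: "'h set \<Rightarrow> bool" where
  "minR N \<longleftrightarrow> Rmod N \<and> N \<noteq> {0} \<and> (\<forall>M. Rmod M \<and> M \<subseteq> N \<longrightarrow> M = {0} \<or> M = N)"

lemma idealD:
  assumes "ideal J"
  shows "j \<in> J \<Longrightarrow> fnl j" "i \<in> J \<Longrightarrow> j \<in> J \<Longrightarrow> (\<lambda>x. i x + j x) \<in> J"
    "i \<in> J \<Longrightarrow> j \<in> J \<Longrightarrow> (\<lambda>x. i x - j x) \<in> J"
    "j \<in> J \<Longrightarrow> fnl f \<Longrightarrow> conv f j \<in> J" "j \<in> J \<Longrightarrow> fnl f \<Longrightarrow> conv j f \<in> J"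
  using assms by (auto simp: ideal_def)

lemma ideal_perp: "sub P \<Longrightarrow> ideal {f. perp P f}"
  unfolding ideal_def
  by (auto intro: perp_conv_left perp_conv_right) (auto simp: perp_def intro: fnl_plus fnl_minus)

text \<open>Closure under convolution on the left comes from \<open>V\<close>, on the right from
  \<open>W\<close>. As \<open>\<epsilon>\<close> acts by the identity, its membership means that
  \<open>W\<close> is contained in \<open>V\<close>; \<open>counit_mem_ideal\<close> yields this
  from a single member that does not vanish on a simple subcoalgebra.\<close>

lemma ideal_R:
  assumes W: "\<And>f x. fnl f \<Longrightarrow> x \<in> W \<Longrightarrow> R f x \<in> W" and V: "Rmod V"
  shows "ideal {f. fnl f \<and> (\<forall>x\<in>W. R f x \<in> V)}"
  using assms unfolding ideal_def Rmod_def
  by (auto simp: R_plus R_minus R_R[symmetric] intro: fnl_plus fnl_minus fnl_conv subspace_add subspace_diff)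

lemma Rmod_subspace: "Rmod N \<Longrightarrow> subspace N"
  and Rmod_R: "Rmod N \<Longrightarrow> x \<in> N \<Longrightarrow> fnl f \<Longrightarrow> R f x \<in> N"
  by (auto simp: Rmod_def)

lemma Rmod_0: "Rmod N \<Longrightarrow> 0 \<in> N"
  by (simp add: Rmod_def subspace_0)

lemma Rmod_orbit:
  assumes "ideal J" "J \<noteq> {}"
  shows "Rmod {R j x |j. j \<in> J}"
proof -
  note J = idealD[OF assms(1)]
  obtain j where j: "j \<in> J" using assms by blast
  have "R (\<lambda>x. j x - j x) x = 0" by (simp add: R_def)
  then have 0: "0 \<in> {R j x |j. j \<in> J}" using J(3)[OF j j] by force
  have scale: "c *s R i x \<in> {R j x |j. j \<in> J}" if "i \<in> J" for c i
  proof -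
    have f: "fnl (\<lambda>x. c * \<epsilon> x)" by (intro fnl_cmult fnl_counit)
    have "c *s R i x = R (conv (\<lambda>x. c * \<epsilon> x) i) x"
      using R_R[OF f J(1)[OF that]] by (simp add: R_cmult)
    with J(4)[OF that f] show ?thesis by blast
  qed
  have add: "R i x + R j x \<in> {R j x |j. j \<in> J}" if "i \<in> J" "j \<in> J" for i j
    using J(2)[OF that] R_plus[of i j x, symmetric] by blast
  have R: "R f (R i x) \<in> {R j x |j. j \<in> J}" if "i \<in> J" "fnl f" for f i
    using J(4)[OF that] R_R[OF that(2) J(1)[OF that(1)]] by blast
  show ?thesis unfolding Rmod_def subspace_def using 0 scale add R by blast
qed

lemma ideal_fnl: "ideal {f. fnl f}"
  by (auto simp: ideal_def intro: fnl_plus fnl_minus fnl_conv)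

lemma R_finite: "{R f x |f. fnl f} \<subseteq> span (fst ` set (D x))"
  by (auto simp: R_def intro!: sweed_mem span_scale) (metis fst_conv image_eqI span_base)

text \<open>The orbit of a point outside \<open>U\<close> is spanned by the left legs of one
  coproduct, hence finite-dimensional, so the dimension can be minimized. Minimality is relative to
  \<open>U\<close>: proper right coideals of \<open>M\<close> may be nonzero, but they lie in
  \<open>U\<close>.\<close>

lemma ex_min_Rmod:
  assumes "Rmod P" "\<not> P \<subseteq> U"
  shows "\<exists>M A. Rmod M \<and> M \<subseteq> P \<and> \<not> M \<subseteq> U \<and> finite A \<and> M \<subseteq> span A \<and>
           (\<forall>M'. Rmod M' \<and> M' \<subset> M \<longrightarrow> M' \<subseteq> U)"
proof -
  obtain x where x: "x \<in> P" "x \<notin> U" using assms by blast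
  define good where "good M \<longleftrightarrow> Rmod M \<and> M \<subseteq> P \<and> \<not> M \<subseteq> U \<and> (\<exists>A. finite A \<and> M \<subseteq> span A)" for M
  have "Rmod {R f x |f. fnl f}" using Rmod_orbit[OF ideal_fnl] fnl_counit by auto
  moreover have "x = R \<epsilon> x" by simp
  then have "x \<in> {R f x |f. fnl f}" using fnl_counit by blast
  moreover have "{R f x |f. fnl f} \<subseteq> P" using Rmod_R[OF assms(1) x(1)] by blast
  ultimately have "good {R f x |f. fnl f}"
    unfolding good_def using R_finite[of x] x(2) by (metis (lifting) List.finite_set finite_imageI subset_iff)
  then obtain M where M: "good M" "\<And>M'. good M' \<Longrightarrow> dim M \<le> dim M'"
    using ex_has_least_nat[of good _ dim] by blast
  then obtain A where A: "finite A" "M \<subseteq> span A" by (auto simp: good_def)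
  have "M' \<subseteq> U" if M': "Rmod M'" "M' \<subset> M" for M'
  proof (rule ccontr)
    assume "\<not> M' \<subseteq> U"
    then have "good M'" using M(1) M' A unfolding good_def by blast
    then show False
      using M(2) dim_strict_mono[OF Rmod_subspace[OF M'(1)] M'(2) A(2,1)] by fastforce
  qed
  with M(1) A show ?thesis unfolding good_def by (intro exI[of _ M] exI[of _ A]) simp
qed

text \<open>Units \<open>i\<close> and \<open>j\<close> for two elements are combined to \<open>1 - (1 - i) (1 - j)\<close>.\<close>

lemma common_unit:
  assumes J: "ideal J" and N: "Rmod N" and unit: "\<And>n. n \<in> N \<Longrightarrow> \<exists>j\<in>J. R j n = n"
    and A: "finite A" "A \<subseteq> N"
  shows "\<exists>j\<in>J. \<forall>n\<in>A. R j n = n"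
  using A
proof (induction A rule: finite_induct)
  case empty
  then show ?case using unit[OF Rmod_0[OF N]] by blast
next
  case (insert a A)
  then obtain j where j: "j \<in> J" "\<forall>n\<in>A. R j n = n" by auto
  have "a - R j a \<in> N"
    using insert N j J by (auto intro!: subspace_diff Rmod_subspace Rmod_R idealD)
  then obtain i where i: "i \<in> J" "R i (a - R j a) = a - R j a" using unit by blast
  have fnl: "fnl i" "fnl j" using i j idealD[OF J] by auto
  define k where "k = (\<lambda>x. (i x + j x) - conv i j x)"
  have k: "R k n = R i n + R j n - R i (R j n)" for n
    by (simp add: k_def R_minus R_plus R_R fnl)
  have "k \<in> J" unfolding k_def using i j idealD[OF J] fnl by blast
  moreover have "R k a = a" using i by (simp add: k lin_diff[OF lin_R] fnl algebra_simps)
  moreover have "\<forall>n\<in>A. R k n = n" using j by (simp add: k)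
  ultimately show ?case by blast
qed

text \<open>For a right coideal \<open>N\<close> this is the subcoalgebra generated by
  \<open>N\<close>; stability under \<open>R\<close> is inherited because the two actions
  commute.\<close>

definition cogen :: "'h set \<Rightarrow> 'h set" where
  "cogen N = span {L f n |f n. fnl f \<and> n \<in> N}"

lemma sub_cogen:
  assumes "Rmod N" shows "sub (cogen N)"
proof -
  let ?S = "{L f n |f n. fnl f \<and> n \<in> N}"
  have "L g x \<in> cogen N \<and> R g x \<in> cogen N" if x: "x \<in> span ?S" and g: "fnl g" for g x
    using x
  proof (induction x rule: span_induct_alt)
    case base then show ?case by (simp add: lin_0 lin_L lin_R g cogen_def span_zero)
  next
    case (step c x y)
    then obtain f n where x: "x = L f n" "fnl f" "n \<in> N" by blast
    have "L g x = L (conv f g) n" "R g x = L f (R g n)"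
      using x g by (simp_all add: L_L L_R_swap)
    then have "L g x \<in> ?S" "R g x \<in> ?S" using x g fnl_conv Rmod_R[OF assms] by blast+
    then have "L g x \<in> cogen N" "R g x \<in> cogen N" unfolding cogen_def by (auto intro: span_base)
    with step show ?case
      by (simp add: lin_add[OF lin_L] lin_add[OF lin_R] lin_scale[OF lin_L] lin_scale[OF lin_R] g
          span_add span_scale cogen_def)
  qed
  then show ?thesis by (simp add: sub_def cogen_def)
qed

lemma subset_cogen: "N \<subseteq> cogen N"
proof
  fix x assume "x \<in> N"
  moreover have "x = L \<epsilon> x" by simp
  ultimately show "x \<in> cogen N" unfolding cogen_def using fnl_counit by (blast intro: span_base)
qed

lemma cogen_minimal: "sub P \<Longrightarrow> N \<subseteq> P \<Longrightarrow> cogen N \<subseteq> P"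
  unfolding cogen_def by (rule span_minimal) (auto intro: fnlD_sub sub_subspace)

lemma R_fixes_cogen:
  assumes j: "fnl j" and A: "\<And>n. n \<in> A \<Longrightarrow> R j n = n" and x: "x \<in> cogen (span A)"
  shows "R j x = x"
proof -
  have sp: "subspace {x. R j x = x}"
    using lin_R[OF j] by (auto simp: subspace_def lin_0 lin_add lin_scale)
  have "R j n = n" if "n \<in> span A" for n
    using span_minimal[of A, OF _ sp] A that by blast
  then have "{L f n |f n. fnl f \<and> n \<in> span A} \<subseteq> {x. R j x = x}"
    by (auto simp: L_R_swap[symmetric] j)
  from span_minimal[OF this sp] x show ?thesis unfolding cogen_def by blast
qed

text \<open>If a nonzero subcoalgebra \<open>B\<close> of \<open>cogen N\<close> did not contain
  \<open>N\<close>, it would meet \<open>N\<close> only in 0, and the annihilator of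
  \<open>B\<close> would carry each nonzero element of \<open>N\<close> onto all of
  \<open>N\<close>. Then for \<open>b\<close> in \<open>B\<close> some functional of this
  annihilator fixes the finitely many elements of \<open>N\<close> that generate \<open>b\<close>,
  hence \<open>b\<close> itself, although it also kills \<open>b\<close>.\<close>

lemma minR_simple:
  assumes "minR N" shows "simple (cogen N)"
proof -
  have N: "Rmod N" "N \<noteq> {0}" "\<And>M. Rmod M \<Longrightarrow> M \<subseteq> N \<Longrightarrow> M = {0} \<or> M = N"
    using assms by (auto simp: minR_def)
  have C: "sub (cogen N)" by (rule sub_cogen[OF N(1)])
  have "cogen N \<subseteq> B" if B: "sub B" "B \<subseteq> cogen N" "B \<noteq> {0}" for B
  proof (rule cogen_minimal[OF B(1)], rule ccontr)
    assume nsub: "\<not> N \<subseteq> B"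
    have "Rmod (N \<inter> B)"
      using N(1) B(1) by (auto simp: Rmod_def sub_def intro: subspace_inter)
    with N(3) nsub have NB: "N \<inter> B = {0}" by blast
    let ?J = "{f. perp B f}"
    have J: "ideal ?J" "?J \<noteq> {}"
      using ideal_perp[OF B(1)] fnl_const_zero by (auto simp: perp_def)
    have unit: "\<exists>j\<in>?J. R j n = n" if n: "n \<in> N" for n
    proof -
      have "{R j n |j. j \<in> ?J} \<subseteq> N" using n Rmod_R[OF N(1)] by (auto intro: perp_fnl)
      then consider "{R j n |j. j \<in> ?J} = {0}" | "{R j n |j. j \<in> ?J} = N"
        using N(3)[OF Rmod_orbit[OF J]] by blast
      then show ?thesis
      proof cases
        case 1
        then have "\<forall>f. perp B f \<longrightarrow> R f n = 0" by blast
        then have "n = 0" using mem_Rmod_iff[OF B(1)] n NB by blast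
        then show ?thesis using J(2) by (auto simp: lin_0 lin_R perp_fnl)
      next
        case 2 with n show ?thesis by force
      qed
    qed
    have "b = 0" if b: "b \<in> B" for b
    proof -
      have "b \<in> span {L f n |f n. fnl f \<and> n \<in> N}" using b B(2) by (auto simp: cogen_def)
      then obtain T where T: "finite T" "T \<subseteq> {L f n |f n. fnl f \<and> n \<in> N}" "b \<in> span T"
        by (rule span_finite_subset)
      then have "\<forall>t\<in>T. \<exists>n. n \<in> N \<and> (\<exists>f. fnl f \<and> t = L f n)" by blast
      then obtain m where m: "\<forall>t\<in>T. m t \<in> N \<and> (\<exists>f. fnl f \<and> t = L f (m t))" by metis
      obtain j where j: "j \<in> ?J" "\<forall>n\<in>m ` T. R j n = n"
        using common_unit[OF J(1) N(1) unit, of "m ` T"] T(1) m by auto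
      have fj: "fnl j" using j perp_fnl by blast
      have "T \<subseteq> {L f n |f n. fnl f \<and> n \<in> span (m ` T)}" 
      proof
        fix t assume "t \<in> T"
        moreover from this obtain f where "fnl f" "t = L f (m t)" using m by blast
        moreover have "m t \<in> span (m ` T)" using \<open>t \<in> T\<close> by (simp add: span_base)
        ultimately show "t \<in> {L f n |f n. fnl f \<and> n \<in> span (m ` T)}" by blast
      qed
      then have "b \<in> cogen (span (m ` T))" unfolding cogen_def by (rule subsetD[OF span_mono T(3)])
      then have "R j b = b" using R_fixes_cogen[OF fj, of "m ` T" b] j(2) by blast
      moreover have "R j b = 0" using j perp_R[OF B(1) _ b] by blast
      ultimately show "b = 0" by simp
    qed
    with B(3) sub_0_mem[OF B(1)] show False by blast
  qed
  moreover have "cogen N \<noteq> {0}" using subset_cogen N(2) Rmod_0[OF N(1)] by blast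
  ultimately show ?thesis unfolding simple_def using C by blast
qed

lemma ex_minR:
  assumes P: "Rmod P" "P \<noteq> {0}"
  obtains N A where "minR N" "N \<subseteq> P" "finite A" "N \<subseteq> span A"
proof -
  have "\<not> P \<subseteq> {0}" using P Rmod_0 by blast
  from ex_min_Rmod[OF P(1) this] obtain M A
    where M: "Rmod M" "M \<subseteq> P" "\<not> M \<subseteq> {0}" "finite A" "M \<subseteq> span A"
      "\<forall>M'. Rmod M' \<and> M' \<subset> M \<longrightarrow> M' \<subseteq> {0}" by (elim exE conjE)
  have "M' = {0} \<or> M' = M" if "Rmod M' \<and> M' \<subseteq> M" for M'
    using M(6) that Rmod_0 by (metis psubsetI subset_singletonD empty_iff)
  then have "minR M" unfolding minR_def using M(1,3) by blast
  with M that show ?thesis by blast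
qed

lemma simple_sub: "simple C \<Longrightarrow> sub C"
  and simple_nonzero: "simple C \<Longrightarrow> C \<noteq> {0}"
  and simple_cases: "simple C \<Longrightarrow> sub B \<Longrightarrow> B \<subseteq> C \<Longrightarrow> B = {0} \<or> B = C"
  by (auto simp: simple_def)

lemma simple_subset_eq: "simple C \<Longrightarrow> simple E \<Longrightarrow> C \<subseteq> E \<Longrightarrow> C = E"
  using simple_cases simple_sub simple_nonzero by metis

lemma simple_Int: "simple C \<Longrightarrow> sub Q \<Longrightarrow> C \<subseteq> Q \<or> C \<inter> Q = {0}"
  using simple_cases[of C "C \<inter> Q"] simple_sub sub_Int by blast

lemma ex_simple:
  assumes P: "sub P" "P \<noteq> {0}" obtains C where "simple C" "C \<subseteq> P"
proof -
  obtain N A where "minR N" "N \<subseteq> P" using ex_minR[OF sub_Rmod[OF P(1)] P(2)] by metis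
  then have "simple (cogen N)" "cogen N \<subseteq> P" using minR_simple cogen_minimal[OF P(1)] by auto
  with that show ?thesis by blast
qed

text \<open>The ideals of \<open>H\<^sup>*\<close> that contain the annihilator of \<open>C\<close> are the ideals of the dual of \<open>C\<close>,
  which is a simple algebra.\<close>

lemma counit_mem_ideal:
  assumes C: "simple C" and J: "ideal J" and perpC: "\<And>f. perp C f \<Longrightarrow> f \<in> J"
    and j: "j \<in> J" "\<not> perp C j"
  shows "\<epsilon> \<in> J"
proof -
  obtain N A where N: "minR N" "N \<subseteq> C" "finite A" "N \<subseteq> span A"
    using ex_minR[OF sub_Rmod[OF simple_sub[OF C]] simple_nonzero[OF C]] by metis
  have N': "Rmod N" "\<And>M. Rmod M \<Longrightarrow> M \<subseteq> N \<Longrightarrow> M = {0} \<or> M = N"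
    using N(1) by (auto simp: minR_def)
  have "cogen N = C"
    using simple_subset_eq[OF minR_simple[OF N(1)] C] cogen_minimal[OF simple_sub[OF C] N(2)] .
  have unit: "\<exists>j\<in>J. R j n = n" if n: "n \<in> N" for n
  proof -
    have "{R j n |j. j \<in> J} \<subseteq> N" using n Rmod_R[OF N'(1)] idealD(1)[OF J] by blast
    then consider "{R j n |j. j \<in> J} = {0}" | "{R j n |j. j \<in> J} = N"
      using N'(2)[OF Rmod_orbit[OF J]] j by blast
    then show ?thesis
    proof cases
      case 1
      \<comment> \<open>The part of \<open>C\<close> killed by \<open>J\<close> is a subcoalgebra.
        It is not all of \<open>C\<close>, because \<open>j\<close> does not vanish there, so
        simplicity leaves only 0.\<close>
      define Z where "Z = {x\<in>C. \<forall>j\<in>J. R j x = 0}"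
      have "subspace Z"
        using sub_subspace[OF simple_sub[OF C]] idealD(1)[OF J]
        by (auto simp: Z_def subspace_def lin_0[OF lin_R] lin_add[OF lin_R] lin_scale[OF lin_R])
      moreover have "L f x \<in> Z \<and> R f x \<in> Z" if "x \<in> Z" "fnl f" for x f
        using that fnlD_sub[OF simple_sub[OF C]] idealD[OF J]
        by (auto simp: Z_def L_R_swap[symmetric] R_R lin_0[OF lin_L])
      ultimately have "sub Z" by (simp add: sub_def)
      then have "Z = {0} \<or> Z = C" using simple_cases[OF C] by (auto simp: Z_def)
      moreover have "n \<in> Z" using 1 n N(2) by (auto simp: Z_def)
      moreover have "Z \<noteq> C"
      proof
        assume "Z = C"
        have "j x = 0" if "x \<in> C" for x
        proof -
          have "R j x = 0" using that \<open>Z = C\<close> j(1) unfolding Z_def by blast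
          then show ?thesis using counit_R[OF idealD(1)[OF J j(1)], of x] by (simp add: fnl_0 fnl_counit)
        qed
        with j idealD(1)[OF J] show False by (auto simp: perp_def)
      qed
      ultimately have "n = 0" by blast
      then show ?thesis using j(1) idealD(1)[OF J] by (auto simp: lin_0 lin_R)
    next
      case 2 with n show ?thesis by force
    qed
  qed
  obtain B where B: "finite B" "B \<subseteq> N" "N \<subseteq> span B" by (rule finite_spanning_subset[OF N(4,3)])
  obtain i where i: "i \<in> J" "\<forall>n\<in>B. R i n = n"
    using common_unit[OF J N'(1) unit B(1,2)] by blast
  have fi: "fnl i" using i idealD(1)[OF J] by blast
  have "cogen N \<subseteq> cogen (span B)" unfolding cogen_def by (rule span_mono) (use B(3) in blast)
  then have "R i x = x" if "x \<in> C" for x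
    using R_fixes_cogen[OF fi, of B x] i that \<open>cogen N = C\<close> by blast
  then have "\<epsilon> x - i x = 0" if "x \<in> C" for x
    using that counit_R[OF fi, of x] by simp
  \<comment> \<open>\<open>i\<close> agrees with the counit only on \<open>C\<close>; the difference
    annihilates \<open>C\<close> and therefore lies in \<open>J\<close> as well.\<close>
  then have "perp C (\<lambda>x. \<epsilon> x - i x)" by (auto simp: perp_def intro: fnl_minus fnl_counit fi)
  then have "(\<lambda>x. (\<epsilon> x - i x) + i x) \<in> J" using perpC i idealD(2)[OF J] by blast
  then show ?thesis by simp
qed

text \<open>Take a right coideal \<open>M\<close> in \<open>P\<close>, minimal among those not
  inside \<open>U\<close>, and \<open>f\<close> vanishing on \<open>U\<close> but not on
  \<open>M\<close>. By minimality \<open>L f\<close> maps \<open>M\<close> onto a minimal right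
  coideal, with kernel inside \<open>U\<close>; \<open>C\<close> is the simple subcoalgebra
  generated by the image. If \<open>g\<close> vanishes on \<open>C\<close>, then
  \<open>L f (R g x) = R g (L f x) = 0\<close>, so \<open>R g x\<close> lies in \<open>U\<close>,
  which puts \<open>M\<close> into the wedge.\<close>

lemma wg_step:
  assumes U: "sub U" and P: "sub P" and "\<not> P \<subseteq> U"
  shows "\<exists>C. simple C \<and> C \<subseteq> P \<and> \<not> wg U C \<inter> P \<subseteq> U"
proof -
  obtain M A where M': "Rmod M" "M \<subseteq> P" "\<not> M \<subseteq> U" "finite A" "M \<subseteq> span A"
      "\<forall>M'. Rmod M' \<and> M' \<subset> M \<longrightarrow> M' \<subseteq> U"
    using ex_min_Rmod[OF sub_Rmod[OF P] assms(3)] by (elim exE conjE)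
  note M = M'(1-3) M'(6)[rule_format, OF conjI]
  obtain m where m: "m \<in> M" "m \<notin> U" using M by blast
  obtain f where f: "perp U f" "f m = 1" using ex_perp_nonzero[OF sub_subspace[OF U] m(2)] by blast
  note ff = perp_fnl[OF f(1)]
  have Rvim: "Rmod {x\<in>M. L f x \<in> K}" if "Rmod K" for K
  proof -
    have "{x\<in>M. L f x \<in> K} = M \<inter> {x. L f x \<in> K}" by auto
    then have "subspace {x\<in>M. L f x \<in> K}"
      using M(1) that lin_L[OF ff] lin_vimage_subspace subspace_inter by (simp add: Rmod_def)
    then show ?thesis using M(1) that by (auto simp: Rmod_def L_R_swap ff)
  qed
  have N: "minR (L f ` M)"
    unfolding minR_def
  proof (intro conjI allI impI)
    show "Rmod (L f ` M)"
      using M(1) by (auto simp: Rmod_def lin_image_subspace lin_L ff L_R_swap[symmetric])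
    show "L f ` M \<noteq> {0}"
    proof
      assume "L f ` M = {0}"
      then have "L f m = 0" using m by blast
      then show False using counit_L[OF ff, of m] f(2) by (simp add: fnl_0 fnl_counit)
    qed
    fix K assume K: "Rmod K \<and> K \<subseteq> L f ` M"
    show "K = {0} \<or> K = L f ` M"
    proof (cases "{x\<in>M. L f x \<in> K} = M")
      case True then show ?thesis using K by blast
    next
      case False
      then have "{x\<in>M. L f x \<in> K} \<subseteq> U" using M(4)[OF Rvim] K by blast
      then have "K \<subseteq> {0}" using K perp_L[OF U f(1)] by blast
      then show ?thesis using K Rmod_0 by blast
    qed
  qed
  let ?C = "cogen (L f ` M)"
  have C: "simple ?C" by (rule minR_simple[OF N])
  have "L f ` M \<subseteq> P" using M(2) P by (auto simp: ff intro: fnlD_sub)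
  then have CP: "?C \<subseteq> P" by (rule cogen_minimal[OF P])
  have K: "{x\<in>M. L f x \<in> {0}} \<subseteq> U"
  proof (rule M(4)[OF Rvim])
    show "Rmod {0}" by (rule sub_Rmod[OF sub_zero])
    have "L f m \<noteq> 0" using counit_L[OF ff, of m] f(2) by (auto simp: fnl_0 fnl_counit)
    then show "{x \<in> M. L f x \<in> {0}} \<subset> M" using m by blast
  qed
  have "x \<in> wg U ?C" if x: "x \<in> M" for x
    unfolding wg_def
  proof (intro CollectI allI impI)
    fix h g assume h: "perp U h" and g: "perp ?C g"
    note fg = perp_fnl[OF g] and fh = perp_fnl[OF h]
    have "L f (R g x) = R g (L f x)" by (simp add: L_R_swap ff fg)
    also have "\<dots> = 0" by (rule perp_R[OF simple_sub[OF C] g]) (use subset_cogen x in blast)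
    finally have "R g x \<in> U" using K x M(1) Rmod_R fg by blast
    then have "h (R g x) = 0" by (rule perp_zero[OF h])
    then show "g (L h x) = 0" using conv_R[OF fh fg, of x] by (simp add: conv_def)
  qed
  with m M(2) have "\<not> wg U ?C \<inter> P \<subseteq> U" by blast
  with C CP show ?thesis by blast
qed

section \<open>The co-opposite coalgebra\<close>

lemma sweedler_coalgebra_cop: "sweedler_coalgebra scale (\<lambda>x. map prod.swap (D x)) \<epsilon>"
proof
  fix B :: "'h \<Rightarrow> 'h \<Rightarrow> 'h" assume "bilin B"
  then show "lin (\<lambda>x. sweed (map prod.swap (D x)) B)"
    unfolding sweed_flip by (rule lin_sweed_arg[OF bilin_flip])
next
  fix T :: "'h \<Rightarrow> 'h \<Rightarrow> 'h \<Rightarrow> 'h" and x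
  assume T: "\<And>b c. lin (\<lambda>a. T a b c)" "\<And>a c. lin (\<lambda>b. T a b c)" "\<And>a b. lin (\<lambda>c. T a b c)"
  show "sweed (map prod.swap (D x)) (\<lambda>a b. sweed (map prod.swap (D a)) (\<lambda>c d. T c d b)) =
        sweed (map prod.swap (D x)) (\<lambda>a b. sweed (map prod.swap (D b)) (\<lambda>c d. T a c d))"
    unfolding sweed_flip by (rule sweed_coassoc[symmetric]) (rule T)+
qed (simp_all add: sweed_flip fnl_counit sweed_counit_left sweed_counit_right)

text \<open>The two actions change places, subcoalgebras stay the same and wedges are reversed, so
  each statement about wedging on the right yields its mirror image.\<close>

lemma cop_eqs:
  shows L_cop: "sweedler_coalgebra.L scale (\<lambda>x. map prod.swap (D x)) = R"
    and R_cop: "sweedler_coalgebra.R scale (\<lambda>x. map prod.swap (D x)) = L"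
    and sub_cop: "sweedler_coalgebra.sub scale (\<lambda>x. map prod.swap (D x)) = sub"
    and simple_cop: "sweedler_coalgebra.simple scale (\<lambda>x. map prod.swap (D x)) = simple"
    and wg_cop: "sweedler_coalgebra.wg scale (\<lambda>x. map prod.swap (D x)) X Y = wg Y X"
proof -
  interpret cop: sweedler_coalgebra scale "\<lambda>x. map prod.swap (D x)" \<epsilon>
    by (rule sweedler_coalgebra_cop)
  show L: "cop.L = R" by (intro ext) (simp add: cop.L_def R_def sweed_flip)
  show R: "cop.R = L" by (intro ext) (simp add: cop.R_def L_def sweed_flip)
  show sub: "cop.sub = sub" by (intro ext) (auto simp: cop.sub_def sub_def L R)
  show "cop.simple = simple" by (intro ext) (auto simp: cop.simple_def simple_def sub)
  show "cop.wg X Y = wg Y X"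
  proof -
    have eq: "g (R f h) = f (L g h)" if "fnl f" "fnl g" for f g h
      using conv_R[OF that(2,1)] by (simp add: conv_def)
    show ?thesis unfolding cop.wg_def wg_def L by (intro Collect_cong) (metis eq perp_fnl)
  qed
qed

lemma wg_step_left:
  assumes "sub U" "sub P" "\<not> P \<subseteq> U"
  shows "\<exists>C. simple C \<and> C \<subseteq> P \<and> \<not> wg C U \<inter> P \<subseteq> U"
  using sweedler_coalgebra.wg_step[OF sweedler_coalgebra_cop] assms
  unfolding sub_cop simple_cop wg_cop by blast

section \<open>Wedges and link components\<close>

lemma wg_L:
  assumes "x \<in> wg X Y" "perp X f" "subspace Y" shows "L f x \<in> Y"
  using assms by (intro mem_by_perp) (auto simp: wg_def)

lemma wg_R:
  assumes "x \<in> wg X Y" "perp Y g" "subspace X" shows "R g x \<in> X"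
proof (rule mem_by_perp[OF assms(3)])
  fix f assume f: "perp X f"
  have "f (R g x) = conv f g x" using conv_R[of f g x] f assms(2) by (simp add: perp_fnl)
  also have "\<dots> = 0" using f assms by (simp add: wg_def conv_def)
  finally show "f (R g x) = 0" .
qed

lemma wgI_L: "(\<And>f. perp X f \<Longrightarrow> L f x \<in> Y) \<Longrightarrow> x \<in> wg X Y"
  by (auto simp: wg_def perp_zero)

lemma wgI_R: "(\<And>g. perp Y g \<Longrightarrow> R g x \<in> X) \<Longrightarrow> x \<in> wg X Y"
  unfolding wg_def using conv_R by (fastforce simp: conv_def perp_def)

lemma sub_wg:
  assumes X: "sub X" and Y: "sub Y" shows "sub (wg X Y)"
proof -
  have "subspace (wg X Y)"
    unfolding subspace_def
    by (intro conjI ballI allI; rule wgI_L)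
       (auto simp: lin_0[OF lin_L] lin_add[OF lin_L] lin_scale[OF lin_L] perp_fnl
         intro!: subspace_0 subspace_add subspace_scale sub_subspace[OF Y] wg_L)
  moreover have "L f x \<in> wg X Y" if "x \<in> wg X Y" "fnl f" for x f
  proof (rule wgI_R)
    fix g assume g: "perp Y g"
    have "R g (L f x) = L f (R g x)" using that g by (simp add: L_R_swap perp_fnl)
    also have "\<dots> \<in> X" using that g by (intro fnlD_sub X wg_R) (auto intro: sub_subspace X)
    finally show "R g (L f x) \<in> X" .
  qed
  moreover have "R f x \<in> wg X Y" if "x \<in> wg X Y" "fnl f" for x f
  proof (rule wgI_L)
    fix g assume g: "perp X g"
    have "L g (R f x) = R f (L g x)" using that g by (simp add: L_R_swap perp_fnl)
    also have "\<dots> \<in> Y" using that g by (intro fnlD_sub Y wg_L) (auto intro: sub_subspace Y)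
    finally show "L g (R f x) \<in> Y" .
  qed
  ultimately show ?thesis by (simp add: sub_def)
qed

lemma subset_wg1: "sub X \<Longrightarrow> subspace Y \<Longrightarrow> X \<subseteq> wg X Y"
  by (rule subsetI, rule wgI_L) (auto simp: perp_L subspace_0)

lemma subset_wg2: "sub Y \<Longrightarrow> subspace X \<Longrightarrow> Y \<subseteq> wg X Y"
  by (rule subsetI, rule wgI_R) (auto simp: perp_R subspace_0)

text \<open>For subcoalgebras such an \<open>a\<close> is a local idempotent: \<open>L a\<close> and
  \<open>R a\<close> are the identity on \<open>Q\<close> and zero on \<open>P\<close>.\<close>

lemma ex_perp_counit:
  assumes "subspace P" "subspace Q" "P \<inter> Q \<subseteq> {0}"
  obtains a where "perp P a" "\<And>x. x \<in> Q \<Longrightarrow> a x = \<epsilon> x"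
  using ex_fnl_extending[OF assms fnl_counit] by blast

lemma L_eq_self: "sub P \<Longrightarrow> x \<in> P \<Longrightarrow> fnl a \<Longrightarrow> (\<And>y. y \<in> P \<Longrightarrow> a y = \<epsilon> y) \<Longrightarrow> L a x = x"
  using L_agree[of P x a \<epsilon>] fnl_counit by simp

lemma R_eq_self: "sub P \<Longrightarrow> x \<in> P \<Longrightarrow> fnl a \<Longrightarrow> (\<And>y. y \<in> P \<Longrightarrow> a y = \<epsilon> y) \<Longrightarrow> R a x = x"
  using R_agree[of P x a \<epsilon>] fnl_counit by simp

lemma counit_zero: "sub P \<Longrightarrow> (\<And>x. x \<in> P \<Longrightarrow> \<epsilon> x = 0) \<Longrightarrow> P = {0}"
proof -
  assume P: "sub P" and 0: "\<And>x. x \<in> P \<Longrightarrow> \<epsilon> x = 0"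
  have "x = 0" if x: "x \<in> P" for x
  proof (rule zero_by_fnl)
    fix f assume "fnl f"
    then show "f x = 0" using counit_L[of f x] 0 fnlD_sub(1)[OF P x] by simp
  qed
  then show "P = {0}" using sub_0_mem[OF P] by blast
qed

text \<open>Otherwise there are functionals that kill \<open>X\<close>, respectively
  \<open>Y\<close>, and agree with the counit on \<open>E\<close>. Their convolution equals the
  counit on \<open>E\<close> and also vanishes there, but the counit is not zero on a nonzero
  subcoalgebra.\<close>

lemma simple_in_wg:
  assumes E: "simple E" "E \<subseteq> wg X Y" and X: "sub X" and Y: "sub Y"
  shows "E \<subseteq> X \<or> E \<subseteq> Y"
proof (rule ccontr)
  assume "\<not> (E \<subseteq> X \<or> E \<subseteq> Y)"
  then have *: "X \<inter> E \<subseteq> {0}" "Y \<inter> E \<subseteq> {0}" using simple_Int[OF E(1)] X Y by blast+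
  note subs = sub_subspace[OF X] sub_subspace[OF Y] sub_subspace[OF simple_sub[OF E(1)]]
  obtain f where f: "perp X f" "\<And>x. x \<in> E \<Longrightarrow> f x = \<epsilon> x" using ex_perp_counit[OF subs(1,3) *(1)] by blast
  obtain g where g: "perp Y g" "\<And>x. x \<in> E \<Longrightarrow> g x = \<epsilon> x" using ex_perp_counit[OF subs(2,3) *(2)] by blast
  have "\<epsilon> x = 0" if x: "x \<in> E" for x
  proof -
    have "L f x = x" using L_eq_self[OF simple_sub[OF E(1)] x perp_fnl[OF f(1)]] f(2) by blast
    moreover have "g (L f x) = 0" using x E(2) f g by (auto simp: wg_def)
    ultimately show ?thesis using g(2) x by simp
  qed
  then show False using counit_zero[OF simple_sub[OF E(1)]] simple_nonzero[OF E(1)] by blast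
qed

text \<open>Only finitely many members of \<open>A\<close> contribute to a given element
  \<open>c\<close> of \<open>C\<close>. If none contained \<open>C\<close>, convolving their local
  idempotents would give a functional that fixes \<open>c\<close> and kills every
  contribution.\<close>

lemma simple_in_span_Union:
  assumes C: "simple C" "C \<subseteq> span (\<Union>A)" and A: "\<And>Q. Q \<in> A \<Longrightarrow> sub Q"
  shows "\<exists>Q\<in>A. C \<subseteq> Q"
proof (rule ccontr)
  assume "\<not> (\<exists>Q\<in>A. C \<subseteq> Q)"
  then have 0: "Q \<inter> C \<subseteq> {0}" if "Q \<in> A" for Q using simple_Int[OF C(1)] A that by blast
  note sC = simple_sub[OF C(1)]
  have unit: "\<exists>a. fnl a \<and> (\<forall>Q\<in>F. perp Q a) \<and> (\<forall>x\<in>C. a x = \<epsilon> x)" if "finite F" "F \<subseteq> A" for F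
    using that
  proof (induction F rule: finite_induct)
    case empty then show ?case using fnl_counit by auto
  next
    case (insert Q F)
    then obtain a where a: "fnl a" "\<forall>Q\<in>F. perp Q a" "\<forall>x\<in>C. a x = \<epsilon> x" by auto
    obtain b where b: "perp Q b" "\<And>x. x \<in> C \<Longrightarrow> b x = \<epsilon> x"
      using ex_perp_counit[OF sub_subspace sub_subspace[OF sC] 0, of Q] A insert by blast
    have "conv a b x = \<epsilon> x" if "x \<in> C" for x
      using that b L_eq_self[OF sC that a(1)] a(3) by (simp add: conv_def)
    moreover have "perp Q (conv a b)" using b a insert A by (auto intro: perp_conv_right)
    moreover have "perp Q' (conv a b)" if "Q' \<in> F" for Q'
      using that a(2) A insert perp_fnl[OF b(1)] by (auto intro: perp_conv_left)
    ultimately show ?case using fnl_conv[OF a(1) perp_fnl[OF b(1)]] by blast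
  qed
  have "c = 0" if c: "c \<in> C" for c
  proof -
    have "c \<in> span (\<Union>A)" using c C by blast
    then obtain T where T: "finite T" "T \<subseteq> \<Union>A" "c \<in> span T" by (rule span_finite_subset)
    then have "\<forall>t\<in>T. \<exists>Q. Q \<in> A \<and> t \<in> Q" by blast
    then obtain q where q: "\<forall>t\<in>T. q t \<in> A \<and> t \<in> q t" by metis
    obtain a where a: "fnl a" "\<forall>Q\<in>q ` T. perp Q a" "\<forall>x\<in>C. a x = \<epsilon> x"
      using unit[of "q ` T"] T(1) q by auto
    have "subspace {x. R a x = 0}"
      using lin_R[OF a(1)] by (auto simp: subspace_def lin_0 lin_add lin_scale)
    moreover have "T \<subseteq> {x. R a x = 0}" using q a(2) A perp_R by blast
    ultimately have "R a c = 0" using T(3) span_minimal by blast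
    moreover have "R a c = c" using R_eq_self[OF sC c a(1)] a(3) by blast
    ultimately show ?thesis by simp
  qed
  then show False using simple_nonzero[OF C(1)] sub_0_mem[OF sC] by blast
qed

section \<open>The coradical and its subcoalgebras\<close>

definition corad :: "'h set" where "corad = span (\<Union>{C. simple C})"

lemma sub_corad: "sub corad"
  unfolding corad_def by (rule sub_span_Union) (auto intro: simple_sub)

lemma simple_subset_corad: "simple C \<Longrightarrow> C \<subseteq> corad"
  unfolding corad_def by (blast intro: span_base)

text \<open>Split \<open>x\<close> along the simple subcoalgebras inside and outside
  \<open>P\<close>. The second summand lies in \<open>P\<close> and in the sum of the outer ones; a
  simple subcoalgebra of this intersection would be an outer one lying inside
  \<open>P\<close>.\<close>

lemma subset_corad:
  assumes P: "sub P" "P \<subseteq> corad"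
  shows "P \<subseteq> span (\<Union>{C. simple C \<and> C \<subseteq> P})"
proof
  fix x assume x: "x \<in> P"
  let ?A = "{C. simple C \<and> C \<subseteq> P}" and ?B = "{C. simple C \<and> \<not> C \<subseteq> P}"
  have "{C. simple C} = ?A \<union> ?B" by blast
  then have "x \<in> span (\<Union>?A \<union> \<Union>?B)" using x P by (auto simp: corad_def)
  then obtain a b where ab: "a \<in> span (\<Union>?A)" "b \<in> span (\<Union>?B)" "x = a + b"
    unfolding span_Un by blast
  have sB: "sub (span (\<Union>?B))" by (rule sub_span_Union) (auto intro: simple_sub)
  have "span (\<Union>?A) \<subseteq> P" by (rule span_minimal) (auto intro: sub_subspace P)
  then have "b \<in> P" using ab x subspace_diff[OF sub_subspace[OF P(1)], of x a] by auto
  moreover have "P \<inter> span (\<Union>?B) = {0}"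
  proof (rule ccontr)
    assume "P \<inter> span (\<Union>?B) \<noteq> {0}"
    then obtain E where E: "simple E" "E \<subseteq> P \<inter> span (\<Union>?B)" using ex_simple sub_Int[OF P(1) sB] by metis
    then obtain Q where "Q \<in> ?B" "E \<subseteq> Q" using simple_in_span_Union[of E ?B] simple_sub by blast
    then show False using E simple_subset_eq[OF E(1)] by blast
  qed
  ultimately have "b = 0" using ab(2) by blast
  then show "x \<in> span (\<Union>?A)" using ab by simp
qed

text \<open>For subcoalgebras \<open>C + E\<close> is always contained in both wedges, so only the
  failure of the converse is recorded; \<open>directly_linked_iff\<close> makes the
  comparison.\<close>

definition dl :: "'h set \<Rightarrow> 'h set \<Rightarrow> bool" where
  "dl C E \<longleftrightarrow> \<not> (wg C E \<subseteq> C + E \<and> wg E C \<subseteq> C + E)"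

definition link_closed :: "'h set set \<Rightarrow> bool" where
  "link_closed T \<longleftrightarrow> (\<forall>C E. simple C \<and> simple E \<and> dl C E \<longrightarrow> (C \<in> T \<longleftrightarrow> E \<in> T))"

text \<open>The largest subcoalgebra whose simple subcoalgebras all belong to \<open>T\<close>; that
  the sum keeps this property is \<open>simple_subset_comp\<close>. For a link class it is the link
  component.\<close>

definition comp :: "'h set set \<Rightarrow> 'h set" where
  "comp T = span (\<Union>{Q. sub Q \<and> (\<forall>C. simple C \<and> C \<subseteq> Q \<longrightarrow> C \<in> T)})"

lemma link_closed_compl: "link_closed T \<Longrightarrow> link_closed (- T)"
  by (auto simp: link_closed_def)

lemma sub_comp: "sub (comp T)"
  unfolding comp_def by (rule sub_span_Union) simp

lemma subset_comp: "sub Q \<Longrightarrow> (\<And>C. simple C \<Longrightarrow> C \<subseteq> Q \<Longrightarrow> C \<in> T) \<Longrightarrow> Q \<subseteq> comp T"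
  unfolding comp_def by (blast intro: span_base)

lemma simple_subset_comp: "simple C \<Longrightarrow> C \<subseteq> comp T \<longleftrightarrow> C \<in> T"
proof
  assume C: "simple C" "C \<subseteq> comp T"
  then show "C \<in> T" using simple_in_span_Union[OF C[unfolded comp_def]] by blast
next
  assume C: "simple C" "C \<in> T"
  show "C \<subseteq> comp T"
    by (rule subset_comp[OF simple_sub[OF C(1)]]) (use simple_subset_eq C in metis)
qed

lemma comp_Int_compl: "comp T \<inter> comp (- T) = {0}"
proof (rule ccontr)
  assume "comp T \<inter> comp (- T) \<noteq> {0}"
  then obtain E where "simple E" "E \<subseteq> comp T \<inter> comp (- T)"
    using ex_simple sub_Int[OF sub_comp sub_comp] by metis
  then show False using simple_subset_comp[of E T] simple_subset_comp[of E "- T"] by auto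
qed

lemma wg_comp: 
  assumes "sub X" "X \<subseteq> comp T" "sub Y" "Y \<subseteq> comp T" shows "wg X Y \<subseteq> comp T"
proof (rule subset_comp)
  show "sub (wg X Y)" using assms sub_wg by blast
  fix E assume "simple E" "E \<subseteq> wg X Y"
  then show "E \<in> T" using simple_in_wg[of E X Y] assms simple_subset_comp[of E T] by blast
qed

text \<open>If \<open>a\<close> kills \<open>X\<close> and \<open>f\<close> kills \<open>Y\<close>,
  their convolution kills \<open>X + Y\<close>; acting by \<open>a\<close> therefore removes
  \<open>X\<close> from the left factor of the wedge.\<close>

lemma L_in_wg_left:
  assumes x: "x \<in> wg (X + Y) Z" and X: "sub X" and Y: "sub Y" and Z: "sub Z" and a: "perp X a"
  shows "L a x \<in> wg Y Z"
proof (rule wgI_L)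
  fix f assume f: "perp Y f"
  note [simp] = perp_fnl[OF a] perp_fnl[OF f]
  have "perp X (conv a f)" "perp Y (conv a f)"
    using perp_conv_left[OF X a] perp_conv_right[OF Y f] by auto
  then have "perp (X + Y) (conv a f)"
    by (auto simp: perp_def set_plus_def fnl_add)
  then show "L f (L a x) \<in> Z" using wg_L[OF x _ sub_subspace[OF Z]] by (simp add: L_L)
qed

lemma R_in_wg_right:
  assumes x: "x \<in> wg Z (X + Y)" and X: "sub X" and Y: "sub Y" and Z: "sub Z" and a: "perp Y a"
  shows "R a x \<in> wg Z X"
proof (rule wgI_R)
  fix f assume f: "perp X f"
  note [simp] = perp_fnl[OF a] perp_fnl[OF f]
  have "perp X (conv f a)" "perp Y (conv f a)"
    using perp_conv_left[OF X f] perp_conv_right[OF Y a] by auto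
  then have "perp (X + Y) (conv f a)"
    by (auto simp: perp_def set_plus_def fnl_add)
  then show "R f (R a x) \<in> Z" using wg_R[OF x _ sub_subspace[OF Z]] by (simp add: R_R)
qed

text \<open>By the mirror of \<open>wg_step\<close> only elements that also lie in a wedge with a
  simple \<open>E\<close> on the left matter. Local idempotents split such an element into a part in
  \<open>comp T\<close> and a part in the wedge of \<open>E\<close> and \<open>C\<close>. If
  \<open>E\<close> is in \<open>T\<close>, the absence of links confines this wedge to
  \<open>E + C\<close>; if \<open>E = C\<close>, the same idempotents acting on the left bring both
  pieces into \<open>C\<close>.\<close>

lemma wg_comp_simple:
  assumes T: "link_closed T" and C: "simple C" "C \<notin> T"
  shows "wg (comp T) C \<subseteq> comp T + C"
proof (rule ccontr)
  let ?Y = "comp T"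
  note sC = simple_sub[OF C(1)] and sY = sub_comp[of T]
  assume "\<not> wg ?Y C \<subseteq> ?Y + C"
  then obtain E where E: "simple E" "E \<subseteq> wg ?Y C" "\<not> wg E (?Y + C) \<inter> wg ?Y C \<subseteq> ?Y + C"
    using wg_step_left[OF sub_sumset[OF sY sC] sub_wg[OF sY sC]] by blast
  have CY: "?Y \<inter> C \<subseteq> {0}"
    using simple_Int[OF C(1) sY] simple_subset_comp[OF C(1)] C(2) by blast
  obtain a where a: "perp ?Y a" "\<And>x. x \<in> C \<Longrightarrow> a x = \<epsilon> x"
    using ex_perp_counit[OF sub_subspace[OF sY] sub_subspace[OF sC] CY] by blast
  note fa = perp_fnl[OF a(1)]
  define b where "b = (\<lambda>x. \<epsilon> x - a x)"
  have b: "perp C b" using a(2) by (auto simp: b_def perp_def intro: fnl_minus fnl_counit fa)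
  have Rsplit: "x = R b x + R a x" and Lsplit: "x = L b x + L a x" for x
    by (simp_all add: b_def R_minus L_minus)
  have "x \<in> ?Y + C" if x: "x \<in> wg E (?Y + C)" "x \<in> wg ?Y C" for x
  proof -
    have "R b x \<in> ?Y" using wg_R[OF x(2) b sub_subspace[OF sY]] .
    moreover have "R a x \<in> ?Y + C"
    proof -
      have z: "R a x \<in> wg E C"
        using R_in_wg_right[of x E C ?Y a] x(1) sC sY simple_sub[OF E(1)] a(1) by (simp add: add.commute)
      have z': "R a x \<in> wg ?Y C" using fnlD_sub(2)[OF sub_wg[OF sY sC] x(2) fa] .
      consider "E \<subseteq> ?Y" | "E \<subseteq> C" using simple_in_wg[OF E(1,2) sY sC] by blast
      then show ?thesis
      proof cases
        case 1
        then have "E \<in> T" using simple_subset_comp[OF E(1)] by blast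
        then have "wg E C \<subseteq> E + C" using T C E(1) by (auto simp: link_closed_def dl_def)
        then show ?thesis using z 1 by (meson set_plus_mono2 subset_iff subset_refl)
      next
        case 2
        then have "R a x \<in> wg C C" using z simple_subset_eq[OF E(1) C(1)] by blast
        then have "L b (R a x) \<in> C" "L a (R a x) \<in> C"
          using wg_L[OF _ b sub_subspace[OF sC]] wg_L[OF z' a(1) sub_subspace[OF sC]] by auto
        then have "R a x \<in> C" using Lsplit[of "R a x"] subspace_add[OF sub_subspace[OF sC]] by metis
        then show ?thesis using subset_sumset2[OF sub_subspace[OF sY]] by blast
      qed
    qed
    ultimately show ?thesis
      using Rsplit[of x] subspace_add[OF subspace_sumset[OF sub_subspace[OF sY] sub_subspace[OF sC]]]
        subset_sumset1[OF sub_subspace[OF sC]] by (metis subsetD)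
  qed
  with E(3) show False by blast
qed

text \<open>If the sum were proper, its wedge with some simple \<open>C\<close> would leave it. Two
  local idempotents split this wedge into wedges of \<open>comp T\<close> and of
  \<open>comp (- T)\<close> with \<open>C\<close>; one of these summands contains \<open>C\<close>,
  and \<open>wg_comp_simple\<close> handles the other.\<close>

lemma comp_decomposition:
  assumes T: "link_closed T" shows "comp T + comp (- T) = UNIV"
proof (rule ccontr)
  let ?X = "comp T" and ?Y = "comp (- T)"
  note sX = sub_comp[of T] and sY = sub_comp[of "- T"]
  let ?U = "?X + ?Y"
  assume "?U \<noteq> UNIV"
  then obtain C where C: "simple C" "\<not> wg ?U C \<subseteq> ?U"
    using wg_step[OF sub_sumset[OF sX sY] sub_UNIV] by auto
  note sC = simple_sub[OF C(1)]
  have sub1: "?X \<subseteq> ?U" "?Y \<subseteq> ?U"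
    using subset_sumset1 subset_sumset2 sub_subspace[OF sX] sub_subspace[OF sY] by auto
  have key: "wg (comp S) C \<subseteq> ?U" if "S = T \<or> S = - T" for S
  proof (cases "C \<in> S")
    case True
    then have "wg (comp S) C \<subseteq> comp S" using wg_comp[OF sub_comp _ sC] simple_subset_comp[OF C(1)] by blast
    then show ?thesis using that sub1 by blast
  next
    case False
    then have "wg (comp S) C \<subseteq> comp S + C"
      using that wg_comp_simple[OF _ C(1)] T link_closed_compl by auto
    also have "\<dots> \<subseteq> ?U"
    proof (rule sumset_subset[OF sub_subspace[OF sub_sumset[OF sX sY]]])
      show "comp S \<subseteq> ?U" using that sub1 by blast
      have "C \<subseteq> comp (- S)" using False simple_subset_comp[OF C(1)] by blast
      moreover have "comp (- S) \<subseteq> ?U" using that sub1 by auto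
      ultimately show "C \<subseteq> ?U" by (rule order.trans)
    qed
    finally show ?thesis .
  qed
  obtain a where a: "perp ?X a" "\<And>x. x \<in> ?Y \<Longrightarrow> a x = \<epsilon> x"
    using ex_perp_counit[OF sub_subspace[OF sX] sub_subspace[OF sY]] comp_Int_compl by blast
  note fa = perp_fnl[OF a(1)]
  define b where "b = (\<lambda>x. \<epsilon> x - a x)"
  have b: "perp ?Y b" using a(2) by (auto simp: b_def perp_def intro: fnl_minus fnl_counit fa)
  have "x \<in> ?U" if x: "x \<in> wg ?U C" for x
  proof -
    have "L a x \<in> wg ?Y C" by (rule L_in_wg_left[OF x sX sY sC a(1)])
    moreover have "L b x \<in> wg ?X C"
      by (rule L_in_wg_left[OF _ sY sX sC b]) (use x in \<open>simp add: add.commute\<close>)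
    ultimately have "L a x \<in> ?U" "L b x \<in> ?U" using key by blast+
    moreover have "x = L a x + L b x" by (simp add: b_def L_minus)
    ultimately show ?thesis using subspace_add[OF sub_subspace[OF sub_sumset[OF sX sY]]] by metis
  qed
  with C(2) show False by blast
qed

section \<open>The central functional of a component\<close>

text \<open>When \<open>T\<close> is link-closed, the decomposition determines this functional: it
  is the central idempotent of the dual algebra that belongs to \<open>comp T\<close>, and
  \<open>L (ce T)\<close> is the projection onto that summand.\<close>

definition ce :: "'h set set \<Rightarrow> 'h \<Rightarrow> 'k" where
  "ce T = (SOME f. perp (comp (- T)) f \<and> (\<forall>x\<in>comp T. f x = \<epsilon> x))"

lemma ce: "perp (comp (- T)) (ce T)" "x \<in> comp T \<Longrightarrow> ce T x = \<epsilon> x"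
proof -
  have "\<exists>f. perp (comp (- T)) f \<and> (\<forall>x\<in>comp T. f x = \<epsilon> x)"
    using ex_fnl_extending[OF _ _ _ fnl_counit, of "comp (- T)" "comp T"]
      comp_Int_compl[of T] sub_subspace[OF sub_comp] by blast
  from someI_ex[OF this] show "perp (comp (- T)) (ce T)" "x \<in> comp T \<Longrightarrow> ce T x = \<epsilon> x"
    unfolding ce_def by blast+
qed

lemma fnl_ce: "fnl (ce T)"
  using ce(1) perp_fnl by blast

lemma ce_zero: "x \<in> comp (- T) \<Longrightarrow> ce T x = 0"
  using ce(1) perp_zero by blast

lemma ce_split:
  assumes "link_closed T" obtains y z where "x = y + z" "y \<in> comp T" "z \<in> comp (- T)"
  using comp_decomposition[OF assms] by (metis UNIV_I set_plus_elim)

lemma ce_L_R: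
  assumes "y \<in> comp T" "z \<in> comp (- T)"
  shows "L (ce T) (y + z) = y" "R (ce T) (y + z) = y"
  using L_eq_self[OF sub_comp assms(1) fnl_ce ce(2)] R_eq_self[OF sub_comp assms(1) fnl_ce ce(2)]
    perp_L[OF sub_comp ce(1) assms(2)] perp_R[OF sub_comp ce(1) assms(2)]
  by (simp_all add: lin_add[OF lin_L] lin_add[OF lin_R] fnl_ce)

lemma ce_central: "link_closed T \<Longrightarrow> L (ce T) x = R (ce T) x"
  by (erule ce_split[of T x]) (simp add: ce_L_R)

lemma L_ce_mem: "link_closed T \<Longrightarrow> L (ce T) x \<in> comp T"
  by (erule ce_split[of T x]) (simp add: ce_L_R)

lemma ce_idem: "link_closed T \<Longrightarrow> ce T (L (ce T) x) = ce T x"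
  by (erule ce_split[of T x]) (simp add: ce_L_R fnl_add fnl_ce ce_zero)

lemma ce_compl: "link_closed T \<Longrightarrow> ce T x + ce (- T) x = \<epsilon> x"
  by (erule ce_split[of T x])
     (use ce(2)[of _ T] ce(2)[of _ "- T"] ce_zero[of _ T] ce_zero[of _ "- T"] in
       \<open>simp add: fnl_add fnl_ce fnl_counit\<close>)

lemma L_ce_plus: "link_closed T \<Longrightarrow> L (ce T) x + L (ce (- T)) x = x"
proof -
  assume "link_closed T"
  then have "(\<lambda>x. ce T x + ce (- T) x) = \<epsilon>" by (intro ext) (rule ce_compl)
  then show ?thesis using L_plus[of "ce T" "ce (- T)" x, symmetric] by simp
qed

text \<open>The projection to the complementary summand vanishes on \<open>Q\<close>. Inclusions
  into a component are thus tested by the values of one functional.\<close>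

lemma subset_comp_ce:
  assumes T: "link_closed T" and Q: "sub Q" and 0: "\<And>x. x \<in> Q \<Longrightarrow> ce (- T) x = 0"
  shows "Q \<subseteq> comp T"
proof
  fix x assume x: "x \<in> Q"
  have "perp Q (ce (- T))" using 0 fnl_ce by (simp add: perp_def)
  then have "L (ce (- T)) x = 0" using perp_L[OF Q _ x] by blast
  moreover have "L (ce T) x + L (ce (- T)) x = x" by (rule L_ce_plus[OF T])
  ultimately show "x \<in> comp T" using L_ce_mem[OF T] by (metis add.right_neutral)
qed

text \<open>Wedge induction: the largest subcoalgebra of \<open>P\<close> on which the family
  vanishes contains the part in \<open>P\<close> of its wedge with any simple subcoalgebra of
  \<open>P\<close>, so it is all of \<open>P\<close>. A whole family is carried along because the
  wedge step for one functional uses other members on the legs.\<close>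

lemma vanish_by_simples:
  assumes \<Psi>: "\<And>\<psi>. \<psi> \<in> \<Psi> \<Longrightarrow> fnl \<psi>" and P: "sub P"
    and simples: "\<And>C \<psi> x. simple C \<Longrightarrow> C \<subseteq> P \<Longrightarrow> \<psi> \<in> \<Psi> \<Longrightarrow> x \<in> C \<Longrightarrow> \<psi> x = 0"
    and wedge: "\<And>U C \<psi> x. sub U \<Longrightarrow> sub C \<Longrightarrow> (\<And>\<psi> x. \<psi> \<in> \<Psi> \<Longrightarrow> x \<in> U \<Longrightarrow> \<psi> x = 0) \<Longrightarrow>
      (\<And>\<psi> x. \<psi> \<in> \<Psi> \<Longrightarrow> x \<in> C \<Longrightarrow> \<psi> x = 0) \<Longrightarrow> \<psi> \<in> \<Psi> \<Longrightarrow> x \<in> wg U C \<Longrightarrow> \<psi> x = 0"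
    and \<psi>: "\<psi> \<in> \<Psi>" "x \<in> P"
  shows "\<psi> x = 0"
proof -
  define A where "A = {Q. sub Q \<and> Q \<subseteq> P \<and> (\<forall>\<psi>\<in>\<Psi>. \<forall>x\<in>Q. \<psi> x = 0)}"
  define U where "U = span (\<Union>A)"
  have U: "sub U" unfolding U_def by (rule sub_span_Union) (simp add: A_def)
  have U0: "\<psi> x = 0" if "\<psi> \<in> \<Psi>" "x \<in> U" for \<psi> x
  proof -
    have "\<Union>A \<subseteq> {x. \<psi> x = 0}" using that(1) by (auto simp: A_def)
    from span_minimal[OF this fnl_kernel_subspace[OF \<Psi>[OF that(1)]]] that(2)
    show ?thesis by (auto simp: U_def)
  qed
  have "P \<subseteq> U"
  proof (rule ccontr)
    assume "\<not> P \<subseteq> U"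
    then obtain C where C: "simple C" "C \<subseteq> P" "\<not> wg U C \<inter> P \<subseteq> U" using wg_step[OF U P] by blast
    have "\<psi> x = 0" if "\<psi> \<in> \<Psi>" "x \<in> wg U C" for \<psi> x
      by (rule wedge[OF U simple_sub[OF C(1)]]) (use U0 simples[OF C(1,2)] that in auto)
    then have "wg U C \<inter> P \<in> A"
      unfolding A_def using sub_Int[OF sub_wg[OF U simple_sub[OF C(1)]] P] by blast
    then show False using C(3) by (auto simp: U_def intro: span_base)
  qed
  with U0 \<psi> show ?thesis by blast
qed

section \<open>Link classes\<close>

definition linkrel :: "('h set \<times> 'h set) set" where
  "linkrel = {(C, E). simple C \<and> simple E \<and> dl C E}\<^sup>*"

definition cls :: "'h set \<Rightarrow> 'h set set" where
  "cls C = {E. simple E \<and> (C, E) \<in> linkrel}"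

lemma dl_sym: "dl C E \<longleftrightarrow> dl E C"
  by (auto simp: dl_def add.commute)

lemma linkrel_sym: "(C, E) \<in> linkrel \<Longrightarrow> (E, C) \<in> linkrel"
proof -
  have "sym {(C, E). simple C \<and> simple E \<and> dl C E}" unfolding sym_def by (clarsimp, metis dl_sym)
  from symD[OF sym_rtrancl[OF this]] show "(C, E) \<in> linkrel \<Longrightarrow> (E, C) \<in> linkrel"
    unfolding linkrel_def .
qed

lemma linkrel_trans: "(C, E) \<in> linkrel \<Longrightarrow> (E, G) \<in> linkrel \<Longrightarrow> (C, G) \<in> linkrel"
  unfolding linkrel_def by (rule rtrancl_trans)

lemma cls_self: "simple C \<Longrightarrow> C \<in> cls C"
  by (simp add: cls_def linkrel_def)

lemma link_closed_cls: "link_closed (cls C)"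
proof -
  have "(C, E) \<in> linkrel \<Longrightarrow> (C, G) \<in> linkrel" if "simple E" "simple G" "dl E G" for E G
    using that unfolding linkrel_def by (auto intro: rtrancl_into_rtrancl)
  then show ?thesis unfolding link_closed_def cls_def using dl_sym by blast
qed

lemma link_closed_Union: "(\<And>T. T \<in> A \<Longrightarrow> link_closed T) \<Longrightarrow> link_closed (\<Union>A)"
  unfolding link_closed_def by blast

lemma simple_subset_comp_cls: "simple C \<Longrightarrow> C \<subseteq> comp (cls C)"
  by (simp add: simple_subset_comp cls_self)

text \<open>The wedge of the right side \<open>U\<close> with a simple \<open>E\<close> in the class
  of \<open>C\<close> stays in \<open>U\<close>: the idempotent of that class sends it into
  \<open>comp (cls C)\<close>, and the complementary one sends it into \<open>U\<close>, since by
  centrality it may act on the leg in \<open>E\<close>, where it vanishes.\<close>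

lemma comp_subset_span:
  assumes A: "\<And>C. C \<in> A \<Longrightarrow> simple C"
  shows "comp (\<Union>(cls ` A)) \<subseteq> span (\<Union>{comp (cls C) |C. C \<in> A})"
proof (rule ccontr)
  let ?T = "\<Union>(cls ` A)"
  let ?U = "span (\<Union>{comp (cls C) |C. C \<in> A})"
  assume "\<not> comp ?T \<subseteq> ?U"
  have U: "sub ?U" by (rule sub_span_Union) (auto intro: sub_comp)
  from wg_step[OF U sub_comp \<open>\<not> comp ?T \<subseteq> ?U\<close>]
  obtain E where E: "simple E" "E \<subseteq> comp ?T" "\<not> wg ?U E \<subseteq> ?U" by blast
  then have "E \<in> ?T" using simple_subset_comp by blast
  then obtain C where C: "C \<in> A" "E \<in> cls C" by blast
  let ?e = "ce (cls C)" and ?e' = "ce (- cls C)"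
  have lc: "link_closed (cls C)" "link_closed (- cls C)"
    using link_closed_cls link_closed_compl by auto
  have "x \<in> ?U" if x: "x \<in> wg ?U E" for x
  proof -
    have "L ?e x \<in> comp (cls C)" by (rule L_ce_mem[OF lc(1)])
    then have "L ?e x \<in> ?U" using C(1) by (blast intro: span_base)
    moreover have "L ?e' x \<in> ?U"
    proof (rule mem_by_perp[OF sub_subspace[OF U]])
      fix f assume f: "perp ?U f"
      have "L f x \<in> E" by (rule wg_L[OF x f sub_subspace[OF simple_sub[OF E(1)]]])
      moreover have "E \<subseteq> comp (cls C)" using simple_subset_comp[OF E(1)] C(2) by blast
      ultimately have "?e' (L f x) = 0" by (intro ce_zero) auto
      moreover have "f (L ?e' x) = f (R ?e' x)" by (simp add: ce_central[OF lc(2)])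
      moreover have "f (R ?e' x) = ?e' (L f x)"
        using conv_R[OF perp_fnl[OF f] fnl_ce[of "- cls C"], of x] by (simp add: conv_def)
      ultimately show "f (L ?e' x) = 0" by simp
    qed
    ultimately have "L ?e x + L ?e' x \<in> ?U" by (rule span_add)
    then show ?thesis unfolding L_ce_plus[OF lc(1)] .
  qed
  with E(3) show False by blast
qed

end

section \<open>Hopf algebras in Sweedler form\<close>

context sweedler_coalgebra
begin

lemma ideal_L:
  assumes W: "\<And>f x. fnl f \<Longrightarrow> x \<in> W \<Longrightarrow> L f x \<in> W" and V: "sub V"
  shows "ideal {f. fnl f \<and> (\<forall>x\<in>W. L f x \<in> V)}"
  using assms unfolding ideal_def sub_def
  by (auto simp: L_plus L_minus L_L[symmetric] intro: fnl_plus fnl_minus fnl_conv subspace_add subspace_diff)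

text \<open>A minimal right coideal is finite-dimensional and generates \<open>C\<close>; the left
  action only produces combinations of the right legs of the coproducts of finitely many spanning
  vectors.\<close>

lemma simple_finite:
  assumes "simple C" shows "\<exists>A. finite A \<and> C \<subseteq> span A"
proof -
  obtain N A where N: "minR N" "N \<subseteq> C" "finite A" "N \<subseteq> span A"
    using ex_minR[OF sub_Rmod[OF simple_sub[OF assms]] simple_nonzero[OF assms]] by metis
  have C: "cogen N = C"
    using simple_subset_eq[OF minR_simple[OF N(1)] assms] cogen_minimal[OF simple_sub[OF assms] N(2)] .
  let ?B = "\<Union>a\<in>A. snd ` set (D a)"
  have L: "L f n \<in> span ?B" if f: "fnl f" and n: "n \<in> N" for f n
  proof -
    have "A \<subseteq> {x. L f x \<in> span ?B}"
    proof
      fix a assume a: "a \<in> A"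
      have "L f a \<in> span ?B" unfolding L_def
      proof (rule sweed_mem)
        fix p q assume "(p, q) \<in> set (D a)"
        then have "q \<in> ?B" using a by force
        then show "f p *s q \<in> span ?B" by (intro span_scale span_base)
      qed simp
      then show "a \<in> {x. L f x \<in> span ?B}" by simp
    qed
    from span_minimal[OF this lin_vimage_subspace[OF lin_L[OF f] subspace_span]] N(4) n
    show ?thesis by blast
  qed
  have "C \<subseteq> span ?B" unfolding C[symmetric] cogen_def by (rule span_minimal) (use L in auto)
  moreover have "finite ?B" using N(3) by simp
  ultimately show ?thesis by blast
qed

end

text \<open>Product and unit are parameters and not those of a type class, so that the opposite
  product with the reversed coproduct is an instance on the same type.\<close>

locale sweedler_hopf = sweedler_coalgebra scale D \<epsilon>
  for scale :: "'k::field \<Rightarrow> 'h::ab_group_add \<Rightarrow> 'h" (infixr \<open>*s\<close> 75)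
    and D :: "'h \<Rightarrow> ('h \<times> 'h) list" and \<epsilon> :: "'h \<Rightarrow> 'k" +
  fixes mul :: "'h \<Rightarrow> 'h \<Rightarrow> 'h" (infixl \<open>\<cdot>\<close> 80) and one :: 'h and S :: "'h \<Rightarrow> 'h"
  assumes bilin_mul: "bilin (\<cdot>)"
    and mul_assoc: "(x \<cdot> y) \<cdot> z = x \<cdot> (y \<cdot> z)"
    and one_mul [simp]: "one \<cdot> x = x" and mul_one [simp]: "x \<cdot> one = x"
    and sweed_mul: "bilin B \<Longrightarrow> sweed (D (x \<cdot> y)) B =
          sweed (D x) (\<lambda>a b. sweed (D y) (\<lambda>c d. B (a \<cdot> c) (b \<cdot> d)))"
    and sweed_one: "bilin B \<Longrightarrow> sweed (D one) B = B one one"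
    and counit_mul: "\<epsilon> (x \<cdot> y) = \<epsilon> x * \<epsilon> y" and counit_one [simp]: "\<epsilon> one = 1"
    and lin_S: "lin S"
    and antipode_left: "sweed (D x) (\<lambda>a b. S a \<cdot> b) = \<epsilon> x *s one"
    and antipode_right: "sweed (D x) (\<lambda>a b. a \<cdot> S b) = \<epsilon> x *s one"
begin

section \<open>Linearity rules and consequences of the antipode axioms\<close>

lemma lin_mul1: "lin f \<Longrightarrow> lin (\<lambda>x. f x \<cdot> c)"
  and lin_mul2: "lin f \<Longrightarrow> lin (\<lambda>x. c \<cdot> f x)"
  using bilin_mul by (auto simp: bilin_def lin_def)

lemma lin_S_comp: "lin f \<Longrightarrow> lin (\<lambda>x. S (f x))"
  using lin_S by (auto simp: lin_def)

lemma lin_sweed_comp: "bilin B \<Longrightarrow> lin f \<Longrightarrow> lin (\<lambda>x. sweed (D (f x)) B)"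
  using lin_comp[OF lin_sweed_arg] .

lemma lin_L_comp: "fnl u \<Longrightarrow> lin f \<Longrightarrow> lin (\<lambda>x. L u (f x))"
  and lin_R_comp: "fnl u \<Longrightarrow> lin f \<Longrightarrow> lin (\<lambda>x. R u (f x))"
  using lin_comp[OF lin_L] lin_comp[OF lin_R] by auto

lemmas lin_rules = lin_id lin_mul1 lin_mul2 lin_S_comp lin_cscale lin_fscale bilinI
  lin_sweed_comp lin_sweed_fun lin_L_comp lin_R_comp fnl_counit

lemma mul_scale: "(c *s x) \<cdot> y = c *s (x \<cdot> y)" "x \<cdot> (c *s y) = c *s (x \<cdot> y)"
  using bilin_mul by (auto simp: bilin_def lin_def)

lemma S_scale: "S (c *s x) = c *s S x"
  using lin_S by (simp add: lin_def)

lemma sweed_mul_left: "x \<cdot> sweed xs B = sweed xs (\<lambda>a b. x \<cdot> B a b)"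
  by (rule lin_sweed) (rule lin_mul2[OF lin_id])

lemma sweed_mul_right: "sweed xs B \<cdot> x = sweed xs (\<lambda>a b. B a b \<cdot> x)"
  by (rule lin_sweed[of "\<lambda>y. y \<cdot> x"]) (rule lin_mul1[OF lin_id])

lemma sweed_counit_left_lin: "lin f \<Longrightarrow> sweed (D x) (\<lambda>a b. \<epsilon> a *s f b) = f x"
  using lin_sweed[of f "D x" "\<lambda>a b. \<epsilon> a *s b"] by (simp add: sweed_counit_left lin_scale)

lemma sweed_counit_right_lin: "lin f \<Longrightarrow> sweed (D x) (\<lambda>a b. \<epsilon> b *s f a) = f x"
  using lin_sweed[of f "D x" "\<lambda>a b. \<epsilon> b *s a"] by (simp add: sweed_counit_right lin_scale)

lemma sweed_antipode_left_lin: "lin f \<Longrightarrow> sweed (D x) (\<lambda>a b. f (S a \<cdot> b)) = \<epsilon> x *s f one"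
  using lin_sweed[of f "D x" "\<lambda>a b. S a \<cdot> b"] by (simp add: antipode_left lin_scale)

lemma sweed_antipode_right_lin: "lin f \<Longrightarrow> sweed (D x) (\<lambda>a b. f (a \<cdot> S b)) = \<epsilon> x *s f one"
  using lin_sweed[of f "D x" "\<lambda>a b. a \<cdot> S b"] by (simp add: antipode_right lin_scale)

lemma counit_S [simp]: "\<epsilon> (S x) = \<epsilon> x"
proof -
  have "\<epsilon> x = \<epsilon> (sweed (D x) (\<lambda>a b. S a \<cdot> b))"
    by (simp add: antipode_left fnl_scale[OF fnl_counit])
  also have "\<dots> = sweed (D x) (\<lambda>a b. \<epsilon> (S (\<epsilon> b *s a)))"
    by (simp add: fnl_sweed[OF fnl_counit] counit_mul S_scale fnl_scale[OF fnl_counit] mult.commute)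
  also have "\<dots> = \<epsilon> (S (sweed (D x) (\<lambda>a b. \<epsilon> b *s a)))"
    by (simp add: fnl_sweed[OF fnl_counit] lin_sweed[OF lin_S])
  finally show ?thesis by (simp add: sweed_counit_right)
qed

text \<open>Both sides are convolution inverses of the comultiplication.\<close>

lemma sweed_S:
  assumes B: "bilin B"
  shows "sweed (D (S x)) B = sweed (D x) (\<lambda>a b. B (S b) (S a))"
proof -
  have B1: "lin f \<Longrightarrow> lin (\<lambda>x. B (f x) c)" and B2: "lin f \<Longrightarrow> lin (\<lambda>x. B c (f x))" for f c
    using B by (auto simp: bilin_def lin_def)
  \<comment> \<open>Triple convolution of S(x_2) tensor S(x_1), the coproduct, and the coproduct
    after \<open>S\<close>, tested by \<open>B\<close>. Grouping from the left or from the right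
    cancels a different pair of factors.\<close>
  let ?F = "\<lambda>p q b1 b2 s t. B (S q \<cdot> (b1 \<cdot> s)) (S p \<cdot> (b2 \<cdot> t))"
  have left: "sweed (D a) (\<lambda>a1 a2. sweed (D a1) (\<lambda>p q. sweed (D a2) (\<lambda>b1 b2. T (S q \<cdot> b1) (S p \<cdot> b2)))) =
      \<epsilon> a *s T one one" if T: "bilin T" for a T
  proof -
    have T1: "lin f \<Longrightarrow> lin (\<lambda>x. T (f x) c)" and T2: "lin f \<Longrightarrow> lin (\<lambda>x. T c (f x))" for f c
      using T by (auto simp: bilin_def lin_def)
    have inner: "sweed (D r) (\<lambda>q a2. sweed (D a2) (\<lambda>b1 b2. T (S q \<cdot> b1) (S p \<cdot> b2))) = T one (S p \<cdot> r)" for p r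
    proof -
      have "sweed (D r) (\<lambda>q a2. sweed (D a2) (\<lambda>b1 b2. T (S q \<cdot> b1) (S p \<cdot> b2))) =
          sweed (D r) (\<lambda>m b2. sweed (D m) (\<lambda>q b1. T (S q \<cdot> b1) (S p \<cdot> b2)))"
        by (rule sweed_coassoc[symmetric]; intro lin_rules T1 T2)
      also have "\<dots> = sweed (D r) (\<lambda>m b2. \<epsilon> m *s T one (S p \<cdot> b2))"
        by (subst sweed_antipode_left_lin[of "\<lambda>y. T y (S p \<cdot> _)"]) (intro lin_rules T1, rule refl)
      also have "\<dots> = T one (S p \<cdot> r)"
        by (rule sweed_counit_left_lin[of "\<lambda>b. T one (S p \<cdot> b)"]) (intro lin_rules T2)
      finally show ?thesis .
    qed
    have "sweed (D a) (\<lambda>a1 a2. sweed (D a1) (\<lambda>p q. sweed (D a2) (\<lambda>b1 b2. T (S q \<cdot> b1) (S p \<cdot> b2)))) =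
        sweed (D a) (\<lambda>p r. sweed (D r) (\<lambda>q a2. sweed (D a2) (\<lambda>b1 b2. T (S q \<cdot> b1) (S p \<cdot> b2))))"
      by (rule sweed_coassoc; intro lin_rules T1 T2)
    also have "\<dots> = \<epsilon> a *s T one one"
      unfolding inner by (rule sweed_antipode_left_lin) (intro lin_rules T2)
    finally show ?thesis .
  qed
  have right: "sweed (D r) (\<lambda>a2 c. sweed (D a2) (\<lambda>b1 b2. sweed (D (S c)) (\<lambda>s t. T (b1 \<cdot> s) (b2 \<cdot> t)))) =
      \<epsilon> r *s T one one" if T: "bilin T" for r T
  proof -
    have "sweed (D r) (\<lambda>a2 c. sweed (D a2) (\<lambda>b1 b2. sweed (D (S c)) (\<lambda>s t. T (b1 \<cdot> s) (b2 \<cdot> t)))) =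
        sweed (D r) (\<lambda>a2 c. sweed (D (a2 \<cdot> S c)) T)"
      by (simp add: sweed_mul[OF T])
    also have "\<dots> = \<epsilon> r *s sweed (D one) T"
      by (rule sweed_antipode_right_lin) (rule lin_sweed_arg[OF T])
    finally show ?thesis by (simp add: sweed_one[OF T])
  qed
  have "sweed (D x) (\<lambda>a c. sweed (D a) (\<lambda>a1 a2. sweed (D a1) (\<lambda>p q. sweed (D a2) (\<lambda>b1 b2.
          sweed (D (S c)) (\<lambda>s t. ?F p q b1 b2 s t))))) =
        sweed (D x) (\<lambda>a c. sweed (D (S c)) (\<lambda>s t. \<epsilon> a *s B s t))" (is "?E = _")
  proof (rule sweed_cong)
    fix a c
    have "sweed (D a) (\<lambda>a1 a2. sweed (D a1) (\<lambda>p q. sweed (D a2) (\<lambda>b1 b2.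
          sweed (D (S c)) (\<lambda>s t. ?F p q b1 b2 s t)))) =
        sweed (D (S c)) (\<lambda>s t. sweed (D a) (\<lambda>a1 a2. sweed (D a1) (\<lambda>p q. sweed (D a2) (\<lambda>b1 b2.
          ?F p q b1 b2 s t))))"
      by (simp add: sweed_swap[of "D (S c)"])
    also have "\<dots> = sweed (D (S c)) (\<lambda>s t. \<epsilon> a *s B s t)"
    proof (rule sweed_cong)
      fix s t
      have "bilin (\<lambda>y z. B (y \<cdot> s) (z \<cdot> t))" by (intro bilinI B1 B2 lin_rules)
      from left[OF this, of a]
      show "sweed (D a) (\<lambda>a1 a2. sweed (D a1) (\<lambda>p q. sweed (D a2) (\<lambda>b1 b2. ?F p q b1 b2 s t))) =
          \<epsilon> a *s B s t" by (simp add: mul_assoc)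
    qed
    finally show "sweed (D a) (\<lambda>a1 a2. sweed (D a1) (\<lambda>p q. sweed (D a2) (\<lambda>b1 b2.
          sweed (D (S c)) (\<lambda>s t. ?F p q b1 b2 s t)))) = sweed (D (S c)) (\<lambda>s t. \<epsilon> a *s B s t)" .
  qed
  also have "\<dots> = sweed (D (S x)) B"
    unfolding sweed_scale
    by (rule sweed_counit_left_lin) (intro lin_sweed_comp B lin_S)
  finally have E1: "?E = sweed (D (S x)) B" .
  have "?E = sweed (D x) (\<lambda>a1 r. sweed (D r) (\<lambda>a2 c. sweed (D a1) (\<lambda>p q. sweed (D a2) (\<lambda>b1 b2.
          sweed (D (S c)) (\<lambda>s t. ?F p q b1 b2 s t)))))"
    by (rule sweed_coassoc; intro lin_rules B1 B2)
  also have "\<dots> = sweed (D x) (\<lambda>a1 r. \<epsilon> r *s sweed (D a1) (\<lambda>p q. B (S q) (S p)))"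
  proof (rule sweed_cong)
    fix a1 r
    have "sweed (D r) (\<lambda>a2 c. sweed (D a1) (\<lambda>p q. sweed (D a2) (\<lambda>b1 b2.
          sweed (D (S c)) (\<lambda>s t. ?F p q b1 b2 s t)))) =
        sweed (D a1) (\<lambda>p q. sweed (D r) (\<lambda>a2 c. sweed (D a2) (\<lambda>b1 b2.
          sweed (D (S c)) (\<lambda>s t. ?F p q b1 b2 s t))))"
      by (rule sweed_swap)
    also have "\<dots> = sweed (D a1) (\<lambda>p q. \<epsilon> r *s B (S q) (S p))"
    proof (rule sweed_cong)
      fix p q
      have "bilin (\<lambda>y z. B (S q \<cdot> y) (S p \<cdot> z))" by (intro bilinI B1 B2 lin_rules)
      from right[OF this, of r]
      show "sweed (D r) (\<lambda>a2 c. sweed (D a2) (\<lambda>b1 b2. sweed (D (S c)) (\<lambda>s t. ?F p q b1 b2 s t))) =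
          \<epsilon> r *s B (S q) (S p)" by simp
    qed
    finally show "sweed (D r) (\<lambda>a2 c. sweed (D a1) (\<lambda>p q. sweed (D a2) (\<lambda>b1 b2.
          sweed (D (S c)) (\<lambda>s t. ?F p q b1 b2 s t)))) = \<epsilon> r *s sweed (D a1) (\<lambda>p q. B (S q) (S p))"
      by (simp add: sweed_scale)
  qed
  also have "\<dots> = sweed (D x) (\<lambda>a b. B (S b) (S a))"
    by (rule sweed_counit_right_lin[of "\<lambda>a1. sweed (D a1) (\<lambda>p q. B (S q) (S p))"])
       (intro lin_rules B1 B2)
  finally show ?thesis using E1 by simp
qed

lemma L_S: "fnl f \<Longrightarrow> L f (S x) = S (R (\<lambda>y. f (S y)) x)"
  unfolding L_def R_def
  by (subst sweed_S) (auto simp: lin_sweed[OF lin_S] S_scale intro!: lin_rules)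

lemma R_S: "fnl f \<Longrightarrow> R f (S x) = S (L (\<lambda>y. f (S y)) x)"
  unfolding L_def R_def
  by (subst sweed_S) (auto simp: lin_sweed[OF lin_S] S_scale intro!: lin_rules)

lemma sub_S:
  assumes "sub P" shows "sub (S ` P)"
  unfolding sub_def
  by (auto simp: L_S R_S intro!: imageI fnlD_sub[OF assms] fnl_comp lin_S
      lin_image_subspace[OF lin_S sub_subspace[OF assms]])

lemma L_mul: "fnl u \<Longrightarrow> L u (g \<cdot> x) = sweed (D g) (\<lambda>p q. q \<cdot> L (\<lambda>c. u (p \<cdot> c)) x)"
  unfolding L_def by (subst sweed_mul) (auto simp: sweed_mul_left mul_scale intro!: lin_rules)

lemma L_mul': "fnl u \<Longrightarrow> L u (x \<cdot> g) = sweed (D g) (\<lambda>p q. L (\<lambda>c. u (c \<cdot> p)) x \<cdot> q)"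
proof -
  assume u: "fnl u"
  have "L u (x \<cdot> g) = sweed (D x) (\<lambda>a b. sweed (D g) (\<lambda>c d. u (a \<cdot> c) *s (b \<cdot> d)))"
    unfolding L_def by (subst sweed_mul) (intro lin_rules u, rule refl)
  also have "\<dots> = sweed (D g) (\<lambda>c d. sweed (D x) (\<lambda>a b. u (a \<cdot> c) *s (b \<cdot> d)))"
    by (rule sweed_swap)
  also have "\<dots> = sweed (D g) (\<lambda>p q. L (\<lambda>c. u (c \<cdot> p)) x \<cdot> q)"
    by (rule sweed_cong) (simp add: L_def sweed_mul_right mul_scale)
  finally show ?thesis .
qed

lemma R_mul: "fnl u \<Longrightarrow> R u (g \<cdot> x) = sweed (D g) (\<lambda>p q. p \<cdot> R (\<lambda>c. u (q \<cdot> c)) x)"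
  unfolding R_def by (subst sweed_mul) (auto simp: sweed_mul_left mul_scale intro!: lin_rules)

lemma fnl_mul: "fnl u \<Longrightarrow> fnl (\<lambda>c. u (p \<cdot> c))" "fnl u \<Longrightarrow> fnl (\<lambda>c. u (c \<cdot> p))"
  using fnl_comp[OF _ lin_mul2[OF lin_id]] fnl_comp[OF _ lin_mul1[OF lin_id]] by auto

lemma fnl_S: "fnl u \<Longrightarrow> fnl (\<lambda>c. u (S c))"
  using fnl_comp lin_S by blast

lemma lin_L_mul: "fnl u \<Longrightarrow> lin h \<Longrightarrow> lin (\<lambda>q. L (\<lambda>c. u (h q \<cdot> c)) x)"
  and lin_R_mul: "fnl u \<Longrightarrow> lin h \<Longrightarrow> lin (\<lambda>q. R (\<lambda>c. u (h q \<cdot> c)) x)"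
  unfolding L_def R_def using fnl_comp[OF fnl_mul(2)] by (intro lin_rules; blast)+

text \<open>\<open>x\<^sub>1 u(f x\<^sub>2) = S(f\<^sub>1) f\<^sub>2 x\<^sub>1 u(f\<^sub>3 x\<^sub>2)\<close>\<close>

lemma R_mul_antipode:
  assumes u: "fnl u"
  shows "R (\<lambda>y. u (f \<cdot> y)) x = sweed (D f) (\<lambda>a g. S a \<cdot> R u (g \<cdot> x))"
proof -
  note linR = lin_R_mul[OF u]
  have "sweed (D f) (\<lambda>a g. S a \<cdot> R u (g \<cdot> x)) =
      sweed (D f) (\<lambda>a g. sweed (D g) (\<lambda>p q. S a \<cdot> (p \<cdot> R (\<lambda>c. u (q \<cdot> c)) x)))"
    by (simp add: R_mul[OF u] sweed_mul_left)
  also have "\<dots> = sweed (D f) (\<lambda>m q. sweed (D m) (\<lambda>a p. S a \<cdot> (p \<cdot> R (\<lambda>c. u (q \<cdot> c)) x)))"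
    by (rule sweed_coassoc[symmetric]; intro lin_rules linR)
  also have "\<dots> = sweed (D f) (\<lambda>m q. \<epsilon> m *s R (\<lambda>c. u (q \<cdot> c)) x)"
    by (simp add: mul_assoc[symmetric] sweed_mul_right[symmetric] antipode_left mul_scale)
  also have "\<dots> = R (\<lambda>y. u (f \<cdot> y)) x"
    by (rule sweed_counit_left_lin) (intro linR lin_id)
  finally show ?thesis by simp
qed

text \<open>\<open>u(S(g) x\<^sub>1) x\<^sub>2 = g\<^sub>1 S(g\<^sub>2) u(S(g\<^sub>3) x\<^sub>1) x\<^sub>2\<close>\<close>

lemma L_mul_antipode:
  assumes u: "fnl u"
  shows "L (\<lambda>y. u (S g \<cdot> y)) x = sweed (D g) (\<lambda>a h. a \<cdot> L u (S h \<cdot> x))"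
proof -
  note linL = lin_L_mul[OF u]
  have LS: "L u (S h \<cdot> x) = sweed (D h) (\<lambda>p q. S p \<cdot> L (\<lambda>c. u (S q \<cdot> c)) x)" for h
    by (subst L_mul[OF u], subst sweed_S) (intro lin_rules linL, rule refl)
  have "sweed (D g) (\<lambda>a h. a \<cdot> L u (S h \<cdot> x)) =
      sweed (D g) (\<lambda>a h. sweed (D h) (\<lambda>p q. a \<cdot> (S p \<cdot> L (\<lambda>c. u (S q \<cdot> c)) x)))"
    by (simp add: LS sweed_mul_left)
  also have "\<dots> = sweed (D g) (\<lambda>m q. sweed (D m) (\<lambda>a p. a \<cdot> (S p \<cdot> L (\<lambda>c. u (S q \<cdot> c)) x)))"
    by (rule sweed_coassoc[symmetric]; intro lin_rules linL)
  also have "\<dots> = sweed (D g) (\<lambda>m q. \<epsilon> m *s L (\<lambda>c. u (S q \<cdot> c)) x)"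
    by (simp add: mul_assoc[symmetric] sweed_mul_right[symmetric] antipode_right mul_scale)
  also have "\<dots> = L (\<lambda>y. u (S g \<cdot> y)) x"
    by (rule sweed_counit_left_lin) (intro linL lin_S)
  finally show ?thesis by simp
qed

lemma R_mul_S:
  assumes u: "fnl u"
  shows "R u (S h \<cdot> x) = sweed (D h) (\<lambda>p q. S q \<cdot> R (\<lambda>c. u (S p \<cdot> c)) x)"
proof -
  note linR = lin_R_mul[OF u]
  show ?thesis by (subst R_mul[OF u], subst sweed_S) (intro lin_rules linR, rule refl)
qed

section \<open>Products of subcoalgebras\<close>

definition prd :: "'h set \<Rightarrow> 'h set \<Rightarrow> 'h set" where
  "prd X Y = span {x \<cdot> y |x y. x \<in> X \<and> y \<in> Y}"

lemma mul_mem_prd: "x \<in> X \<Longrightarrow> y \<in> Y \<Longrightarrow> x \<cdot> y \<in> prd X Y"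
  unfolding prd_def by (blast intro: span_base)

lemma prd_subset: "subspace W \<Longrightarrow> (\<And>x y. x \<in> X \<Longrightarrow> y \<in> Y \<Longrightarrow> x \<cdot> y \<in> W) \<Longrightarrow> prd X Y \<subseteq> W"
  unfolding prd_def by (rule span_minimal) auto

lemma prd_mono: "X \<subseteq> X' \<Longrightarrow> Y \<subseteq> Y' \<Longrightarrow> prd X Y \<subseteq> prd X' Y'"
  unfolding prd_def by (rule span_mono) blast

lemma sub_prd:
  assumes X: "sub X" and Y: "sub Y" shows "sub (prd X Y)"
proof -
  have "L f z \<in> prd X Y \<and> R f z \<in> prd X Y" if z: "z \<in> prd X Y" and f: "fnl f" for f z
  proof -
    let ?W = "{z. L f z \<in> prd X Y} \<inter> {z. R f z \<in> prd X Y}"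
    have sp: "subspace (prd X Y)" by (simp add: prd_def)
    have W: "subspace ?W"
      by (intro subspace_inter lin_vimage_subspace sp lin_L lin_R f)
    have "x \<cdot> y \<in> ?W" if x: "x \<in> X" and y: "y \<in> Y" for x y
    proof -
      have "L f (x \<cdot> y) \<in> prd X Y"
        unfolding L_mul[OF f]
      proof (rule sweed_mem_sub[OF X x _ sp])
        show "bilin (\<lambda>p q. q \<cdot> L (\<lambda>c. f (p \<cdot> c)) y)" by (intro lin_rules lin_L_mul f)
        show "b \<cdot> L (\<lambda>c. f (a \<cdot> c)) y \<in> prd X Y" if "b \<in> X" for a b
          using that by (intro mul_mem_prd fnlD_sub Y y fnl_mul f)
      qed
      moreover have "R f (x \<cdot> y) \<in> prd X Y"
        unfolding R_mul[OF f]
      proof (rule sweed_mem_sub[OF X x _ sp])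
        show "bilin (\<lambda>p q. p \<cdot> R (\<lambda>c. f (q \<cdot> c)) y)" by (intro lin_rules lin_R_mul f)
        show "a \<cdot> R (\<lambda>c. f (b \<cdot> c)) y \<in> prd X Y" if "a \<in> X" for a b
          using that by (intro mul_mem_prd fnlD_sub Y y fnl_mul f)
      qed
      ultimately show ?thesis by blast
    qed
    from prd_subset[OF W this] z show ?thesis by blast
  qed
  then show ?thesis by (simp add: sub_def prd_def)
qed

end

context sweedler_coalgebra
begin

text \<open>A subcoalgebra of the coradical is the sum of its simple subcoalgebras, and those of the
  wedge lie in \<open>C\<close> or \<open>E\<close>. Refuting a direct link thus amounts to placing
  both wedges in the coradical.\<close>

lemma wg_subset_sumset:
  assumes C: "simple C" and E: "simple E" and "wg C E \<subseteq> corad"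
  shows "wg C E \<subseteq> C + E"
proof -
  note s = sub_subspace[OF simple_sub[OF C]] sub_subspace[OF simple_sub[OF E]]
  have "\<Union>{G. simple G \<and> G \<subseteq> wg C E} \<subseteq> C + E"
    using simple_in_wg[OF _ _ simple_sub[OF C] simple_sub[OF E]] subset_sumset1[OF s(2), of C] subset_sumset2[OF s(1), of E]
    by blast
  from span_minimal[OF this subspace_sumset[OF s]]
  show ?thesis using subset_corad[OF sub_wg[OF simple_sub[OF C] simple_sub[OF E]] assms(3)] by blast
qed

end

section \<open>Hopf algebras with the dual Chevalley property\<close>

context sweedler_hopf
begin

definition one_coalg :: "'h set" where "one_coalg = span {one}"

lemma one_nonzero: "one \<noteq> 0"
  using counit_one fnl_0[OF fnl_counit] by (metis zero_neq_one)

lemma mem_one_coalg: "x \<in> one_coalg \<longleftrightarrow> (\<exists>c. x = c *s one)"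
  by (auto simp: one_coalg_def span_singleton)

lemma L_one: "fnl f \<Longrightarrow> L f one = f one *s one"
  and R_one: "fnl f \<Longrightarrow> R f one = f one *s one"
  unfolding L_def R_def by (simp_all add: sweed_one bilinI lin_cscale lin_fscale lin_id)

lemma simple_one: "simple one_coalg"
proof -
  have "sub one_coalg"
    unfolding sub_def
    by (auto simp: mem_one_coalg lin_scale[OF lin_L] lin_scale[OF lin_R] L_one R_one)
      (simp add: one_coalg_def)
  moreover have "one \<in> one_coalg" by (simp add: one_coalg_def span_base)
  moreover have "B = one_coalg" if B: "sub B" "B \<subseteq> one_coalg" "B \<noteq> {0}" for B
  proof -
    have "\<exists>b\<in>B. b \<noteq> 0" using B(3) sub_0_mem[OF B(1)] by blast
    then obtain b where b: "b \<in> B" "b \<noteq> 0" by blast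
    then obtain c where c: "b = c *s one" "c \<noteq> 0" using B(2) mem_one_coalg by fastforce
    then have "one = inverse c *s b" by simp
    then have "one \<in> B" using b(1) sub_subspace[OF B(1)] subspace_scale by metis
    then have "one_coalg \<subseteq> B" unfolding one_coalg_def
      by (intro span_minimal sub_subspace B(1)) simp
    with B(2) show ?thesis by blast
  qed
  ultimately show ?thesis using one_nonzero unfolding simple_def by blast
qed

text \<open>Apply \<open>f\<close> to the identity S(c_1) c_2 = \<epsilon>(c) 1: if all these values
  vanished, so would the counit on \<open>C\<close>.\<close>

lemma antipode_pairing_nonzero:
  assumes C: "simple C" and f: "fnl f" "f one = 1"
  shows "\<exists>a\<in>C. \<exists>b\<in>C. f (S a \<cdot> b) \<noteq> 0"
proof (rule ccontr)
  assume *: "\<not> (\<exists>a\<in>C. \<exists>b\<in>C. f (S a \<cdot> b) \<noteq> 0)"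
  have "\<epsilon> c = 0" if c: "c \<in> C" for c
  proof -
    have "lin (\<lambda>y. f y *s one)" by (rule lin_fscale[OF f(1)])
    from sweed_antipode_left_lin[OF this, of c] f(2)
    have "sweed (D c) (\<lambda>a b. f (S a \<cdot> b) *s one) = \<epsilon> c *s one" by simp
    moreover have "sweed (D c) (\<lambda>a b. f (S a \<cdot> b) *s one) \<in> {0}"
    proof (rule sweed_mem_sub[OF simple_sub[OF C] c])
      show "bilin (\<lambda>a b. f (S a \<cdot> b) *s one)"
        by (intro bilinI lin_fscale fnl_comp[OF f(1)] lin_rules)
    qed (use * in auto)
    ultimately show ?thesis using one_nonzero by simp
  qed
  then show False using counit_zero[OF simple_sub[OF C]] simple_nonzero[OF C] by blast
qed

lemma S_image_nonzero: "simple C \<Longrightarrow> S ` C \<noteq> {0}"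
proof
  assume C: "simple C" and 0: "S ` C = {0}"
  have "\<epsilon> c = 0" if "c \<in> C" for c
  proof -
    have "S c = 0" using 0 that by blast
    then show ?thesis using counit_S[of c] by (simp add: fnl_0[OF fnl_counit])
  qed
  then show False using counit_zero[OF simple_sub[OF C]] simple_nonzero[OF C] by blast
qed

end

locale sweedler_dual_chevalley = sweedler_hopf +
  assumes corad_mul: "x \<in> corad \<Longrightarrow> y \<in> corad \<Longrightarrow> x \<cdot> y \<in> corad"
    and corad_S: "x \<in> corad \<Longrightarrow> S x \<in> corad"
begin

text \<open>The integral of the cosemisimple Hopf algebra \<open>corad\<close>, which shows that \<open>S\<^sup>2\<close> fixes all
  simple subcoalgebras.\<close>

lemma ex_integral:
  "\<exists>l. fnl l \<and> l one = 1 \<and> (\<forall>x\<in>corad. R l x = l x *s one)"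
proof -
  let ?A = "{C. simple C \<and> C \<noteq> one_coalg}"
  have sA: "sub (span (\<Union>?A))" by (rule sub_span_Union) (auto intro: simple_sub)
  have "one \<notin> span (\<Union>?A)"
  proof
    assume "one \<in> span (\<Union>?A)"
    then have "one_coalg \<subseteq> span (\<Union>?A)" unfolding one_coalg_def
      by (intro span_minimal) auto
    then obtain C where "C \<in> ?A" "one_coalg \<subseteq> C"
      using simple_in_span_Union[OF simple_one, of ?A] simple_sub by blast
    then show False using simple_subset_eq[OF simple_one, of C] by blast
  qed
  then obtain l where l: "perp (span (\<Union>?A)) l" "l one = 1"
    using ex_perp_nonzero[OF subspace_span] by blast
  note fl = perp_fnl[OF l(1)]
  have sp: "subspace {x. R l x = l x *s one}"
    using lin_R[OF fl] by (auto simp: subspace_def lin_0 lin_add lin_scale fnl_0[OF fl] fnl_add[OF fl]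
        fnl_scale[OF fl] scale_left_distrib)
  have "\<Union>{C. simple C} \<subseteq> {x. R l x = l x *s one}"
  proof
    fix x assume "x \<in> \<Union>{C. simple C}"
    then obtain C where C: "simple C" "x \<in> C" by blast
    show "x \<in> {x. R l x = l x *s one}"
    proof (cases "C = one_coalg")
      case True
      then obtain c where "x = c *s one" using C mem_one_coalg by blast
      then show ?thesis by (simp add: lin_scale[OF lin_R[OF fl]] R_one fl fnl_scale)
    next
      case False
      then have "C \<subseteq> span (\<Union>?A)" using C by (blast intro: span_base)
      then have "perp C l" using l(1) perp_mono by blast
      then show ?thesis using perp_R[OF simple_sub[OF C(1)] _ C(2)] perp_zero C(2) by fastforce
    qed
  qed
  from span_minimal[OF this sp] l fl show ?thesis unfolding corad_def by blast
qed

text \<open>For \<open>c\<close> and \<open>y\<close> in \<open>C\<close>, invariance of the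
  integral \<open>l\<close> turns y_1 l(S(c) y_2) into an element of \<open>S(S(C))\<close>. The
  functionals that send \<open>C\<close> into \<open>S(S(C))\<close> under \<open>R\<close> form an
  ideal; it contains such a functional not vanishing on \<open>C\<close>, hence the counit.\<close>

lemma simple_subset_S_S:
  assumes C: "simple C" shows "C \<subseteq> S ` S ` C"
proof -
  obtain l where l: "fnl l" "l one = 1" "\<And>x. x \<in> corad \<Longrightarrow> R l x = l x *s one"
    using ex_integral by blast
  have sC: "sub C" and sSC: "sub (S ` S ` C)" using simple_sub[OF C] sub_S by auto
  have Ccor: "C \<subseteq> corad" by (rule simple_subset_corad[OF C])
  have key: "R (\<lambda>z. l (S c \<cdot> z)) y \<in> S ` S ` C" if c: "c \<in> C" and y: "y \<in> C" for c y
  proof -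
    let ?x = "S c"
    have x: "?x \<in> corad" using c Ccor corad_S by blast
    have "R (\<lambda>z. l (?x \<cdot> z)) y = sweed (D ?x) (\<lambda>a g. S a \<cdot> R l (g \<cdot> y))"
      by (rule R_mul_antipode[OF l(1)])
    also have "\<dots> = sweed (D ?x) (\<lambda>a g. l (g \<cdot> y) *s S a)"
    proof (rule sweed_cong_sub[OF sub_corad x])
      show "bilin (\<lambda>a g. S a \<cdot> R l (g \<cdot> y))" by (intro lin_rules l)
      show "bilin (\<lambda>a g. l (g \<cdot> y) *s S a)" by (intro lin_rules fnl_mul l)
      fix a b assume "a \<in> corad" "b \<in> corad"
      then show "S a \<cdot> R l (b \<cdot> y) = l (b \<cdot> y) *s S a"
        using l(3)[of "b \<cdot> y"] corad_mul y Ccor by (auto simp: mul_scale)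
    qed
    also have "\<dots> = S (R (\<lambda>g. l (g \<cdot> y)) ?x)"
      unfolding R_def by (simp add: lin_sweed[OF lin_S] S_scale)
    also have "\<dots> = S (S (L (\<lambda>g. l (S g \<cdot> y)) c))"
      by (subst R_S) (intro fnl_mul l, rule refl)
    also have "\<dots> \<in> S ` S ` C"
      by (intro imageI fnlD_sub[OF sC c] fnl_comp[OF fnl_mul(2)[OF l(1)] lin_S])
    finally show ?thesis .
  qed
  let ?J = "{h. fnl h \<and> (\<forall>y\<in>C. R h y \<in> S ` S ` C)}"
  have J: "ideal ?J" by (rule ideal_R) (auto intro: fnlD_sub sC sub_Rmod[OF sSC])
  have pJ: "perp C f \<Longrightarrow> f \<in> ?J" for f
    using perp_R[OF sC] sub_0_mem[OF sSC] perp_fnl by force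
  obtain a b where ab: "a \<in> C" "b \<in> C" "l (S a \<cdot> b) \<noteq> 0"
    using antipode_pairing_nonzero[OF C l(1,2)] by blast
  have "(\<lambda>z. l (S a \<cdot> z)) \<in> ?J" using key[OF ab(1)] fnl_mul(1)[OF l(1)] by simp
  moreover have "\<not> perp C (\<lambda>z. l (S a \<cdot> z))" using ab by (auto simp: perp_def)
  ultimately have "\<epsilon> \<in> ?J" using counit_mem_ideal[OF C J] pJ by blast
  then show ?thesis by auto
qed

text \<open>\<open>C\<close> is finite-dimensional and its image under a linear map cannot have
  larger dimension, so the inclusion is not strict.\<close>

lemma S_S_simple:
  assumes C: "simple C" shows "S ` S ` C = C"
proof (rule ccontr)
  assume "S ` S ` C \<noteq> C"
  then have less: "C \<subset> S ` S ` C" using simple_subset_S_S[OF C] by blast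
  obtain A where "finite A" "C \<subseteq> span A" using simple_finite[OF C] by blast
  then obtain B where B: "finite B" "B \<subseteq> C" "C \<subseteq> span B" "card B = dim C"
    using basis_exists[of C] independent_span_bound by (metis order.trans)
  let ?SS = "\<lambda>x. S (S x)"
  have "B \<subseteq> {x. ?SS x \<in> span (?SS ` B)}" by (auto intro: span_base)
  from span_minimal[OF this lin_vimage_subspace[OF lin_comp[OF lin_S lin_S] subspace_span]]
  have 1: "S ` S ` C \<subseteq> span (?SS ` B)" using B(3) by blast
  have "dim C < dim (S ` S ` C)"
    using dim_strict_mono[OF sub_subspace[OF simple_sub[OF C]] less 1] B(1) by simp
  also have "\<dots> \<le> card (?SS ` B)" by (rule dim_le_card[OF 1]) (use B(1) in simp)
  also have "\<dots> \<le> card B" by (rule card_image_le[OF B(1)])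
  finally show False using B(4) by simp
qed

text \<open>The key step.  If \<open>u\<close> vanishes on \<open>S(F) C\<close> but not on \<open>S(F) E\<close>, then both wedges of \<open>C\<close>
  and \<open>E\<close> lie in the coradical, since the functionals that map them there form ideals.\<close>

lemma vanish_dl:
  assumes u: "fnl u" and central: "\<And>y. L u y = R u y"
    and F: "sub F" "F \<subseteq> corad" and C: "simple C" and E: "simple E" and dl: "dl C E"
    and 0: "\<And>f c. f \<in> F \<Longrightarrow> c \<in> C \<Longrightarrow> u (S f \<cdot> c) = 0"
  shows "f \<in> F \<Longrightarrow> e \<in> E \<Longrightarrow> u (S f \<cdot> e) = 0"
proof (rule ccontr)
  assume f: "f \<in> F" and e: "e \<in> E" "u (S f \<cdot> e) \<noteq> 0"
  let ?j = "\<lambda>y. u (S f \<cdot> y)"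
  have fj: "fnl ?j" by (rule fnl_mul[OF u])
  have nj: "\<not> perp E ?j" using e by (auto simp: perp_def)
  note sC = simple_sub[OF C] and sE = simple_sub[OF E]
  have cor: "C \<subseteq> corad" "E \<subseteq> corad" using C E simple_subset_corad by auto
  have pC: "perp C (\<lambda>y. u (S g \<cdot> y))" if "g \<in> F" for g
    using that 0 fnl_mul[OF u] by (auto simp: perp_def)
  have R: "R ?j x \<in> corad" if x: "x \<in> wg C E" for x
  proof -
    have SF: "sub (S ` F)" "S f \<in> S ` F" using sub_S[OF F(1)] f by auto
    \<comment> \<open>Centrality turns \<open>R u\<close> into \<open>L u\<close>: the vanishing on
      \<open>S(F) C\<close> concerns the left leg of an element of the wedge of \<open>C\<close> and
      \<open>E\<close>, and forces the right leg into \<open>E\<close>.\<close>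
    have "R ?j x = sweed (D (S f)) (\<lambda>a g. S a \<cdot> L u (g \<cdot> x))"
      using R_mul_antipode[OF u, of "S f" x] by (simp add: central)
    also have "\<dots> \<in> corad"
    proof (rule sweed_mem_sub[OF SF _ sub_subspace[OF sub_corad]])
      show "bilin (\<lambda>a g. S a \<cdot> L u (g \<cdot> x))" by (intro lin_rules u)
      fix a g assume a: "a \<in> S ` F" and g: "g \<in> S ` F"
      have "L u (g \<cdot> x) \<in> corad"
        unfolding L_mul[OF u]
      proof (rule sweed_mem_sub[OF SF(1) g _ sub_subspace[OF sub_corad]])
        show "bilin (\<lambda>p q. q \<cdot> L (\<lambda>c. u (p \<cdot> c)) x)" by (intro lin_rules lin_L_mul u)
        fix p q assume p: "p \<in> S ` F" and q: "q \<in> S ` F"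
        have "L (\<lambda>c. u (p \<cdot> c)) x \<in> E" using wg_L[OF x _ sub_subspace[OF sE]] pC p by auto
        then show "q \<cdot> L (\<lambda>c. u (p \<cdot> c)) x \<in> corad"
          using q F(2) cor corad_S by (intro corad_mul) auto
      qed
      then show "S a \<cdot> L u (g \<cdot> x) \<in> corad"
        using a F(2) corad_S by (intro corad_mul) auto
    qed
    finally show ?thesis .
  qed
  have L: "L ?j x \<in> corad" if x: "x \<in> wg E C" for x
  proof -
    \<comment> \<open>The mirror identity cancels through a_1 S(a_2). It applies because the
      functional multiplies by an element \<open>S f\<close>, so no inverse of the antipode
      appears.\<close>
    have "L ?j x = sweed (D f) (\<lambda>a h. a \<cdot> R u (S h \<cdot> x))"
      using L_mul_antipode[OF u, of f x] by (simp add: central)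
    also have "\<dots> \<in> corad"
    proof (rule sweed_mem_sub[OF F(1) f _ sub_subspace[OF sub_corad]])
      show "bilin (\<lambda>a h. a \<cdot> R u (S h \<cdot> x))" by (intro lin_rules u)
      fix a h assume a: "a \<in> F" and h: "h \<in> F"
      have "R u (S h \<cdot> x) \<in> corad"
        unfolding R_mul_S[OF u]
      proof (rule sweed_mem_sub[OF F(1) h _ sub_subspace[OF sub_corad]])
        show "bilin (\<lambda>p q. S q \<cdot> R (\<lambda>c. u (S p \<cdot> c)) x)" by (intro lin_rules lin_R_mul lin_S u)
        fix p q assume p: "p \<in> F" and q: "q \<in> F"
        have "R (\<lambda>c. u (S p \<cdot> c)) x \<in> E" using wg_R[OF x _ sub_subspace[OF sE]] pC p by auto
        then show "S q \<cdot> R (\<lambda>c. u (S p \<cdot> c)) x \<in> corad"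
          using q F(2) cor corad_S by (intro corad_mul) auto
      qed
      then show "a \<cdot> R u (S h \<cdot> x) \<in> corad" using a F(2) by (intro corad_mul) auto
    qed
    finally show ?thesis .
  qed
  let ?J1 = "{h. fnl h \<and> (\<forall>x\<in>wg C E. R h x \<in> corad)}"
  have "ideal ?J1"
    by (rule ideal_R) (auto intro: fnlD_sub sub_wg sC sE sub_Rmod[OF sub_corad])
  moreover have "perp E h \<Longrightarrow> h \<in> ?J1" for h
    using wg_R[OF _ _ sub_subspace[OF sC]] cor perp_fnl by blast
  moreover have "?j \<in> ?J1" using R fj by simp
  ultimately have "\<epsilon> \<in> ?J1" using nj by (rule counit_mem_ideal[OF E])
  then have "wg C E \<subseteq> corad" by auto
  then have 1: "wg C E \<subseteq> C + E" by (rule wg_subset_sumset[OF C E])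
  let ?J2 = "{h. fnl h \<and> (\<forall>x\<in>wg E C. L h x \<in> corad)}"
  have "ideal ?J2"
    by (rule ideal_L) (auto intro: fnlD_sub sub_wg sC sE sub_corad)
  moreover have "perp E h \<Longrightarrow> h \<in> ?J2" for h
    using wg_L[OF _ _ sub_subspace[OF sC]] cor perp_fnl by blast
  moreover have "?j \<in> ?J2" using L fj by simp
  ultimately have "\<epsilon> \<in> ?J2" using nj by (rule counit_mem_ideal[OF E])
  then have "wg E C \<subseteq> corad" by auto
  then have "wg E C \<subseteq> C + E" using wg_subset_sumset[OF E C] by (simp add: add.commute)
  with 1 dl show False by (simp add: dl_def)
qed

lemma vanish_linkrel:
  assumes u: "fnl u" "\<And>y. L u y = R u y" and F: "sub F" "F \<subseteq> corad"
    and CE: "(C, E) \<in> linkrel"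
    and 0: "\<And>f c. f \<in> F \<Longrightarrow> c \<in> C \<Longrightarrow> u (S f \<cdot> c) = 0"
    and fe: "f \<in> F" "e \<in> E"
  shows "u (S f \<cdot> e) = 0"
proof -
  have "\<forall>f\<in>F. \<forall>e\<in>E. u (S f \<cdot> e) = 0"
    using CE unfolding linkrel_def
  proof (induction rule: rtrancl_induct)
    case base then show ?case using 0 by blast
  next
    case (step G E)
    then show ?case using vanish_dl[OF u F, of G E] by blast
  qed
  with fe show ?thesis by blast
qed

text \<open>The central idempotent \<open>u\<close> of the complement of \<open>T\<close> vanishes
  on \<open>E C\<close>. As \<open>E = S(S(E))\<close>, the key step applies with
  \<open>F = S(E)\<close> and carries the vanishing along links to \<open>E G\<close> for every
  \<open>G\<close> in the class of \<open>C\<close>; wedge induction extends it to the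
  component.\<close>

lemma prd_simple_comp:
  assumes E: "simple E" and C: "simple C" and T: "link_closed T" and sub: "prd E C \<subseteq> comp T"
  shows "prd E (comp (cls C)) \<subseteq> comp T"
proof -
  let ?u = "ce (- T)"
  have lT: "link_closed (- T)" by (rule link_closed_compl[OF T])
  note u = fnl_ce[of "- T"] ce_central[OF lT]
  have F: "sub (S ` E)" "S ` E \<subseteq> corad"
    using sub_S[OF simple_sub[OF E]] simple_subset_corad[OF E] corad_S by auto
  note sE = simple_sub[OF E]
  have uC: "?u (e \<cdot> c) = 0" if "e \<in> E" "c \<in> C" for e c
    using ce_zero[of "e \<cdot> c" "- T"] mul_mem_prd[OF that] sub by auto
  have uG: "?u (e \<cdot> g) = 0" if e: "e \<in> E" and G: "simple G" "G \<in> cls C" "g \<in> G" for e g G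
  proof -
    have "e \<in> S ` S ` E" using e S_S_simple[OF E] by simp
    then obtain f where f: "f \<in> S ` E" "e = S f" by blast
    have "?u (S h \<cdot> c) = 0" if "h \<in> S ` E" "c \<in> C" for h c
      using uC[of "S h" c] that S_S_simple[OF E] by blast
    moreover have "(C, G) \<in> linkrel" using G by (simp add: cls_def)
    ultimately show ?thesis unfolding f(2) by (intro vanish_linkrel[OF u F _ _ f(1) G(3)]) auto
  qed
  have "?u (e \<cdot> x) = 0" if e: "e \<in> E" and x: "x \<in> comp (cls C)" for e x
  proof -
    let ?\<Psi> = "{\<lambda>x. ?u (e \<cdot> x) |e. e \<in> E}"
    show ?thesis
    proof (rule vanish_by_simples[of ?\<Psi> "comp (cls C)" "\<lambda>x. ?u (e \<cdot> x)"])
      show "fnl \<psi>" if "\<psi> \<in> ?\<Psi>" for \<psi> using that fnl_mul[OF u(1)] by auto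
      show "\<psi> x = 0" if "simple G" "G \<subseteq> comp (cls C)" "\<psi> \<in> ?\<Psi>" "x \<in> G" for G \<psi> x
        using that uG simple_subset_comp by auto
      fix U G \<psi> x
      assume U: "sub U" and G: "sub G" and U0: "\<And>\<psi> x. \<psi> \<in> ?\<Psi> \<Longrightarrow> x \<in> U \<Longrightarrow> \<psi> x = 0"
        and G0: "\<And>\<psi> x. \<psi> \<in> ?\<Psi> \<Longrightarrow> x \<in> G \<Longrightarrow> \<psi> x = 0" and \<psi>: "\<psi> \<in> ?\<Psi>" and x: "x \<in> wg U G"
      obtain e where e: "e \<in> E" "\<psi> = (\<lambda>x. ?u (e \<cdot> x))" using \<psi> by blast
      \<comment> \<open>By idempotency u(e x) = u(e_1 x_1) u(e_2 x_2). The functionals given by the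
        first factor kill \<open>U\<close>, which leaves x_2 in \<open>G\<close>, where the second
        factor vanishes.\<close>
      have "L ?u (e \<cdot> x) \<in> {y. ?u y = 0}"
        unfolding L_mul[OF u(1)]
      proof (rule sweed_mem_sub[OF sE e(1) _ fnl_kernel_subspace[OF u(1)]])
        show "bilin (\<lambda>p q. q \<cdot> L (\<lambda>c. ?u (p \<cdot> c)) x)" by (intro lin_rules lin_L_mul u)
        fix p q assume pq: "p \<in> E" "q \<in> E"
        have "perp U (\<lambda>c. ?u (p \<cdot> c))" using U0 pq fnl_mul[OF u(1)] by (auto simp: perp_def)
        then have "L (\<lambda>c. ?u (p \<cdot> c)) x \<in> G" by (rule wg_L[OF x _ sub_subspace[OF G]])
        then show "q \<cdot> L (\<lambda>c. ?u (p \<cdot> c)) x \<in> {y. ?u y = 0}" using G0 pq by auto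
      qed
      then show "\<psi> x = 0" using ce_idem[OF lT] e(2) by simp
    qed (use e x sub_comp in auto)
  qed
  then have 0: "prd E (comp (cls C)) \<subseteq> {y. ?u y = 0}"
    by (intro prd_subset fnl_kernel_subspace u) auto
  show ?thesis
    by (rule subset_comp_ce[OF T sub_prd[OF sE sub_comp]]) (use 0 in auto)
qed

end

section \<open>Reversing product and coproduct\<close>

context sweedler_hopf
begin

text \<open>The two antipode axioms change places under the double reversal, so \<open>S\<close>
  remains the antipode; reversing only one operation would call for its inverse.\<close>

lemma sweedler_hopf_op_cop:
  "sweedler_hopf scale (\<lambda>x. map prod.swap (D x)) \<epsilon> (\<lambda>x y. y \<cdot> x) one S"
proof -
  interpret cop: sweedler_coalgebra scale "\<lambda>x. map prod.swap (D x)" \<epsilon>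
    by (rule sweedler_coalgebra_cop)
  show ?thesis
  proof
    show "bilin (\<lambda>x y. y \<cdot> x)" by (rule bilin_flip[OF bilin_mul])
    fix x y and B :: "'h \<Rightarrow> 'h \<Rightarrow> 'h" assume B: "bilin B"
    show "sweed (map prod.swap (D (y \<cdot> x))) B = sweed (map prod.swap (D x)) (\<lambda>a b.
        sweed (map prod.swap (D y)) (\<lambda>c d. B (c \<cdot> a) (d \<cdot> b)))"
      unfolding sweed_flip sweed_mul[OF bilin_flip[OF B]] by (rule sweed_swap)
  qed (simp_all add: sweed_flip mul_assoc sweed_one bilin_flip counit_mul lin_S antipode_left antipode_right)
qed

end

context sweedler_coalgebra
begin

lemma cop_eqs2:
  shows corad_cop: "sweedler_coalgebra.corad scale (\<lambda>x. map prod.swap (D x)) = corad"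
    and link_closed_cop: "sweedler_coalgebra.link_closed scale (\<lambda>x. map prod.swap (D x)) = link_closed"
    and comp_cop: "sweedler_coalgebra.comp scale (\<lambda>x. map prod.swap (D x)) = comp"
    and cls_cop: "sweedler_coalgebra.cls scale (\<lambda>x. map prod.swap (D x)) = cls"
proof -
  interpret cop: sweedler_coalgebra scale "\<lambda>x. map prod.swap (D x)" \<epsilon>
    by (rule sweedler_coalgebra_cop)
  show "cop.corad = corad" by (simp add: cop.corad_def corad_def simple_cop)
  have dl: "cop.dl = dl" by (intro ext) (auto simp: cop.dl_def dl_def wg_cop)
  show "cop.link_closed = link_closed"
    by (intro ext) (simp add: cop.link_closed_def link_closed_def simple_cop dl)
  show "cop.comp = comp" by (intro ext) (simp add: cop.comp_def comp_def simple_cop sub_cop)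
  show "cop.cls = cls"
    by (intro ext) (simp add: cop.cls_def cls_def cop.linkrel_def linkrel_def simple_cop dl)
qed

end

section \<open>Products of components, and the antipode on the unit component\<close>

context sweedler_dual_chevalley
begin

lemma sweedler_dual_chevalley_op_cop:
  "sweedler_dual_chevalley scale (\<lambda>x. map prod.swap (D x)) \<epsilon> (\<lambda>x y. y \<cdot> x) one S"
proof -
  interpret oc: sweedler_hopf scale "\<lambda>x. map prod.swap (D x)" \<epsilon> "\<lambda>x y. y \<cdot> x" one S
    by (rule sweedler_hopf_op_cop)
  show ?thesis by unfold_locales (auto simp: corad_cop corad_mul corad_S)
qed

lemma prd_op_cop: "sweedler_hopf.prd scale (\<lambda>x y. y \<cdot> x) X Y = prd Y X"
proof -
  interpret oc: sweedler_hopf scale "\<lambda>x. map prod.swap (D x)" \<epsilon> "\<lambda>x y. y \<cdot> x" one S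
    by (rule sweedler_hopf_op_cop)
  show ?thesis unfolding oc.prd_def prd_def by (rule arg_cong[of _ _ span]) blast
qed

lemma prd_comp_simple:
  assumes "simple E" "simple C" "link_closed T" "prd C E \<subseteq> comp T"
  shows "prd (comp (cls C)) E \<subseteq> comp T"
  using sweedler_dual_chevalley.prd_simple_comp[OF sweedler_dual_chevalley_op_cop, of E C T] assms
  unfolding simple_cop link_closed_cop comp_cop cls_cop prd_op_cop by simp

text \<open>The mirrored one-sided result passes from \<open>C\<close> to any \<open>G\<close> in
  its class, the one-sided result then passes from \<open>E\<close> to its component, and wedge
  induction in the first factor, for all \<open>y\<close> in that component at once, passes from the
  \<open>G\<close> to the component of \<open>C\<close>.\<close>

lemma prd_comp_comp:
  assumes C: "simple C" and E: "simple E" and T: "link_closed T" and sub: "prd C E \<subseteq> comp T"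
  shows "prd (comp (cls C)) (comp (cls E)) \<subseteq> comp T"
proof -
  let ?u = "ce (- T)" and ?Y = "comp (cls E)"
  have lT: "link_closed (- T)" by (rule link_closed_compl[OF T])
  note u = fnl_ce[of "- T"]
  have uG: "?u (g \<cdot> y) = 0" if G: "simple G" "G \<in> cls C" "g \<in> G" and y: "y \<in> ?Y" for G g y
  proof -
    have "G \<subseteq> comp (cls C)" using G simple_subset_comp by blast
    then have "prd G E \<subseteq> comp T" using prd_mono prd_comp_simple[OF E C T sub] by blast
    then have "prd G ?Y \<subseteq> comp T" by (rule prd_simple_comp[OF G(1) E T])
    then show ?thesis using mul_mem_prd[OF G(3) y] ce_zero[of "g \<cdot> y" "- T"] by auto
  qed
  have "?u (x \<cdot> y) = 0" if x: "x \<in> comp (cls C)" and y: "y \<in> ?Y" for x y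
  proof -
    let ?\<Psi> = "{\<lambda>x. ?u (x \<cdot> y) |y. y \<in> ?Y}"
    show ?thesis
    proof (rule vanish_by_simples[of ?\<Psi> "comp (cls C)" "\<lambda>x. ?u (x \<cdot> y)"])
      show "fnl \<psi>" if "\<psi> \<in> ?\<Psi>" for \<psi> using that fnl_mul[OF u(1)] by auto
      show "\<psi> x = 0" if "simple G" "G \<subseteq> comp (cls C)" "\<psi> \<in> ?\<Psi>" "x \<in> G" for G \<psi> x
        using that uG simple_subset_comp by auto
      fix U G \<psi> x
      assume U: "sub U" and G: "sub G" and U0: "\<And>\<psi> x. \<psi> \<in> ?\<Psi> \<Longrightarrow> x \<in> U \<Longrightarrow> \<psi> x = 0"
        and G0: "\<And>\<psi> x. \<psi> \<in> ?\<Psi> \<Longrightarrow> x \<in> G \<Longrightarrow> \<psi> x = 0" and \<psi>: "\<psi> \<in> ?\<Psi>" and x: "x \<in> wg U G"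
      obtain y where y: "y \<in> ?Y" "\<psi> = (\<lambda>x. ?u (x \<cdot> y))" using \<psi> by blast
      have "L ?u (x \<cdot> y) \<in> {z. ?u z = 0}"
        unfolding L_mul'[OF u]
      proof (rule sweed_mem_sub[OF sub_comp y(1) _ fnl_kernel_subspace[OF u]])
        show "bilin (\<lambda>p q. L (\<lambda>c. ?u (c \<cdot> p)) x \<cdot> q)"
          unfolding L_def by (intro lin_rules fnl_mul u)
        fix p q assume pq: "p \<in> ?Y" "q \<in> ?Y"
        have "perp U (\<lambda>c. ?u (c \<cdot> p))" using U0 pq fnl_mul[OF u] by (auto simp: perp_def)
        then have "L (\<lambda>c. ?u (c \<cdot> p)) x \<in> G" by (rule wg_L[OF x _ sub_subspace[OF G]])
        then show "L (\<lambda>c. ?u (c \<cdot> p)) x \<cdot> q \<in> {z. ?u z = 0}" using G0 pq by auto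
      qed
      then show "\<psi> x = 0" using ce_idem[OF lT] y(2) by simp
    qed (use x y sub_comp in auto)
  qed
  then have 0: "prd (comp (cls C)) ?Y \<subseteq> {y. ?u y = 0}"
    by (intro prd_subset fnl_kernel_subspace u) auto
  show ?thesis
    by (rule subset_comp_ce[OF T sub_prd[OF sub_comp sub_comp]]) (use 0 in auto)
qed

text \<open>\<open>?T\<close> unites the classes of the simple subcoalgebras of \<open>C E\<close>.
  The dual Chevalley property puts \<open>C E\<close> into the coradical, so it is the sum of these
  and lies in \<open>comp ?T\<close>.\<close>

theorem prd_comp_subset:
  assumes C: "simple C" and E: "simple E"
  shows "prd (comp (cls C)) (comp (cls E)) \<subseteq> span (\<Union>{comp (cls G) |G. simple G \<and> G \<subseteq> prd C E})"
proof -
  let ?A = "{G. simple G \<and> G \<subseteq> prd C E}"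
  let ?T = "\<Union>(cls ` ?A)"
  have T: "link_closed ?T" by (rule link_closed_Union) (auto intro: link_closed_cls)
  have "prd C E \<subseteq> corad"
    using simple_subset_corad[OF C] simple_subset_corad[OF E]
    by (intro prd_subset sub_subspace sub_corad corad_mul) auto
  then have "prd C E \<subseteq> span (\<Union>?A)"
    using subset_corad[OF sub_prd[OF simple_sub[OF C] simple_sub[OF E]]] by blast
  also have "\<dots> \<subseteq> comp ?T"
  proof (rule span_minimal[OF _ sub_subspace[OF sub_comp]], rule Union_least)
    fix G assume G: "G \<in> ?A"
    then have "G \<in> ?T" using cls_self by blast
    then show "G \<subseteq> comp ?T" using simple_subset_comp[of G ?T] G by blast
  qed
  finally have "prd (comp (cls C)) (comp (cls E)) \<subseteq> comp ?T" by (rule prd_comp_comp[OF C E T])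
  also have "\<dots> \<subseteq> span (\<Union>{comp (cls G) |G. G \<in> ?A})" by (rule comp_subset_span) simp
  finally show ?thesis by simp
qed

abbreviation comp_one :: "'b set" where "comp_one \<equiv> comp (cls one_coalg)"

lemma one_mem_comp: "one \<in> comp_one"
  using simple_subset_comp_cls[OF simple_one] span_base[of one "{one}"] by (auto simp: one_coalg_def)

lemma prd_one_coalg: "subspace X \<Longrightarrow> prd X one_coalg \<subseteq> X" "subspace X \<Longrightarrow> prd one_coalg X \<subseteq> X"
  by (rule prd_subset; auto simp: mem_one_coalg mul_scale subspace_scale)+

theorem comp_eq_prd:
  assumes C: "simple C" shows "comp (cls C) = prd C comp_one"
proof
  note sC = simple_sub[OF C]
  show "prd C comp_one \<subseteq> comp (cls C)"
    by (rule prd_simple_comp[OF C simple_one link_closed_cls])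
       (rule order.trans[OF prd_one_coalg(1)[OF sub_subspace[OF sC]] simple_subset_comp_cls[OF C]])
  let ?U = "prd C comp_one" and ?e = "ce (cls one_coalg)"
  have U: "sub ?U" by (rule sub_prd[OF sC sub_comp])
  note e = fnl_ce[of "cls one_coalg"] ce_central[OF link_closed_cls, of one_coalg]
  have e1: "?e one = 1" using ce(2)[OF one_mem_comp] by simp
  have key: "L (\<lambda>y. ?e (S c \<cdot> y)) x \<in> ?U" if c: "c \<in> C" for c x
    unfolding L_mul_antipode[OF e(1)]
  proof (rule sweed_mem_sub[OF sC c _ sub_subspace[OF U]])
    show "bilin (\<lambda>a h. a \<cdot> L ?e (S h \<cdot> x))" by (intro lin_rules e)
    show "a \<cdot> L ?e (S h \<cdot> x) \<in> ?U" if "a \<in> C" for a h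
      using that by (intro mul_mem_prd L_ce_mem link_closed_cls)
  qed
  show "comp (cls C) \<subseteq> ?U"
  proof (rule ccontr)
    assume "\<not> comp (cls C) \<subseteq> ?U"
    then obtain E where E: "simple E" "E \<subseteq> comp (cls C)" "\<not> wg E ?U \<inter> comp (cls C) \<subseteq> ?U"
      using wg_step_left[OF U sub_comp] by blast
    then have "E \<in> cls C" using simple_subset_comp by blast
    then have EC: "(E, C) \<in> linkrel" using linkrel_sym by (simp add: cls_def)
    note sE = simple_sub[OF E(1)]
    \<comment> \<open>Otherwise the vanishing of e(S(c) y) would spread along the links from
      \<open>E\<close> to \<open>C\<close>, where the antipode identity forbids it.\<close>
    have "\<exists>c\<in>C. \<exists>y\<in>E. ?e (S c \<cdot> y) \<noteq> 0"
    proof (rule ccontr)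
      assume "\<not> ?thesis"
      then have "?e (S c \<cdot> y) = 0" if "c \<in> C" "y \<in> C" for c y
        using vanish_linkrel[OF e sC simple_subset_corad[OF C] EC _ that] by blast
      then show False using antipode_pairing_nonzero[OF C e(1) e1] by blast
    qed
    then obtain c y where c: "c \<in> C" "y \<in> E" "?e (S c \<cdot> y) \<noteq> 0" by blast
    let ?J = "{h. fnl h \<and> (\<forall>x\<in>wg E ?U. L h x \<in> ?U)}"
    have "ideal ?J" by (rule ideal_L[OF _ U]) (auto intro: fnlD_sub sub_wg sE U)
    moreover have "perp E h \<Longrightarrow> h \<in> ?J" for h
      using wg_L[OF _ _ sub_subspace[OF U]] perp_fnl by blast
    moreover have "(\<lambda>y. ?e (S c \<cdot> y)) \<in> ?J" using key[OF c(1)] fnl_mul(1)[OF e(1)] by simp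
    moreover have "\<not> perp E (\<lambda>y. ?e (S c \<cdot> y))" using c by (auto simp: perp_def)
    ultimately have "\<epsilon> \<in> ?J" by (rule counit_mem_ideal[OF E(1)])
    then show False using E(3) by auto
  qed
qed

theorem comp_eq_prd':
  assumes C: "simple C" shows "comp (cls C) = prd comp_one C"
proof -
  interpret oc: sweedler_dual_chevalley scale "\<lambda>x. map prod.swap (D x)" \<epsilon> "\<lambda>x y. y \<cdot> x" one S
    by (rule sweedler_dual_chevalley_op_cop)
  show ?thesis
    using oc.comp_eq_prd[of C] C
    unfolding oc.one_coalg_def one_coalg_def simple_cop comp_cop cls_cop prd_op_cop by simp
qed

text \<open>Since \<open>one_coalg\<close> and \<open>E\<close> are linked, e(S(d)) cannot vanish
  for all \<open>d\<close> in \<open>E\<close>, so \<open>S(E)\<close> contains a simple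
  \<open>G\<close> of the class. Then \<open>S(G)\<close> is a nonzero subcoalgebra of
  \<open>S(S(E)) = E\<close>, hence equals \<open>E\<close>, and applying \<open>S\<close> once more
  gives \<open>S(E) = G\<close>.\<close>

lemma S_simple_mem_cls:
  assumes E: "simple E" "E \<in> cls one_coalg" shows "S ` E \<in> cls one_coalg" "simple (S ` E)"
proof -
  let ?e = "ce (cls one_coalg)"
  note e = fnl_ce[of "cls one_coalg"] ce_central[OF link_closed_cls, of one_coalg]
  have e1: "?e one = 1" using ce(2)[OF one_mem_comp] by simp
  note sE = simple_sub[OF E(1)]
  have link: "(one_coalg, E) \<in> linkrel" using E by (simp add: cls_def)
  have sub: "sub (S ` E)" "S ` E \<subseteq> corad"
    using sub_S[OF sE] simple_subset_corad[OF E(1)] corad_S by auto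
  have "\<exists>d\<in>E. ?e (S d) \<noteq> 0"
  proof (rule ccontr)
    assume "\<not> ?thesis"
    then have "?e (S d \<cdot> c) = 0" if "d \<in> E" "c \<in> one_coalg" for d c
      using that by (auto simp: mem_one_coalg mul_scale fnl_scale[OF e(1)])
    then have "?e (S d \<cdot> c) = 0" if "d \<in> E" "c \<in> E" for d c
      using vanish_linkrel[OF e sE simple_subset_corad[OF E(1)] link _ that] by blast
    then show False using antipode_pairing_nonzero[OF E(1) e(1) e1] by blast
  qed
  then obtain d where d: "d \<in> E" "?e (S d) \<noteq> 0" by blast
  have "\<exists>G. simple G \<and> G \<subseteq> S ` E \<and> G \<in> cls one_coalg"
  proof (rule ccontr)
    assume *: "\<not> ?thesis"
    have "\<Union>{G. simple G \<and> G \<subseteq> S ` E} \<subseteq> comp (- cls one_coalg)"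
      using * simple_subset_comp[of _ "- cls one_coalg"] by blast
    from span_minimal[OF this sub_subspace[OF sub_comp]]
    have "S ` E \<subseteq> comp (- cls one_coalg)" using subset_corad[OF sub] by blast
    then show False using d ce_zero by blast
  qed
  then obtain G where G: "simple G" "G \<subseteq> S ` E" "G \<in> cls one_coalg" by blast
  have "S ` G \<subseteq> E" using G(2) S_S_simple[OF E(1)] by blast
  then have "S ` G = E"
    using simple_cases[OF E(1) sub_S[OF simple_sub[OF G(1)]]] S_image_nonzero[OF G(1)] by blast
  then have "S ` E = G" using S_S_simple[OF G(1)] by simp
  then show "S ` E \<in> cls one_coalg" "simple (S ` E)" using G by simp_all
qed

text \<open>The antipode reverses the coproduct, so idempotency gives u(S(x)) = u(S(x_2)) u(S(x_1));
  wedge induction therefore works with the single functional \<open>u\<close> after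
  \<open>S\<close>.\<close>

theorem S_comp_one: "S ` comp_one \<subseteq> comp_one"
proof -
  let ?T = "cls one_coalg" 
  let ?u = "ce (- ?T)"
  have lT: "link_closed (- ?T)" by (rule link_closed_compl[OF link_closed_cls])
  note u = fnl_ce[of "- ?T"]
  have fuS: "fnl (\<lambda>x. ?u (S x))" by (rule fnl_S[OF u])
  have "?u (S x) = 0" if x: "x \<in> comp_one" for x
  proof (rule vanish_by_simples[of "{\<lambda>x. ?u (S x)}" comp_one "\<lambda>x. ?u (S x)"])
    fix C \<psi> x assume C: "simple C" "C \<subseteq> comp_one" "\<psi> \<in> {\<lambda>x. ?u (S x)}" "x \<in> C"
    then have "C \<in> ?T" using simple_subset_comp by blast
    then have "S ` C \<subseteq> comp_one" using S_simple_mem_cls[OF C(1)] simple_subset_comp by blast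
    then show "\<psi> x = 0" using C ce_zero[of "S x" "- ?T"] by auto
  next
    fix U C \<psi> x
    assume U: "sub U" and C: "sub C" and U0: "\<And>\<psi> x. \<psi> \<in> {\<lambda>x. ?u (S x)} \<Longrightarrow> x \<in> U \<Longrightarrow> \<psi> x = 0"
      and C0: "\<And>\<psi> x. \<psi> \<in> {\<lambda>x. ?u (S x)} \<Longrightarrow> x \<in> C \<Longrightarrow> \<psi> x = 0"
      and \<psi>: "\<psi> \<in> {\<lambda>x. ?u (S x)}" and x: "x \<in> wg U C"
    have "perp C (\<lambda>x. ?u (S x))" using C0 fuS by (auto simp: perp_def)
    then have "R (\<lambda>x. ?u (S x)) x \<in> U" by (rule wg_R[OF x _ sub_subspace[OF U]])
    then have "?u (L ?u (S x)) = 0" using U0 by (simp add: L_S[OF u])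
    then show "\<psi> x = 0" using \<psi> ce_idem[OF lT] by simp
  qed (use fuS x sub_comp in auto)
  then show ?thesis
    by (intro subset_comp_ce[OF link_closed_cls sub_S[OF sub_comp]]) auto
qed

theorem prd_comp_one: "prd comp_one comp_one \<subseteq> comp_one"
  using prd_comp_comp[OF simple_one simple_one link_closed_cls] prd_one_coalg(1)[of one_coalg]
    simple_subset_comp_cls[OF simple_one] by (auto simp: one_coalg_def)

end

section \<open>Tensors and functionals\<close>

lemma lin_ext_superset:
  assumes "vector_space s" "finite K" "Poly_Mapping.keys p \<subseteq> K"
  shows "lin_ext s f p = (\<Sum>x\<in>K. s (Poly_Mapping.lookup p x) (f x))"
proof -
  interpret vector_space s by fact
  show ?thesis unfolding lin_ext_def
    by (rule sum.mono_neutral_left) (use assms in \<open>auto simp: in_keys_iff\<close>)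
qed

lemma lin_ext_add:
  assumes s: "vector_space s" shows "lin_ext s f (p + q) = lin_ext s f p + lin_ext s f q"
proof -
  interpret vector_space s by fact
  let ?K = "Poly_Mapping.keys p \<union> Poly_Mapping.keys q"
  have "Poly_Mapping.keys (p + q) \<subseteq> ?K" by (rule Poly_Mapping.keys_add)
  then show ?thesis
    by (simp add: lin_ext_superset[OF s, of ?K] lookup_add scale_left_distrib sum.distrib)
qed

lemma keys_fscale: "Poly_Mapping.keys (fscale c p) \<subseteq> Poly_Mapping.keys p"
  by (auto simp: in_keys_iff)

lemma lin_ext_fscale:
  assumes s: "vector_space s" shows "lin_ext s f (fscale c p) = s c (lin_ext s f p)"
proof -
  interpret vector_space s by fact
  show ?thesis
    by (simp add: lin_ext_superset[OF s, of "Poly_Mapping.keys p"] keys_fscale scale_sum_right)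
qed

lemma lin_ext_gen:
  assumes s: "vector_space s" shows "lin_ext s f (gen x) = f x"
proof -
  interpret vector_space s by fact
  show ?thesis by (simp add: lin_ext_def)
qed

lemma lin_ext_0: "lin_ext s f 0 = 0"
  by (simp add: lin_ext_def)

lemma lin_ext_sum:
  assumes s: "vector_space s" shows "lin_ext s f (sum g I) = (\<Sum>i\<in>I. lin_ext s f (g i))"
  by (induction I rule: infinite_finite_induct) (auto simp: lin_ext_0 lin_ext_add[OF s])

lemma lin_ext_diff:
  assumes s: "vector_space s" shows "lin_ext s f (p - q) = lin_ext s f p - lin_ext s f q"
  using lin_ext_add[OF s, of f "p - q" q] by (simp add: algebra_simps)

lemma lin_ext_lin_ext:
  assumes s: "vector_space s"
  shows "lin_ext s g (lin_ext fscale h p) = lin_ext s (\<lambda>x. lin_ext s g (h x)) p"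
  by (simp add: lin_ext_def[of fscale] lin_ext_sum[OF s] lin_ext_fscale[OF s]) (simp add: lin_ext_def[of s])

lemma lin_ext_self: "lin_ext fscale gen p = p"
proof (rule poly_mapping_eqI)
  fix x
  have "Poly_Mapping.lookup (lin_ext fscale gen p) x =
      (\<Sum>k\<in>Poly_Mapping.keys p. Poly_Mapping.lookup p k * (1 when k = x))"
    by (simp add: lin_ext_def lookup_sum lookup_single)
  also have "\<dots> = (\<Sum>k\<in>Poly_Mapping.keys p. if k = x then Poly_Mapping.lookup p k else 0)"
    by (rule sum.cong) (auto simp: when_def)
  also have "\<dots> = Poly_Mapping.lookup p x"
    by (simp add: in_keys_iff)
  finally show "Poly_Mapping.lookup (lin_ext fscale gen p) x = Poly_Mapping.lookup p x" .
qed

lemma keys_lin_ext: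
  assumes "\<And>x. Poly_Mapping.keys (h x) \<subseteq> K"
  shows "Poly_Mapping.keys (lin_ext fscale h p) \<subseteq> K"
  unfolding lin_ext_def
  using Poly_Mapping.keys_sum[of "\<lambda>x. fscale (Poly_Mapping.lookup p x) (h x)" "Poly_Mapping.keys p"]
    keys_fscale assms by fastforce

context tensor_space
begin

lemma lin_ext_kernel_subspace:
  assumes s: "vector_space s" shows "free.subspace {p. lin_ext s f p = 0}"
proof -
  interpret v: vector_space s by fact
  show ?thesis
    by (auto simp: free.subspace_def lin_ext_0 lin_ext_add[OF s] lin_ext_fscale[OF s])
qed

text \<open>Universal property of the tensor product: the kernel of the linear extension is a
  subspace containing the bilinearity relations.\<close>

lemma teq2_lin_ext:
  assumes s: "vector_space s" and eq: "teq2 p q"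
    and B: "\<And>x x' y. B (x + x') y = B x y + B x' y" "\<And>x y y'. B x (y + y') = B x y + B x y'"
      "\<And>c x y. B (c *s x) y = s c (B x y)" "\<And>c x y. B x (c *s y) = s c (B x y)"
  shows "lin_ext s (\<lambda>(a, b). B a b) p = lin_ext s (\<lambda>(a, b). B a b) q"
proof -
  let ?f = "\<lambda>(a, b). B a b"
  have "tensor2_rel \<subseteq> {p. lin_ext s ?f p = 0}"
    unfolding tensor2_rel_def
    by (rule free.span_minimal[OF _ lin_ext_kernel_subspace[OF s]])
       (auto simp: lin_ext_diff[OF s] lin_ext_add[OF s] lin_ext_fscale[OF s] lin_ext_gen[OF s] B)
  then show ?thesis using eq by (auto simp: teq2_def lin_ext_diff[OF s])
qed

lemma teq3_lin_ext:
  assumes eq: "teq3 p q"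
    and T: "\<And>b c. lin (\<lambda>a. T a b c)" "\<And>a c. lin (\<lambda>b. T a b c)" "\<And>a b. lin (\<lambda>c. T a b c)"
  shows "lin_ext scale (\<lambda>(a, b, c). T a b c) p = lin_ext scale (\<lambda>(a, b, c). T a b c) q"
proof -
  let ?f = "\<lambda>(a, b, c). T a b c"
  note s = vector_space_axioms
  have T': "T (x + x') y z = T x y z + T x' y z" "T x (y + y') z = T x y z + T x y' z"
    "T x y (z + z') = T x y z + T x y z'" "T (c *s x) y z = c *s T x y z"
    "T x (c *s y) z = c *s T x y z" "T x y (c *s z) = c *s T x y z" for x x' y y' z z' c
    using T by (auto simp: lin_def)
  have "tensor3_rel \<subseteq> {p. lin_ext scale ?f p = 0}"
    unfolding tensor3_rel_def
    by (rule free.span_minimal[OF _ lin_ext_kernel_subspace[OF s]])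
       (auto simp: lin_ext_diff[OF s] lin_ext_add[OF s] lin_ext_fscale[OF s] lin_ext_gen[OF s] T')
  then show ?thesis using eq by (auto simp: teq3_def lin_ext_diff[OF s])
qed

lemma teq2_bilin: "bilin B \<Longrightarrow> teq2 p q \<Longrightarrow>
    lin_ext scale (\<lambda>(a, b). B a b) p = lin_ext scale (\<lambda>(a, b). B a b) q"
  by (rule teq2_lin_ext[OF vector_space_axioms]) (auto simp: bilin_def lin_def)

section \<open>Tensors tested by pairs of functionals\<close>

definition ev2 :: "('b \<Rightarrow> 'a) \<Rightarrow> ('b \<Rightarrow> 'a) \<Rightarrow> (('b \<times> 'b) \<Rightarrow>\<^sub>0 'a) \<Rightarrow> 'a" where
  "ev2 f g = lin_ext (*) (\<lambda>(a, b). f a * g b)"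

lemma ev2_teq2: "fnl f \<Longrightarrow> fnl g \<Longrightarrow> teq2 p q \<Longrightarrow> ev2 f g p = ev2 f g q"
  unfolding ev2_def
  by (rule teq2_lin_ext[OF vector_space_field]) (auto simp: fnl_def algebra_simps)

lemma ev2_add: "ev2 f g (p + q) = ev2 f g p + ev2 f g q"
  and ev2_diff: "ev2 f g (p - q) = ev2 f g p - ev2 f g q"
  unfolding ev2_def using lin_ext_add lin_ext_diff vector_space_field by blast+

lemma ev2_minus_left: "ev2 (\<lambda>x. f x - f' x) g p = ev2 f g p - ev2 f' g p"
  and ev2_minus_right: "ev2 f (\<lambda>x. g x - g' x) p = ev2 f g p - ev2 f g' p"
  by (simp_all add: ev2_def lin_ext_def sum.distrib[symmetric] sum_subtractf[symmetric] split_def algebra_simps)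

lemma ev2_zero:
  assumes "\<And>a b. (a, b) \<in> Poly_Mapping.keys p \<Longrightarrow> f a * g b = 0" shows "ev2 f g p = 0"
  unfolding ev2_def lin_ext_def by (rule sum.neutral) (use assms in auto)

lemma tensor2_rel_subspace: "free.subspace tensor2_rel"
  unfolding tensor2_rel_def by (rule free.subspace_span)

lemma teq2_refl [simp]: "teq2 p p"
  using free.subspace_0[OF tensor2_rel_subspace] by (simp add: teq2_def)

lemma teq2_trans: "teq2 p q \<Longrightarrow> teq2 q r \<Longrightarrow> teq2 p r"
  using free.subspace_add[OF tensor2_rel_subspace, of "p - q" "q - r"] by (simp add: teq2_def)

lemma teq2_add: "teq2 p p' \<Longrightarrow> teq2 q q' \<Longrightarrow> teq2 (p + q) (p' + q')"
  using free.subspace_add[OF tensor2_rel_subspace, of "p - p'" "q - q'"]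
  by (simp add: teq2_def algebra_simps)

lemma teq2_fscale: "teq2 p q \<Longrightarrow> teq2 (fscale c p) (fscale c q)"
  using free.subspace_scale[OF tensor2_rel_subspace, of "p - q" c]
  by (simp add: teq2_def free.scale_right_diff_distrib)

lemma teq2_sum: "(\<And>i. i \<in> I \<Longrightarrow> teq2 (f i) (g i)) \<Longrightarrow> teq2 (sum f I) (sum g I)"
  by (induction I rule: infinite_finite_induct) (auto intro: teq2_add)

lemma teq2_gens:
  shows "teq2 (gen (x + x', y)) (gen (x, y) + gen (x', y))"
    and "teq2 (gen (x, y + y')) (gen (x, y) + gen (x, y'))"
    and "teq2 (gen (c *s x, y)) (fscale c (gen (x, y)))"
    and "teq2 (gen (x, c *s y)) (fscale c (gen (x, y)))"
  unfolding teq2_def tensor2_rel_def by (rule free.span_base, blast)+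

lemma teq2_gen_zero: "teq2 (gen (0, y)) 0" "teq2 (gen (x, 0)) 0"
  using teq2_gens(3)[of 0 0 y] teq2_gens(4)[of x 0 0] by simp_all

lemma teq2_gen_sum:
  assumes "finite I"
  shows "teq2 (gen (\<Sum>i\<in>I. c i *s i, y)) (\<Sum>i\<in>I. fscale (c i) (gen (i, y)))"
    and "teq2 (gen (x, \<Sum>i\<in>I. c i *s i)) (\<Sum>i\<in>I. fscale (c i) (gen (x, i)))"
  using assms
  by (induction I rule: finite_induct)
     (simp_all add: teq2_gen_zero teq2_trans[OF teq2_gens(1) teq2_add[OF teq2_gens(3)]]
       teq2_trans[OF teq2_gens(2) teq2_add[OF teq2_gens(4)]])

text \<open>In finitely many coordinates \<open>r i\<close> for all legs, \<open>t\<close> is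
  congruent to a double sum of generators with coefficients \<open>ev2 (r i) (r j) t\<close>, which
  all vanish.\<close>

lemma mem_tensor2_rel:
  assumes 0: "\<And>f g. fnl f \<Longrightarrow> fnl g \<Longrightarrow> ev2 f g t = 0"
  shows "teq2 t 0"
proof -
  let ?K = "Poly_Mapping.keys t"
  let ?A = "fst ` ?K \<union> snd ` ?K"
  have "finite ?A" by simp
  from ex_coordinates[OF this] obtain I r where I: "finite I" and r: "\<forall>i. fnl (r i)"
    and A: "\<forall>a\<in>?A. a = (\<Sum>i\<in>I. r i a *s i)" by (elim exE conjE)
  have "teq2 (gen k) (\<Sum>i\<in>I. \<Sum>j\<in>I. fscale (r i (fst k) * r j (snd k)) (gen (i, j)))"
    if k: "k \<in> ?K" for k
  proof -
    obtain a b where ab: "k = (a, b)" by (cases k)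
    have a: "(\<Sum>i\<in>I. r i a *s i) = a" and b: "(\<Sum>i\<in>I. r i b *s i) = b"
      using A k by (force simp: ab)+
    have "teq2 (gen (a, b)) (\<Sum>i\<in>I. fscale (r i a) (gen (i, b)))"
      using teq2_gen_sum(1)[OF I, of "\<lambda>i. r i a" b] unfolding a .
    moreover have "teq2 (\<Sum>i\<in>I. fscale (r i a) (gen (i, b)))
        (\<Sum>i\<in>I. fscale (r i a) (\<Sum>j\<in>I. fscale (r j b) (gen (i, j))))"
      using teq2_gen_sum(2)[OF I, of _ "\<lambda>i. r i b"] unfolding b by (intro teq2_sum teq2_fscale)
    ultimately show ?thesis using teq2_trans by (simp add: ab free.scale_sum_right)
  qed
  then have "teq2 (\<Sum>k\<in>?K. fscale (Poly_Mapping.lookup t k) (gen k))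
      (\<Sum>k\<in>?K. fscale (Poly_Mapping.lookup t k)
        (\<Sum>i\<in>I. \<Sum>j\<in>I. fscale (r i (fst k) * r j (snd k)) (gen (i, j))))"
    by (intro teq2_sum teq2_fscale)
  also have "(\<Sum>k\<in>?K. fscale (Poly_Mapping.lookup t k) (gen k)) = t"
    using lin_ext_self[of t] by (simp add: lin_ext_def)
  also have "(\<Sum>k\<in>?K. fscale (Poly_Mapping.lookup t k)
        (\<Sum>i\<in>I. \<Sum>j\<in>I. fscale (r i (fst k) * r j (snd k)) (gen (i, j)))) =
      (\<Sum>i\<in>I. \<Sum>j\<in>I. fscale (ev2 (r i) (r j) t) (gen (i, j)))"
    unfolding free.scale_sum_right free.scale_scale ev2_def lin_ext_def free.scale_sum_left split_def
    by (subst sum.swap, rule sum.cong[OF refl], subst sum.swap) (rule refl)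
  also have "\<dots> = 0" using 0 r by simp
  finally show ?thesis .
qed

lemma teq2_by_ev2:
  assumes "\<And>f g. fnl f \<Longrightarrow> fnl g \<Longrightarrow> ev2 f g p = ev2 f g q" shows "teq2 p q"
  using mem_tensor2_rel[of "p - q"] assms by (simp add: ev2_diff teq2_def)

definition tmap :: "('b \<Rightarrow> 'b) \<Rightarrow> ('b \<Rightarrow> 'b) \<Rightarrow> (('b \<times> 'b) \<Rightarrow>\<^sub>0 'a) \<Rightarrow> (('b \<times> 'b) \<Rightarrow>\<^sub>0 'a)" where
  "tmap p q = lin_ext fscale (\<lambda>(a, b). gen (p a, q b))"

lemma ev2_tmap: "ev2 f g (tmap p q t) = ev2 (\<lambda>x. f (p x)) (\<lambda>x. g (q x)) t"
  unfolding ev2_def tmap_def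
  by (simp add: lin_ext_lin_ext[OF vector_space_field] split_def lin_ext_gen[OF vector_space_field])

lemma keys_tmap: "range p \<subseteq> X \<Longrightarrow> range q \<subseteq> Y \<Longrightarrow> Poly_Mapping.keys (tmap p q t) \<subseteq> X \<times> Y"
  unfolding tmap_def by (rule keys_lin_ext) auto

lemma ev2_tensor_sub_left: "t \<in> tensor_sub X Y \<Longrightarrow> perp X f \<Longrightarrow> fnl g \<Longrightarrow> ev2 f g t = 0"
  and ev2_tensor_sub_right: "t \<in> tensor_sub X Y \<Longrightarrow> fnl f \<Longrightarrow> perp Y g \<Longrightarrow> ev2 f g t = 0"
proof -
  have 0: "ev2 f g t = 0"
    if *: "t \<in> tensor_sub X Y" "fnl f" "fnl g" "\<And>a b. a \<in> X \<Longrightarrow> b \<in> Y \<Longrightarrow> f a * g b = 0"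
  proof -
    obtain p where p: "Poly_Mapping.keys p \<subseteq> X \<times> Y" "teq2 t p"
      using *(1) unfolding tensor_sub_def by blast
    have "ev2 f g p = 0" by (rule ev2_zero) (use p(1) *(4) in blast)
    then show ?thesis using ev2_teq2[OF *(2,3) p(2)] by simp
  qed
  show "t \<in> tensor_sub X Y \<Longrightarrow> perp X f \<Longrightarrow> fnl g \<Longrightarrow> ev2 f g t = 0"
    and "t \<in> tensor_sub X Y \<Longrightarrow> fnl f \<Longrightarrow> perp Y g \<Longrightarrow> ev2 f g t = 0"
    using 0 by (auto simp: perp_def)
qed

lemma ev2_projection:
  assumes f: "fnl f" and g: "fnl g" and p: "lin p" "\<forall>x\<in>P. p x = x"
    and left: "\<And>f g. perp P f \<Longrightarrow> fnl g \<Longrightarrow> ev2 f g t = 0"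
    and right: "\<And>f g. fnl f \<Longrightarrow> perp P g \<Longrightarrow> ev2 f g t = 0"
  shows "ev2 f g t = ev2 (\<lambda>x. f (p x)) (\<lambda>x. g (p x)) t"
proof -
  have "perp P (\<lambda>x. h x - h (p x))" if "fnl h" for h
    using that p by (auto simp: perp_def intro: fnl_minus fnl_comp)
  then have "ev2 (\<lambda>x. f x - f (p x)) g t = 0" "ev2 (\<lambda>x. f (p x)) (\<lambda>x. g x - g (p x)) t = 0"
    using left right f g fnl_comp[OF f p(1)] by auto
  then show ?thesis by (simp add: ev2_minus_left ev2_minus_right)
qed

text \<open>The part of \<open>t\<close> outside \<open>P\<close> is invisible to functionals, so
  projecting both legs to \<open>P\<close> gives a representative of the same class.\<close>

lemma mem_tensor_sub:
  assumes P: "subspace P"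
    and left: "\<And>f g. perp P f \<Longrightarrow> fnl g \<Longrightarrow> ev2 f g t = 0"
    and right: "\<And>f g. fnl f \<Longrightarrow> perp P g \<Longrightarrow> ev2 f g t = 0"
  shows "t \<in> tensor_sub P P"
proof -
  obtain p where p: "lin p" "range p \<subseteq> P" "\<forall>x\<in>P. p x = x" using ex_projection[OF P] by blast
  have "teq2 t (tmap p p t)"
    by (rule teq2_by_ev2) (simp only: ev2_tmap, rule ev2_projection[OF _ _ p(1,3) left right])
  then show ?thesis using keys_tmap[OF p(2,2)] by (auto simp: tensor_sub_def)
qed

lemma mem_tensor_sum:
  assumes P: "subspace P" and X: "subspace X" "X \<subseteq> P" and Y: "subspace Y" "Y \<subseteq> P"
    and left: "\<And>f g. perp P f \<Longrightarrow> fnl g \<Longrightarrow> ev2 f g t = 0"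
    and right: "\<And>f g. fnl f \<Longrightarrow> perp P g \<Longrightarrow> ev2 f g t = 0"
    and XY: "\<And>f g. perp X f \<Longrightarrow> perp Y g \<Longrightarrow> ev2 f g t = 0"
  shows "t \<in> tensor_sub X P + tensor_sub P Y"
proof -
  obtain p where p: "lin p" "range p \<subseteq> P" "\<forall>x\<in>P. p x = x" using ex_projection[OF P] by blast
  obtain x where x: "lin x" "range x \<subseteq> X" "\<forall>y\<in>X. x y = y" using ex_projection[OF X(1)] by blast
  obtain y where y: "lin y" "range y \<subseteq> Y" "\<forall>x\<in>Y. y x = x" using ex_projection[OF Y(1)] by blast
  \<comment> \<open>\<open>s\<close> is what the projection to \<open>X\<close> sees on the left
    leg, \<open>s'\<close> what the one to \<open>Y\<close> sees on the right leg of the remainder.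
    The rest is tested only by functionals vanishing on \<open>X\<close> and on \<open>Y\<close>, so
    \<open>XY\<close> removes it.\<close>
  define s where "s = tmap (\<lambda>z. x (p z)) p t"
  define s' where "s' = tmap (\<lambda>z. p z - x (p z)) (\<lambda>z. y (p z)) t"
  have "range (\<lambda>z. x (p z)) \<subseteq> X" using x by auto
  then have "Poly_Mapping.keys s \<subseteq> X \<times> P" unfolding s_def by (rule keys_tmap[OF _ p(2)])
  then have s: "s \<in> tensor_sub X P" using teq2_refl unfolding tensor_sub_def by blast
  have "p z - x (p z) \<in> P" for z using p(2) x(2) X(2) by (intro subspace_diff[OF P]) auto
  then have "range (\<lambda>z. p z - x (p z)) \<subseteq> P" "range (\<lambda>z. y (p z)) \<subseteq> Y" using y by auto
  then have s': "Poly_Mapping.keys s' \<subseteq> P \<times> Y" unfolding s'_def by (rule keys_tmap)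
  have "teq2 (t - s) s'"
  proof (rule teq2_by_ev2)
    fix f g assume f: "fnl f" and g: "fnl g"
    have "fnl (\<lambda>z. f (p z) - f (x (p z)))" "fnl (\<lambda>z. g (p z) - g (y (p z)))"
      by (intro fnl_minus fnl_comp[OF f] fnl_comp[OF g] lin_comp[OF x(1) p(1)] lin_comp[OF y(1) p(1)] p(1))+
    moreover have "p z = z" if "z \<in> X \<or> z \<in> Y" for z using that p(3) X(2) Y(2) by blast
    ultimately have "perp X (\<lambda>z. f (p z) - f (x (p z)))" "perp Y (\<lambda>z. g (p z) - g (y (p z)))"
      using x(3) y(3) by (simp_all add: perp_def)
    then have "ev2 (\<lambda>z. f (p z) - f (x (p z))) (\<lambda>z. g (p z) - g (y (p z))) t = 0" by (rule XY)
    moreover have "ev2 f g t = ev2 (\<lambda>x. f (p x)) (\<lambda>x. g (p x)) t"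
      by (rule ev2_projection[OF f g p(1,3) left right])
    ultimately show "ev2 f g (t - s) = ev2 f g s'"
      by (simp add: ev2_diff s_def s'_def ev2_tmap fnl_diff[OF f] ev2_minus_left ev2_minus_right algebra_simps)
  qed
  with s' have "t - s \<in> tensor_sub P Y" by (auto simp: tensor_sub_def)
  with s show ?thesis by (metis add_diff_cancel_left' diff_add_cancel add.commute set_plus_intro)
qed

end

section \<open>From representatives to Sweedler form\<close>

context coalgebra
begin

text \<open>The scalars of the formal sum are absorbed into the first tensor factor.\<close>

definition terms :: "'h \<Rightarrow> ('h \<times> 'h) list" where
  "terms x = map (\<lambda>k. (Poly_Mapping.lookup (\<Delta> x) k *s fst k, snd k))
     (SOME ks. distinct ks \<and> set ks = Poly_Mapping.keys (\<Delta> x))"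

lemma sweed_terms:
  assumes "\<And>b. lin (\<lambda>a. B a b)"
  shows "sweed (terms x) B = lin_ext scale (\<lambda>(a, b). B a b) (\<Delta> x)"
proof -
  define ks where "ks = (SOME ks. distinct ks \<and> set ks = Poly_Mapping.keys (\<Delta> x))"
  have "\<exists>ks. distinct ks \<and> set ks = Poly_Mapping.keys (\<Delta> x)"
    using finite_distinct_list[OF finite_keys] by metis
  then have ks: "distinct ks \<and> set ks = Poly_Mapping.keys (\<Delta> x)"
    unfolding ks_def by (rule someI_ex)
  have "sweed (terms x) B = sum_list (map (\<lambda>k. B (Poly_Mapping.lookup (\<Delta> x) k *s fst k) (snd k)) ks)"
    by (simp add: sweed_def terms_def ks_def[symmetric] o_def)
  also have "\<dots> = (\<Sum>k\<in>Poly_Mapping.keys (\<Delta> x). B (Poly_Mapping.lookup (\<Delta> x) k *s fst k) (snd k))"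
    using ks by (simp add: sum_list_distinct_conv_sum_set)
  finally show ?thesis by (simp add: lin_ext_def split_def lin_scale[OF assms])
qed

lemma lin_sweed_terms: "bilin B \<Longrightarrow> lin (\<lambda>x. sweed (terms x) B)"
proof (rule linI)
  assume B: "bilin B"
  note eq = sweed_terms[OF bilinD(1)[OF B]] and v = vector_space_axioms
  show "sweed (terms (x + y)) B = sweed (terms x) B + sweed (terms y) B" for x y
    unfolding eq using teq2_bilin[OF B comult_add] by (simp add: lin_ext_add[OF v])
  show "sweed (terms (c *s x)) B = c *s sweed (terms x) B" for c x
    unfolding eq using teq2_bilin[OF B comult_scale] by (simp add: lin_ext_fscale[OF v])
qed

sublocale sc: sweedler_coalgebra scale terms \<epsilon>
proof
  show "bilin B \<Longrightarrow> lin (\<lambda>x. sweed (terms x) B)" for B by (rule lin_sweed_terms)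
  show fe: "fnl \<epsilon>" using counit_linear by (simp add: fnl_linear)
  show "sweed (terms x) (\<lambda>a b. \<epsilon> a *s b) = x" for x
    by (subst sweed_terms) (auto simp: counit_left intro: lin_fscale fe)
  show "sweed (terms x) (\<lambda>a b. \<epsilon> b *s a) = x" for x
    by (subst sweed_terms) (auto simp: counit_right intro: lin_cscale lin_id)
  fix T :: "'h \<Rightarrow> 'h \<Rightarrow> 'h \<Rightarrow> 'h" and x
  assume T: "\<And>b c. lin (\<lambda>a. T a b c)" "\<And>a c. lin (\<lambda>b. T a b c)" "\<And>a b. lin (\<lambda>c. T a b c)"
  note v = vector_space_axioms
  have "sweed (terms x) (\<lambda>a b. sweed (terms a) (\<lambda>c d. T c d b)) =
      lin_ext scale (\<lambda>(a, b). lin_ext scale (\<lambda>(c, d). T c d b) (\<Delta> a)) (\<Delta> x)"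
    by (subst sweed_terms, intro lin_sweed_terms bilinI T) (simp add: sweed_terms[OF T(1)])
  also have "\<dots> = lin_ext scale (\<lambda>(a, b, c). T a b c)
      (lin_ext fscale (\<lambda>(a, b). lin_ext fscale (\<lambda>(a', a''). gen (a', a'', b)) (\<Delta> a)) (\<Delta> x))"
    by (simp add: lin_ext_lin_ext[OF v] split_def lin_ext_gen[OF v])
  also have "\<dots> = lin_ext scale (\<lambda>(a, b, c). T a b c)
      (lin_ext fscale (\<lambda>(a, b). lin_ext fscale (\<lambda>(b', b''). gen (a, b', b'')) (\<Delta> b)) (\<Delta> x))"
    by (rule teq3_lin_ext[OF coassoc T])
  also have "\<dots> = lin_ext scale (\<lambda>(a, b). lin_ext scale (\<lambda>(c, d). T a c d) (\<Delta> b)) (\<Delta> x)"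
    by (simp add: lin_ext_lin_ext[OF v] split_def lin_ext_gen[OF v])
  also have "\<dots> = sweed (terms x) (\<lambda>a b. sweed (terms b) (\<lambda>c d. T a c d))"
    by (subst sweed_terms, intro lin_sweed_fun T) (simp add: sweed_terms[OF T(2)])
  finally show "sweed (terms x) (\<lambda>a b. sweed (terms a) (\<lambda>c d. T c d b)) =
      sweed (terms x) (\<lambda>a b. sweed (terms b) (\<lambda>c d. T a c d))" .
qed

section \<open>Translation of subcoalgebras, wedges, links and components\<close>

lemma ev2_comult:
  assumes "fnl f" "fnl g" shows "ev2 f g (\<Delta> x) = g (sc.L f x)" "ev2 f g (\<Delta> x) = f (sc.R g x)"
proof -
  have "sc.L f x = lin_ext scale (\<lambda>(a, b). f a *s b) (\<Delta> x)"
    unfolding sc.L_def by (rule sweed_terms) (rule lin_fscale[OF assms(1)])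
  then show 1: "ev2 f g (\<Delta> x) = g (sc.L f x)"
    by (simp add: ev2_def lin_ext_def split_def fnl_sum[OF assms(2)] fnl_scale[OF assms(2)] mult.assoc)
  show "ev2 f g (\<Delta> x) = f (sc.R g x)"
    using sc.conv_R[OF assms, of x] by (simp add: 1 sc.conv_def)
qed

lemma subcoalgebra_iff: "subcoalgebra P \<longleftrightarrow> sc.sub P"
proof
  assume P: "subcoalgebra P"
  then have sP: "subspace P" and D: "\<And>x. x \<in> P \<Longrightarrow> \<Delta> x \<in> tensor_sub P P"
    by (auto simp: subcoalgebra_def)
  have "sc.L f x \<in> P" if "x \<in> P" "fnl f" for x f
    using ev2_tensor_sub_right[OF D[OF that(1)] that(2)] that(2)
    by (intro mem_by_perp[OF sP]) (simp add: ev2_comult(1)[symmetric] sc.perp_fnl)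
  moreover have "sc.R f x \<in> P" if "x \<in> P" "fnl f" for x f
    using ev2_tensor_sub_left[OF D[OF that(1)] _ that(2)] that(2)
    by (intro mem_by_perp[OF sP]) (simp add: ev2_comult(2)[symmetric] sc.perp_fnl)
  ultimately show "sc.sub P" using sP by (simp add: sc.sub_def)
next
  assume P: "sc.sub P"
  have "\<Delta> x \<in> tensor_sub P P" if x: "x \<in> P" for x
  proof (rule mem_tensor_sub[OF sc.sub_subspace[OF P]])
    fix f g
    show "perp P f \<Longrightarrow> fnl g \<Longrightarrow> ev2 f g (\<Delta> x) = 0"
      using sc.perp_L[OF P _ x] by (simp add: ev2_comult(1) sc.perp_fnl fnl_0)
    show "fnl f \<Longrightarrow> perp P g \<Longrightarrow> ev2 f g (\<Delta> x) = 0"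
      using sc.perp_R[OF P _ x] by (simp add: ev2_comult(2) sc.perp_fnl fnl_0)
  qed
  then show "subcoalgebra P" using sc.sub_subspace[OF P] by (simp add: subcoalgebra_def)
qed

lemma simple_subcoalgebra_iff: "simple_subcoalgebra C \<longleftrightarrow> sc.simple C"
  by (simp add: simple_subcoalgebra_def sc.simple_def subcoalgebra_iff)

lemma coradical_eq: "coradical = sc.corad"
  by (simp add: coradical_def sc.corad_def simple_subcoalgebra_iff)

lemma wedge_eq:
  assumes P: "sc.sub P" and X: "subspace X" "X \<subseteq> P" and Y: "subspace Y" "Y \<subseteq> P"
  shows "wedge P X Y = P \<inter> sc.wg X Y"
proof (intro equalityI subsetI)
  fix h assume "h \<in> wedge P X Y"
  then have h: "h \<in> P" and "\<Delta> h \<in> tensor_sub X P + tensor_sub P Y" by (auto simp: wedge_def)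
  then obtain s t where st: "\<Delta> h = s + t" "s \<in> tensor_sub X P" "t \<in> tensor_sub P Y"
    by (auto elim: set_plus_elim)
  have "g (sc.L f h) = 0" if "perp X f" "perp Y g" for f g
    using that ev2_tensor_sub_left[OF st(2) that(1)] ev2_tensor_sub_right[OF st(3) _ that(2)]
      ev2_comult(1)[of f g h] by (simp add: sc.perp_fnl st(1) ev2_add)
  with h show "h \<in> P \<inter> sc.wg X Y" by (simp add: sc.wg_def)
next
  fix h assume h: "h \<in> P \<inter> sc.wg X Y"
  have "\<Delta> h \<in> tensor_sub X P + tensor_sub P Y"
  proof (rule mem_tensor_sum[OF sc.sub_subspace[OF P] X Y])
    fix f g
    show "perp P f \<Longrightarrow> fnl g \<Longrightarrow> ev2 f g (\<Delta> h) = 0"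
      using sc.perp_L[OF P, of f h] h by (simp add: ev2_comult(1) sc.perp_fnl fnl_0)
    show "fnl f \<Longrightarrow> perp P g \<Longrightarrow> ev2 f g (\<Delta> h) = 0"
      using sc.perp_R[OF P, of g h] h by (simp add: ev2_comult(2) sc.perp_fnl fnl_0)
    show "perp X f \<Longrightarrow> perp Y g \<Longrightarrow> ev2 f g (\<Delta> h) = 0"
      using h by (simp add: ev2_comult(1) sc.perp_fnl sc.wg_def)
  qed
  with h show "h \<in> wedge P X Y" by (simp add: wedge_def)
qed

lemma directly_linked_iff:
  assumes P: "sc.sub P" and C: "sc.simple C" "C \<subseteq> P" and E: "sc.simple E" "E \<subseteq> P"
  shows "directly_linked P C E \<longleftrightarrow> \<not> (P \<inter> sc.wg C E \<subseteq> C + E \<and> P \<inter> sc.wg E C \<subseteq> C + E)"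
proof -
  note sC = sc.simple_sub[OF C(1)] and sE = sc.simple_sub[OF E(1)]
  note vC = sc.sub_subspace[OF sC] and vE = sc.sub_subspace[OF sE]
  let ?V = "P \<inter> sc.wg C E" and ?W = "P \<inter> sc.wg E C"
  have sV: "sc.sub ?V" and sW: "sc.sub ?W" using sc.sub_Int[OF P sc.sub_wg] sC sE by auto
  note V = sc.sub_subspace[OF sV] and W = sc.sub_subspace[OF sW]
  have "C \<subseteq> ?V" "E \<subseteq> ?V"
    using C E sc.subset_wg1[OF sC vE] sc.subset_wg2[OF sE vC] by auto
  then have 1: "C + E \<subseteq> ?V + ?W"
    using sumset_subset[OF V] subset_sumset1[OF W, of ?V] by blast
  have 2: "?V + ?W \<subseteq> C + E \<longleftrightarrow> ?V \<subseteq> C + E \<and> ?W \<subseteq> C + E"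
    using sumset_subset[OF subspace_sumset[OF vC vE], of ?V ?W]
      subset_sumset1[OF W, of ?V] subset_sumset2[OF V, of ?W] by blast
  show ?thesis
    unfolding directly_linked_def wedge_eq[OF P vC C(2) vE E(2)] wedge_eq[OF P vE E(2) vC C(2)]
      psubset_eq using 1 2 by blast
qed

lemma linked_imp_linkrel:
  assumes P: "sc.sub P" and "linked P C E" shows "(C, E) \<in> sc.linkrel"
proof -
  obtain n :: nat and F where F: "\<And>i. i \<le> n \<Longrightarrow> sc.simple (F i) \<and> F i \<subseteq> P" "F 0 = C" "F n = E"
      "\<And>i. i < n \<Longrightarrow> directly_linked P (F i) (F (Suc i))"
    using assms(2) unfolding linked_def simple_subcoalgebra_iff by blast
  have "(C, F i) \<in> sc.linkrel" if "i \<le> n" for i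
    using that
  proof (induction i)
    case 0 then show ?case by (simp add: F(2) sc.linkrel_def)
  next
    case (Suc i)
    then have "sc.simple (F i)" "sc.simple (F (Suc i))" "sc.dl (F i) (F (Suc i))"
      using F(1)[of i] F(1)[of "Suc i"] F(4)[of i] directly_linked_iff[OF P, of "F i" "F (Suc i)"]
      by (auto simp: sc.dl_def)
    with Suc show ?case by (auto simp: sc.linkrel_def intro: rtrancl_into_rtrancl)
  qed
  then show ?thesis using F(3) by blast
qed

text \<open>Wedges of simple subcoalgebras of \<open>comp T\<close> already lie in
  \<open>comp T\<close>, so no direct link of \<open>H\<close> is lost there, and a chain of links
  starting in \<open>T\<close> never leaves it.\<close>

lemma linked_comp:
  assumes T: "sc.link_closed T" and C: "sc.simple C" "C \<in> T" and CE: "(C, E) \<in> sc.linkrel"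
  shows "linked (sc.comp T) C E"
proof -
  let ?P = "sc.comp T"
  obtain n F where F: "F 0 = C" "F n = E"
      "\<And>i. i < n \<Longrightarrow> sc.simple (F i) \<and> sc.simple (F (Suc i)) \<and> sc.dl (F i) (F (Suc i))"
    using CE unfolding sc.linkrel_def rtrancl_power relpow_fun_conv by auto
  have mem: "sc.simple (F i) \<and> F i \<in> T" if "i \<le> n" for i
    using that
  proof (induction i)
    case 0 then show ?case using C F(1) by simp
  next
    case (Suc i) then show ?case using F(3)[of i] T by (auto simp: sc.link_closed_def)
  qed
  then have sub: "sc.simple (F i) \<and> F i \<subseteq> ?P" if "i \<le> n" for i
    using that sc.simple_subset_comp by blast
  have "directly_linked ?P (F i) (F (Suc i))" if i: "i < n" for i
  proof -
    have s: "sc.simple (F i)" "F i \<subseteq> ?P" "sc.simple (F (Suc i))" "F (Suc i) \<subseteq> ?P"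
      using sub[of i] sub[of "Suc i"] i by auto
    have "sc.wg (F i) (F (Suc i)) \<subseteq> ?P" "sc.wg (F (Suc i)) (F i) \<subseteq> ?P"
      using sc.wg_comp s sc.simple_sub by auto
    then show ?thesis
      using F(3)[OF i] unfolding directly_linked_iff[OF sc.sub_comp s] sc.dl_def by blast
  qed
  with sub F(1,2) show ?thesis unfolding linked_def simple_subcoalgebra_iff by blast
qed

lemma link_indecomposable_comp:
  assumes "sc.simple C" shows "link_indecomposable (sc.comp (sc.cls C))"
  unfolding link_indecomposable_def subcoalgebra_iff simple_subcoalgebra_iff
proof (intro conjI allI impI sc.sub_comp)
  fix E G
  assume "sc.simple E \<and> E \<subseteq> sc.comp (sc.cls C) \<and> sc.simple G \<and> G \<subseteq> sc.comp (sc.cls C)"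
  then have E: "sc.simple E" "E \<in> sc.cls C" and G: "G \<in> sc.cls C"
    using sc.simple_subset_comp by auto
  have "(E, G) \<in> sc.linkrel"
    using sc.linkrel_trans[OF sc.linkrel_sym, of C E G] E G by (simp add: sc.cls_def)
  then show "linked (sc.comp (sc.cls C)) E G" by (rule linked_comp[OF sc.link_closed_cls E])
qed

lemma link_indecomposable_subset:
  assumes C: "sc.simple C" "C \<subseteq> Q" and Q: "link_indecomposable Q"
  shows "Q \<subseteq> sc.comp (sc.cls C)"
proof (rule sc.subset_comp)
  show sQ: "sc.sub Q" using Q by (simp add: link_indecomposable_def subcoalgebra_iff)
  fix E assume E: "sc.simple E" "E \<subseteq> Q"
  then have "linked Q C E" using C Q by (simp add: link_indecomposable_def simple_subcoalgebra_iff)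
  then show "E \<in> sc.cls C" using linked_imp_linkrel[OF sQ] E(1) by (simp add: sc.cls_def)
qed

text \<open>A link-indecomposable subcoalgebra containing \<open>C\<close> has all its simple
  subcoalgebras in the class of \<open>C\<close>, hence lies in \<open>comp (cls C)\<close>. As the
  latter is itself link-indecomposable, it is the only maximal one, and the definite description
  denotes it.\<close>

lemma component_of_eq:
  assumes C: "sc.simple C" shows "component_of C = sc.comp (sc.cls C)"
  unfolding component_of_def
proof (rule the_equality)
  note CP = sc.simple_subset_comp_cls[OF C] and P = link_indecomposable_comp[OF C]
  show "link_component (sc.comp (sc.cls C)) \<and> C \<subseteq> sc.comp (sc.cls C)"
    unfolding link_component_def using CP P link_indecomposable_subset[OF C] by blast
  fix Q assume "link_component Q \<and> C \<subseteq> Q"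
  then show "Q = sc.comp (sc.cls C)"
    unfolding link_component_def using P link_indecomposable_subset[OF C, of Q] by blast
qed

end

section \<open>The given Hopf algebra as an instance\<close>

context hopf_algebra
begin

sublocale sh: sweedler_hopf scale terms \<epsilon> "(*)" 1 S
proof
  note v = vector_space_axioms
  show bm: "bilin (*)"
    by (auto intro!: bilinI linI simp: distrib_left distrib_right mult_scale_left mult_scale_right)
  show lS: "lin S" using antipode_linear by (simp add: lin_linear)
  show "\<epsilon> (x * y) = \<epsilon> x * \<epsilon> y" "\<epsilon> 1 = 1" for x y by (rule counit_mult counit_one)+
  show "sweed (terms x) (\<lambda>a b. S a * b) = \<epsilon> x *s 1" for x
    by (subst sweed_terms) (auto simp: antipode_left intro: lin_comp[OF bilinD(1)[OF bm] lS])
  show "sweed (terms x) (\<lambda>a b. a * S b) = \<epsilon> x *s 1" for x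
    by (subst sweed_terms) (auto simp: antipode_right intro: bilinD(1)[OF bm])
  fix B :: "'h \<Rightarrow> 'h \<Rightarrow> 'h" and x y assume B: "bilin B"
  show "sweed (terms 1) B = B 1 1"
    using teq2_bilin[OF B comult_one] by (simp add: sweed_terms[OF bilinD(1)[OF B]] lin_ext_gen[OF v])
  have Bl: "lin (\<lambda>a. B (a * c) d)" for c d
    by (rule lin_comp[OF bilinD(1)[OF B] bilinD(1)[OF bm]])
  have Bl': "lin (\<lambda>a. B (c * a) d)" for c d
    by (rule lin_comp[OF bilinD(1)[OF B] bilinD(2)[OF bm]])
  have "sweed (terms (x * y)) B = lin_ext scale (\<lambda>(a, b). B a b) (\<Delta> (x * y))"
    by (rule sweed_terms[OF bilinD(1)[OF B]])
  also have "\<dots> = lin_ext scale (\<lambda>(a, b). lin_ext scale (\<lambda>(c, d). B (a * c) (b * d)) (\<Delta> y)) (\<Delta> x)"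
    using teq2_bilin[OF B comult_mult[of x y]]
    by (simp add: lin_ext_lin_ext[OF v] split_def lin_ext_gen[OF v])
  also have "\<dots> = sweed (terms x) (\<lambda>a b. sweed (terms y) (\<lambda>c d. B (a * c) (b * d)))"
    by (subst sweed_terms, intro lin_sweed_fun Bl) (simp add: sweed_terms[OF Bl'])
  finally show "sweed (terms (x * y)) B = sweed (terms x) (\<lambda>a b. sweed (terms y) (\<lambda>c d. B (a * c) (b * d)))" .
qed (simp_all add: mult.assoc)

lemma subspace_prod_eq: "subspace_prod X Y = sh.prd X Y"
  by (simp add: subspace_prod_def sh.prd_def)

lemma unit_component_eq: "unit_component = sc.comp (sc.cls sh.one_coalg)"
  using component_of_eq[OF sh.simple_one] by (simp add: unit_component_def sh.one_coalg_def)

theorem component_products: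
  assumes dual_chevalley
  shows "simple_subcoalgebra C \<Longrightarrow> component_of C = subspace_prod C unit_component"
    and "simple_subcoalgebra C \<Longrightarrow> component_of C = subspace_prod unit_component C"
    and "simple_subcoalgebra C \<Longrightarrow> simple_subcoalgebra E \<Longrightarrow>
      subspace_prod (component_of C) (component_of E) \<subseteq>
      span (\<Union>{component_of G |G. simple_subcoalgebra G \<and> G \<subseteq> subspace_prod C E})"
    and "hopf_subalgebra unit_component"
proof -
  interpret dc: sweedler_dual_chevalley scale terms \<epsilon> "(*)" 1 S
    using assms by unfold_locales (auto simp: dual_chevalley_def hopf_subalgebra_def coradical_eq)
  note [simp] = simple_subcoalgebra_iff component_of_eq subspace_prod_eq unit_component_eq
  show "simple_subcoalgebra C \<Longrightarrow> component_of C = subspace_prod C unit_component"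
    using dc.comp_eq_prd[of C] by simp
  show "simple_subcoalgebra C \<Longrightarrow> component_of C = subspace_prod unit_component C"
    using dc.comp_eq_prd'[of C] by simp
  show "subspace_prod (component_of C) (component_of E) \<subseteq>
      span (\<Union>{component_of G |G. simple_subcoalgebra G \<and> G \<subseteq> subspace_prod C E})"
    if "simple_subcoalgebra C" "simple_subcoalgebra E"
  proof -
    have "{component_of G |G. sc.simple G \<and> G \<subseteq> sh.prd C E} =
        {sc.comp (sc.cls G) |G. sc.simple G \<and> G \<subseteq> sh.prd C E}"
      using component_of_eq by metis
    with dc.prd_comp_subset[of C E] that show ?thesis by simp
  qed
  show "hopf_subalgebra unit_component"
    using dc.prd_comp_one dc.S_comp_one dc.one_mem_comp sh.mul_mem_prd
    by (auto simp: hopf_subalgebra_def subcoalgebra_iff sc.sub_comp)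
qed

end

theorem theorem1p1:
  fixes scale :: "'k::field \<Rightarrow> 'h::ring_1 \<Rightarrow> 'h"
    and \<Delta> :: "'h \<Rightarrow> (('h \<times> 'h) \<Rightarrow>\<^sub>0 'k)"
    and \<epsilon> :: "'h \<Rightarrow> 'k"
    and S :: "'h \<Rightarrow> 'h"
  assumes "hopf_algebra scale \<Delta> \<epsilon> S"
    and "hopf_algebra.dual_chevalley scale \<Delta> S"
  shows "(\<forall>C. coalgebra.simple_subcoalgebra scale \<Delta> C \<longrightarrow>
            coalgebra.component_of scale \<Delta> C =
              hopf_algebra.subspace_prod scale C (hopf_algebra.unit_component scale \<Delta>) \<and>
            coalgebra.component_of scale \<Delta> C =
              hopf_algebra.subspace_prod scale (hopf_algebra.unit_component scale \<Delta>) C)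
       \<and> (\<forall>C D. coalgebra.simple_subcoalgebra scale \<Delta> C \<and>
                coalgebra.simple_subcoalgebra scale \<Delta> D \<longrightarrow>
            hopf_algebra.subspace_prod scale
                (coalgebra.component_of scale \<Delta> C) (coalgebra.component_of scale \<Delta> D)
              \<subseteq> module.span scale
                  (\<Union>{coalgebra.component_of scale \<Delta> E | E.
                      coalgebra.simple_subcoalgebra scale \<Delta> E \<and>
                      E \<subseteq> hopf_algebra.subspace_prod scale C D}))
       \<and> hopf_algebra.hopf_subalgebra scale \<Delta> S (hopf_algebra.unit_component scale \<Delta>)"
proof -
  interpret hopf_algebra scale \<Delta> \<epsilon> S by fact
  show ?thesis
    using component_products[OF assms(2)] by (intro conjI allI impI) auto
qed

end
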